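(* Let $\alpha\in(0,1)$, $\beta\in(0,1]$, $N>4\beta$, $\gamma\in\mathbb{R}$ and $p\in[1,\infty]$, and put $p_{\rm c}=N/(N-2\beta)$ and $q_{\rm c}(p)=\dfrac{N}{2\beta+\frac Np}$. Let $f:\mathbb{R}^N\times[0,\infty)\to\mathbb{R}$ be measurable and suppose that there is $C_0>0$ with $$\|f(\cdot,t)\|_{L^1(\mathbb{R}^N)}\le \frac{C_0}{(1+t)^{\gamma}}\qquad\text{for all } t\ge 0 .$$ If $p\ge p_{\rm c}$, suppose in addition that there are $q\in(q_{\rm c}(p),\infty]$ and $C_1>0$ with (the same $\gamma$) $$\|f(\cdot,t)\|_{L^q(\mathbb{R}^N)}\le C_1(1+t)^{-\gamma}\qquad\text{for all } t\ge0 .$$ Let $u$ be the mild solution of $\partial_t^\alpha u+(-\Delta)^\beta u=f$ in $\mathbb{R}^N\times(0,\infty)$, $u(\cdot,0)=0$. Then for every compact set $K\subset\mathbb{R}^N$ there are constants $C>0$ and $t_0\ge 2$ such that for all $t\ge t_0$ $$\|u(\cdot,t)\|_{L^p(K)}\le C\,\Phi(t),\qquad \Phi(t):=\begin{cases} t^{-\gamma},&\gamma\le 1+\alpha,\\ t^{-(1+\alpha)},&\gamma\ge 1+\alpha. \end{cases}$$ These estimates are sharp: for all $\alpha\in(0,1)$, $\beta\in(0,1]$, $N>4\beta$, $\gamma\in\mathbb{R}$, $p\in[1,\infty]$ and every compact set $K\subset\mathbb{R}^N$ of positive Lebesgue measure there exist a measurable function $f:\mathbb{R}^N\times[0,\infty)\to\mathbb{R}$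 satisfying, for some $C_0>0$, $\|f(\cdot,t)\|_{L^1(\mathbb{R}^N)}\le C_0(1+t)^{-\gamma}$ for all $t\ge0$ and, if $p\ge p_{\rm c}$, also, for some $q\in(q_{\rm c}(p),\infty]$ and $C_1>0$, $\|f(\cdot,t)\|_{L^q(\mathbb{R}^N)}\le C_1(1+t)^{-\gamma}$ for all $t\ge0$, and constants $c>0$, $t_1\ge2$ such that the corresponding mild solution $u$ satisfies $\|u(\cdot,t)\|_{L^p(K)}\ge c\,\Phi(t)$ for all $t\ge t_1$.
   Context: $N$ is a positive integer (the space dimension), and $1/p=0$ when $p=\infty$. $\partial_t^\alpha$, $\alpha\in(0,1)$, is the Caputo derivative, defined for smooth functions by $$\partial_t^\alpha u(x,t)=\frac1{\Gamma(1-\alpha)}\,\partial_t\int_0^t\frac{u(x,\tau)-u(x,0)}{(t-\tau)^{\alpha}}\,{\rm d}\tau,$$ and $(-\Delta)^\beta=\mathcal{F}^{-1}(|\cdot|^{2\beta}\mathcal{F})$, with $\mathcal{F}$ the Fourier transform in space. Kernel $Y$: let $Z$ be the fundamental solution, i.e. the solution of $\partial_t^\alpha Z+(-\Delta)^\beta Z=0$ in $\mathbb{R}^N\times(0,\infty)$ with $Z(\cdot,0)=\delta_0$ (Dirac mass at the origin), and $Y(x,t)=\partial_t^{1-\alpha}Z(x,t)$ for $x\ne0$, $t>0$ (where $Z(x,0)=0$ for $x\neq 0$). Equivalently, $Y(\cdot,t)\in L^1(\mathbb{R}^N)$ is the function with $\int_{\mathbb{R}^N}e^{-ix\cdot\xi}Y(x,t)\,{\rm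 d}x=t^{\alpha-1}E_{\alpha,\alpha}(-|\xi|^{2\beta}t^\alpha)$ for $t>0$, where $E_{\alpha,\alpha}(z)=\sum_{k\ge0}z^k/\Gamma(\alpha k+\alpha)$. The function $Y$ is nonnegative. The mild solution of $\partial_t^\alpha u+(-\Delta)^\beta u=f$ in $\mathbb{R}^N\times(0,\infty)$, $u(\cdot,0)=0$, is the function $$u(x,t)=\int_0^t\int_{\mathbb{R}^N}Y(x-y,t-s)f(y,s)\,{\rm d}y\,{\rm d}s .$$ *)

theory Defs
  imports "HOL-Analysis.Analysis" "HOL-Probability.Essential_Supremum"
begin

definition mittag_leffler :: "real \<Rightarrow> real \<Rightarrow> real \<Rightarrow> real" where
  "mittag_leffler a b z = (\<Sum>k. z ^ k / Gamma (a * real k + b))"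

text \<open>
  The kernel \<open>Y = \<partial>\<^sub>t\<^sup>1\<^sup>-\<^sup>\<alpha> Z\<close>, where \<open>Z\<close> is the fundamental solution of
  \<open>\<partial>\<^sub>t\<^sup>\<alpha> Z + (-\<Delta>)\<^sup>\<beta> Z = 0\<close>, is described through its spatial Fourier transform, which
  determines each \<open>Y(\<cdot>,t)\<close> up to a null set. A predicate is used rather than a choice of
  representative; the mild solution below does not depend on the (Borel) representative.
  Nonnegativity is a known property of the kernel, so the last clause singles out nothing further.
  Values of \<open>Y\<close> at times \<open>t \<le> 0\<close> are unconstrained.
\<close>

definition is_kernel_Y :: "real \<Rightarrow> real \<Rightarrow> ('a::euclidean_space \<Rightarrow> real \<Rightarrow> real) \<Rightarrow> bool" where
  "is_kernel_Y \<alpha> \<beta> Y \<longleftrightarrow>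
     set_borel_measurable borel (UNIV \<times> {0<..}) (\<lambda>(x, t). Y x t) \<and>
     (\<forall>t>0. integrable lborel (\<lambda>x. Y x t) \<and>
        (\<forall>\<xi>. (LINT x|lborel. cis (- (x \<bullet> \<xi>)) * complex_of_real (Y x t)) =
              complex_of_real (t powr (\<alpha> - 1) *
                mittag_leffler \<alpha> \<alpha> (- (norm \<xi> powr (2 * \<beta>)) * t powr \<alpha>))) \<and>
        (AE x in lborel. 0 \<le> Y x t))"

definition mild_solution ::
    "('a::euclidean_space \<Rightarrow> real \<Rightarrow> real) \<Rightarrow> ('a \<Rightarrow> real \<Rightarrow> real) \<Rightarrow> 'a \<Rightarrow> real \<Rightarrow> real" where
  "mild_solution Y f x t =
     (LINT s|lebesgue_on {0<..<t}. (LINT y|lebesgue. Y (x - y) (t - s) * f y s))"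

text \<open>
  The norm of \<open>L\<^sup>p(A)\<close> for \<open>p \<in> [1,\<infinity>]\<close>. As for \<^const>\<open>esssup\<close>, it is \<open>\<infinity>\<close> on functions that are
  not Lebesgue measurable on \<open>A\<close>, so that a finite bound on the norm includes measurability.
\<close>

definition Lp_norm :: "ennreal \<Rightarrow> 'a::euclidean_space set \<Rightarrow> ('a \<Rightarrow> real) \<Rightarrow> ennreal" where
  "Lp_norm p A g =
     (if g \<notin> borel_measurable (lebesgue_on A) then \<infinity>
      else if p = \<infinity> then esssup (lebesgue_on A) (\<lambda>x. ennreal \<bar>g x\<bar>)
      else let I = (\<integral>\<^sup>+ x. ennreal (\<bar>g x\<bar> powr enn2real p) \<partial>lebesgue_on A)
           in if I = \<infinity> then \<infinity> else ennreal (enn2real I powr (1 / enn2real p)))"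

definition p_crit :: "nat \<Rightarrow> real \<Rightarrow> real" where
  "p_crit N \<beta> = real N / (real N - 2 * \<beta>)"

text \<open>In \<^typ>\<open>ennreal\<close>, \<open>inverse \<infinity> = 0\<close>, as required by the convention \<open>1/p = 0\<close> for \<open>p = \<infinity>\<close>.\<close>

definition q_crit :: "nat \<Rightarrow> real \<Rightarrow> ennreal \<Rightarrow> real" where
  "q_crit N \<beta> p = real N / (2 * \<beta> + real N * enn2real (inverse p))"

definition admissible_source ::
    "real \<Rightarrow> real \<Rightarrow> ennreal \<Rightarrow> ('a::euclidean_space \<Rightarrow> real \<Rightarrow> real) \<Rightarrow> bool" where
  "admissible_source \<beta> \<gamma> p f \<longleftrightarrow>
     (\<lambda>(x, t). f x t) \<in> borel_measurable (lebesgue_on (UNIV \<times> {0..})) \<and>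
     (\<exists>C0>0. \<forall>t\<ge>0. Lp_norm 1 UNIV (\<lambda>x. f x t) \<le> ennreal (C0 / (1 + t) powr \<gamma>)) \<and>
     (ennreal (p_crit DIM('a) \<beta>) \<le> p \<longrightarrow>
        (\<exists>q C1. ennreal (q_crit DIM('a) \<beta> p) < q \<and> C1 > 0 \<and>
           (\<forall>t\<ge>0. Lp_norm q UNIV (\<lambda>x. f x t) \<le> ennreal (C1 * (1 + t) powr (- \<gamma>)))))"

definition decay_rate :: "real \<Rightarrow> real \<Rightarrow> real \<Rightarrow> real" where
  "decay_rate \<alpha> \<gamma> t = (if \<gamma> \<le> 1 + \<alpha> then t powr (- \<gamma>) else t powr (- (1 + \<alpha>)))"

text \<open>
  Since the Bochner integral is \<open>0\<close> where it does not converge, an estimate of the mild solution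
  has content only together with the absolute convergence of the integral defining it.
\<close>

definition mild_solution_converges ::
    "('a::euclidean_space \<Rightarrow> real \<Rightarrow> real) \<Rightarrow> ('a \<Rightarrow> real \<Rightarrow> real) \<Rightarrow> real \<Rightarrow> bool" where
  "mild_solution_converges Y f t \<longleftrightarrow>
     (AE x in lebesgue. integrable (lebesgue_on (UNIV \<times> {0<..<t}))
        (\<lambda>(y, s). Y (x - y) (t - s) * f y s))"

end

theory Submission
  imports Defs "HOL-Probability.Probability" "HOL-Real_Asymp.Real_Asymp"
begin

text \<open>
  The kernel \<open>Y(\<cdot>,t)\<close> is a positive mixture of Gaussian heat kernels, and every property of it that
  the theorem needs can be read off the Laplace transform of the mixing measure.

  \<^bold>\<open>The mixture.\<close> For \<open>0 < \<beta> \<le> 1\<close> the function \<open>exp(-l\<^sup>\<beta>)\<close> is the Laplace transform of a probability law on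
  the positive half-line, the one-sided \<open>\<beta>\<close>-stable law (\<open>stable_law_exists\<close>). The negative moments of
  the \<open>\<alpha>\<close>-stable variable \<open>X\<close> are quotients of Gamma values, and summing them gives
  \<open>E\<^sub>\<alpha>\<^sub>,\<^sub>\<alpha>(-z) = \<alpha> E[X\<^sup>-\<^sup>\<alpha> exp(-z X\<^sup>-\<^sup>\<alpha>)]\<close> (\<open>mittag_leffler_stable\<close>). Composing the two laws yields a finite measure \<open>Q\<close>
  on the positive half-line whose Laplace transform is \<open>E\<^sub>\<alpha>\<^sub>,\<^sub>\<alpha>(-l\<^sup>\<beta> t\<^sup>\<alpha>)\<close>. At \<open>l = |\<xi>|\<^sup>2\<close> this is, up to the
  factor \<open>t\<^sup>\<alpha>\<^sup>-\<^sup>1\<close>, the Fourier transform of \<open>Y(\<cdot>,t)\<close>; since \<open>exp(-s|\<xi>|\<^sup>2)\<close> is the Fourier transform of the heat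
  kernel at time \<open>s\<close>, Fourier uniqueness identifies \<open>Y(x,t)\<close> with \<open>t\<^sup>\<alpha>\<^sup>-\<^sup>1 \<integral> heat s x dQ(s)\<close>
  (\<open>kernel_as_mixture\<close>).

  \<^bold>\<open>Pointwise bounds.\<close> The heat kernel at \<open>x\<close> is dominated up to constants, as a function of \<open>s\<close>, both by
  \<open>|x|\<^sup>-\<^sup>N\<close> times a superposition of the exponentials \<open>exp(-s u/|x|\<^sup>2)\<close>, \<open>0 < u < 1\<close>, and by \<open>|x|\<^sup>-\<^sup>N (1 - exp(-s/|x|\<^sup>2))\<close>.
  Integrating against \<open>Q\<close> turns \<open>E\<^sub>\<alpha>\<^sub>,\<^sub>\<alpha>(-z) \<le> C z\<^sup>-\<^sup>2\<close> into \<open>Y \<le> C t\<^sup>-\<^sup>1\<^sup>-\<^sup>\<alpha> |x|\<^sup>4\<^sup>\<beta>\<^sup>-\<^sup>N\<close> (here \<open>N > 4\<beta>\<close> is what makes the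
  superposition converge) and \<open>E\<^sub>\<alpha>\<^sub>,\<^sub>\<alpha>(0) - E\<^sub>\<alpha>\<^sub>,\<^sub>\<alpha>(-z) \<le> C z\<close> into \<open>Y \<le> C t\<^sup>2\<^sup>\<alpha>\<^sup>-\<^sup>1 |x|\<^sup>-\<^sup>N\<^sup>-\<^sup>2\<^sup>\<beta>\<close> (\<open>kernel_upper\<close>). In the same way
  \<open>E\<^sub>\<alpha>\<^sub>,\<^sub>\<alpha>(-z) \<ge> c z\<^sup>-\<^sup>2\<close> for \<open>z \<ge> 1\<close> bounds the mass of \<open>Y(\<cdot>,t)\<close> in the unit ball below by \<open>c t\<^sup>-\<^sup>1\<^sup>-\<^sup>\<alpha>\<close> for \<open>t \<ge> 1\<close>
  (\<open>kernel_ball_mass\<close>).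

  \<^bold>\<open>Upper estimate.\<close> For large times the first bound is used as it stands. For small times a geometric
  mean of the two, with weight slightly above \<open>1/3\<close> on the second, trades the singularity in time for an
  integrable one, at the price of a singularity \<open>|x|\<^sup>-\<^sup>e\<close> with \<open>e\<close> slightly above \<open>N - 2\<beta>\<close>
  (\<open>kernel_dominated\<close>). So \<open>Y\<close> is dominated by a product \<open>\<omega>(t) (1 + k(x))\<close>. The threshold \<open>q\<^sub>c(p)\<close> says that \<open>f\<close> is
  bounded in some \<open>L\<^sup>m\<close> for which the exponent \<open>r\<close> of Young's inequality, \<open>1/r + 1/m = 1 + 1/p\<close>, is below
  \<open>N/(N - 2\<beta>)\<close>, and then \<open>k \<in> L\<^sup>r\<close>; for \<open>p < p\<^sub>c\<close> the \<open>L\<^sup>1\<close> bound is already of this kind. One application of Jensen's inequality in space-time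
  (\<open>convolution_Lp\<close>) plays the roles of both Young's and Minkowski's inequality and reduces the claim
  to the scalar estimate \<open>\<integral>\<^sub>0\<^sup>t \<omega>(t-s) (1+s)\<^sup>-\<^sup>\<gamma> ds \<le> C \<Phi>(t)\<close> (\<open>time_convolution\<close>).

  \<^bold>\<open>Sharpness.\<close> The source \<open>(1+s)\<^sup>-\<^sup>\<gamma>\<close> times the indicator of a large ball attains both rates: what it emits
  shortly before time \<open>t\<close> contributes \<open>t\<^sup>-\<^sup>\<gamma>\<close>, and what it emits during the first unit of time
  contributes \<open>t\<^sup>-\<^sup>1\<^sup>-\<^sup>\<alpha>\<close> through the mass of the kernel in the unit ball.
\<close>

section \<open>One-sided stable laws\<close>

text \<open>
  The Sibuya distribution: its generating function is \<open>1 - (1 - z)\<^sup>\<beta>\<close>. Sums of \<open>n\<close> independent copies,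
  divided by \<open>n\<^sup>1\<^sup>/\<^sup>\<beta>\<close>, are discrete approximations of the \<open>\<beta>\<close>-stable law, because
  \<open>(1 - (1 - exp(-l n\<^sup>-\<^sup>1\<^sup>/\<^sup>\<beta>))\<^sup>\<beta>)\<^sup>n\<close> tends to \<open>exp(-l\<^sup>\<beta>)\<close>.
\<close>

definition sibuya_coeff :: "real \<Rightarrow> nat \<Rightarrow> real" where
  "sibuya_coeff \<beta> k = (if k = 0 then 0 else (-1)^(k+1) * (\<beta> gchoose k))"

lemma sibuya_coeff_nonneg:
  assumes "0 < \<beta>" "\<beta> < 1" shows "0 \<le> sibuya_coeff \<beta> k"
proof (induction k)
  case 0 then show ?case by (simp add: sibuya_coeff_def)
next
  case (Suc k)
  show ?case
  proof (cases "k = 0")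
    case True then show ?thesis using assms by (simp add: sibuya_coeff_def)
  next
    case False
    have "real (Suc k) * (\<beta> gchoose Suc k) = (\<beta> - real k) * (\<beta> gchoose k)"
      using gbinomial_mult_1[of \<beta> k] by (simp add: algebra_simps)
    hence "(-1)^k * (real (Suc k) * (\<beta> gchoose Suc k)) = (-1)^k * ((\<beta> - real k) * (\<beta> gchoose k))"
      by simp
    hence "real (Suc k) * sibuya_coeff \<beta> (Suc k) = (real k - \<beta>) * sibuya_coeff \<beta> k"
      using False by (simp add: sibuya_coeff_def algebra_simps)
    moreover have "0 \<le> (real k - \<beta>) * sibuya_coeff \<beta> k"
      using Suc False assms by (intro mult_nonneg_nonneg) auto
    ultimately have "0 \<le> real (Suc k) * sibuya_coeff \<beta> (Suc k)" by simp
    thus ?thesis by (simp add: zero_le_mult_iff)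
  qed
qed

lemma sibuya_generating_function:
  assumes "0 \<le> z" "z < 1"
  shows "(\<lambda>k. sibuya_coeff \<beta> k * z ^ k) sums (1 - (1 - z) powr \<beta>)"
proof -
  have "(\<lambda>n. (\<beta> gchoose n) * (-z)^n) sums (1 + (-z)) powr \<beta>"
    by (rule gen_binomial_real) (use assms in auto)
  moreover have "(\<lambda>n. if n = 0 then 1 else 0::real) sums 1"
    using sums_single[of 0 "\<lambda>_. 1::real"] by simp
  ultimately have "(\<lambda>n. (if n = 0 then 1 else 0) - (\<beta> gchoose n) * (-z)^n) sums (1 - (1 + (-z)) powr \<beta>)"
    by (intro sums_diff)
  moreover have "(if n = 0 then 1 else 0) - (\<beta> gchoose n) * (-z)^n = sibuya_coeff \<beta> n * z ^ n" for n
    by (simp add: sibuya_coeff_def power_minus[of z])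
  ultimately show ?thesis by simp
qed

text \<open>
  Abel's argument: the coefficients are nonnegative, so letting \<open>z\<close> increase to \<open>1\<close> in the generating
  function bounds the partial sums above and the full sum below.
\<close>

lemma sibuya_coeff_sums_1:
  assumes "0 < \<beta>" "\<beta> < 1" shows "sibuya_coeff \<beta> sums 1"
proof -
  have le: "(\<Sum>k<n. sibuya_coeff \<beta> k) \<le> 1" for n
  proof (rule tendsto_upperbound)
    show "((\<lambda>z. \<Sum>k<n. sibuya_coeff \<beta> k * z ^ k) \<longlongrightarrow> (\<Sum>k<n. sibuya_coeff \<beta> k)) (at_left 1)"
    proof -
      have "((\<lambda>z. \<Sum>k<n. sibuya_coeff \<beta> k * z ^ k) \<longlongrightarrow> (\<Sum>k<n. sibuya_coeff \<beta> k * 1 ^ k)) (at_left 1)"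
        by (intro tendsto_intros)
      thus ?thesis by simp
    qed
    show "\<forall>\<^sub>F z in at_left 1. (\<Sum>k<n. sibuya_coeff \<beta> k * z ^ k) \<le> 1"
    proof -
      have "\<forall>\<^sub>F z in at_left (1::real). z \<in> {0<..<1}" 
        using eventually_at_left_real[of 0 1] by simp
      then show ?thesis
      proof eventually_elim
        case (elim z)
        hence "(\<Sum>k<n. sibuya_coeff \<beta> k * z ^ k) \<le> 1 - (1 - z) powr \<beta>"
          using sibuya_generating_function[of z \<beta>] sibuya_coeff_nonneg[OF assms]
          by (intro sum_le_suminf[THEN order_trans]) (auto simp: sums_iff)
        also have "\<dots> \<le> 1" by simp
        finally show ?case .
      qed
    qed
  qed simp
  have sm: "summable (sibuya_coeff \<beta>)"
    by (rule summableI_nonneg_bounded[of _ 1]) (use sibuya_coeff_nonneg[OF assms] le in auto)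
  have "suminf (sibuya_coeff \<beta>) \<le> 1" using sm le by (rule suminf_le_const)
  moreover have "1 \<le> suminf (sibuya_coeff \<beta>)"
  proof (rule tendsto_upperbound)
    show "((\<lambda>z. 1 - (1 - z) powr \<beta>) \<longlongrightarrow> 1) (at_left (1::real))"
    proof -
      have "((\<lambda>z. 1 - (1 - z) powr \<beta>) \<longlongrightarrow> 1 - (1 - 1) powr \<beta>) (at_left (1::real))"
        using assms by (intro tendsto_intros) (auto simp: eventually_at_filter)
      thus ?thesis by simp
    qed
    have "\<forall>\<^sub>F z in at_left (1::real). z \<in> {0<..<1}" 
      using eventually_at_left_real[of 0 1] by simp
    then show "\<forall>\<^sub>F z in at_left 1. 1 - (1 - z) powr \<beta> \<le> suminf (sibuya_coeff \<beta>)"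
    proof eventually_elim
      case (elim z)
      hence g: "(\<lambda>k. sibuya_coeff \<beta> k * z ^ k) sums (1 - (1 - z) powr \<beta>)"
        by (intro sibuya_generating_function) auto
      have "sibuya_coeff \<beta> k * z ^ k \<le> sibuya_coeff \<beta> k" for k
        using sibuya_coeff_nonneg[OF assms, of k] elim by (simp add: mult_left_le power_le_one)
      hence "(\<Sum>k. sibuya_coeff \<beta> k * z ^ k) \<le> suminf (sibuya_coeff \<beta>)"
        using g sm by (intro suminf_le) (auto simp: sums_iff)
      thus ?case using g by (simp add: sums_iff)
    qed
  qed simp
  ultimately show ?thesis using sm by (simp add: sums_iff)
qed

lemma sibuya_pmf:
  assumes "0 < \<beta>" "\<beta> < 1"
  obtains P :: "nat pmf" where
    "\<And>z. 0 \<le> z \<Longrightarrow> z < 1 \<Longrightarrow> (\<integral>\<^sup>+k. ennreal (z ^ k) \<partial>measure_pmf P) = ennreal (1 - (1 - z) powr \<beta>)"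
proof
  have 1: "(\<integral>\<^sup>+x. ennreal (sibuya_coeff \<beta> x) \<partial>count_space UNIV) = 1"
    using sibuya_coeff_sums_1[OF assms] sibuya_coeff_nonneg[OF assms]
    by (simp add: nn_integral_count_space_nat suminf_ennreal2 sums_iff)
  fix z :: real assume z: "0 \<le> z" "z < 1"
  have pm: "pmf (embed_pmf (sibuya_coeff \<beta>)) x = sibuya_coeff \<beta> x" for x
    by (rule pmf_embed_pmf[OF sibuya_coeff_nonneg[OF assms] 1])
  have "(\<integral>\<^sup>+k. ennreal (z ^ k) \<partial>measure_pmf (embed_pmf (sibuya_coeff \<beta>)))
      = (\<integral>\<^sup>+k. ennreal (sibuya_coeff \<beta> k * z ^ k) \<partial>count_space UNIV)"
    by (subst nn_integral_measure_pmf) (simp add: pm ennreal_mult' sibuya_coeff_nonneg[OF assms])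
  also have "\<dots> = ennreal (1 - (1 - z) powr \<beta>)"
    using sibuya_generating_function[OF z, of \<beta>] z sibuya_coeff_nonneg[OF assms]
    by (simp add: nn_integral_count_space_nat suminf_ennreal2 sums_iff)
  finally show "(\<integral>\<^sup>+k. ennreal (z ^ k) \<partial>measure_pmf (embed_pmf (sibuya_coeff \<beta>))) = ennreal (1 - (1 - z) powr \<beta>)" .
qed

lemma sibuya_sum_pmf:
  assumes "0 < \<beta>" "\<beta> < 1"
  obtains S :: "nat \<Rightarrow> nat pmf" where
    "\<And>n z. 0 \<le> z \<Longrightarrow> z < 1 \<Longrightarrow>
       (\<integral>\<^sup>+k. ennreal (z ^ k) \<partial>measure_pmf (S n)) = ennreal ((1 - (1 - z) powr \<beta>) ^ n)"
proof -
  obtain P :: "nat pmf" where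
    P: "\<And>z. 0 \<le> z \<Longrightarrow> z < 1 \<Longrightarrow> (\<integral>\<^sup>+k. ennreal (z ^ k) \<partial>measure_pmf P) = ennreal (1 - (1 - z) powr \<beta>)"
    using sibuya_pmf[OF assms] by blast
  define S where "S = rec_nat (return_pmf 0) (\<lambda>n Q. map_pmf (\<lambda>(a,b). a + b) (pair_pmf Q P))"
  have "(\<integral>\<^sup>+k. ennreal (z ^ k) \<partial>measure_pmf (S n)) = ennreal ((1 - (1 - z) powr \<beta>) ^ n)"
    if z: "0 \<le> z" "z < 1" for n z
  proof (induction n)
    case 0 then show ?case by (simp add: S_def)
  next
    case (Suc n)
    have le: "(1 - z) powr \<beta> \<le> 1" using z assms by (intro powr_le1) auto
    have "(\<integral>\<^sup>+k. ennreal (z ^ k) \<partial>measure_pmf (S (Suc n)))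
       = (\<integral>\<^sup>+a. \<integral>\<^sup>+b. ennreal (z ^ a) * ennreal (z ^ b) \<partial>measure_pmf P \<partial>measure_pmf (S n))"
      using z by (simp add: S_def nn_integral_pair_pmf' power_add ennreal_mult)
    also have "\<dots> = ennreal ((1 - (1 - z) powr \<beta>) ^ n) * ennreal (1 - (1 - z) powr \<beta>)"
      using Suc P[OF z] by (simp add: nn_integral_cmult nn_integral_multc)
    also have "\<dots> = ennreal ((1 - (1 - z) powr \<beta>) ^ Suc n)"
      using le by (simp add: ennreal_mult'' mult.commute)
    finally show ?case .
  qed
  thus thesis by (rule that)
qed

lemma sibuya_laplace_limit:
  assumes "0 < \<beta>" "\<beta> < 1" "0 < l"
  shows "(\<lambda>n. (1 - (1 - exp (-(l * real (Suc n) powr (-1/\<beta>)))) powr \<beta>) ^ Suc n) \<longlonglongrightarrow> exp (-(l powr \<beta>))"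
proof -
  have "((\<lambda>n. (1 - (1 - exp (-(l * real n powr (-1/\<beta>)))) powr \<beta>) ^ n) \<longlongrightarrow> exp (-(l powr \<beta>))) sequentially"
    using assms by real_asymp
  from LIMSEQ_Suc[OF this] show ?thesis .
qed

lemma stable_law_approximants:
  assumes "0 < \<beta>" "\<beta> < 1"
  obtains \<mu> :: "nat \<Rightarrow> real measure" where
    "\<And>n. real_distribution (\<mu> n)" "\<And>n. AE x in \<mu> n. 0 \<le> x"
    "\<And>n l. 0 < l \<Longrightarrow> (\<integral>x. exp (-(l * max x 0)) \<partial>\<mu> n)
        = (1 - (1 - exp (-(l * real (Suc n) powr (-1/\<beta>)))) powr \<beta>) ^ Suc n"
proof -
  obtain S :: "nat \<Rightarrow> nat pmf" where
    S: "\<And>n z. 0 \<le> z \<Longrightarrow> z < 1 \<Longrightarrow>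
       (\<integral>\<^sup>+k. ennreal (z ^ k) \<partial>measure_pmf (S n)) = ennreal ((1 - (1 - z) powr \<beta>) ^ n)"
    using sibuya_sum_pmf[OF assms] by blast
  define h where "h n = real (Suc n) powr (-1/\<beta>)" for n
  have h0: "0 < h n" for n by (simp add: h_def)
  define \<mu> where "\<mu> n = distr (measure_pmf (S (Suc n))) borel (\<lambda>k. real k * h n)" for n
  show thesis
  proof (rule that)
    show "real_distribution (\<mu> n)" for n
      unfolding \<mu>_def real_distribution_def real_distribution_axioms_def
      by (auto intro!: measure_pmf.prob_space_distr)
    show "AE x in \<mu> n. 0 \<le> x" for n
      unfolding \<mu>_def using h0[of n]
      by (subst AE_distr_iff) (auto simp: less_imp_le)
    fix n and l :: real assume l: "0 < l"
    define z where "z = exp (-(l * h n))"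
    have z: "0 \<le> z" "z < 1" using l h0[of n] by (auto simp: z_def)
    have le: "(1 - z) powr \<beta> \<le> 1" using z assms by (intro powr_le1) auto
    have "(\<integral>x. exp (-(l * max x 0)) \<partial>\<mu> n) = (\<integral>k. exp (-(l * max (real k * h n) 0)) \<partial>measure_pmf (S (Suc n)))"
      unfolding \<mu>_def by (subst integral_distr) auto
    also have "\<dots> = (\<integral>k. z ^ k \<partial>measure_pmf (S (Suc n)))"
    proof (rule Bochner_Integration.integral_cong[OF refl])
      fix k :: nat
      have "max (real k * h n) 0 = real k * h n" using h0[of n] by (simp add: less_imp_le)
      thus "exp (-(l * max (real k * h n) 0)) = z ^ k"
        unfolding z_def exp_of_nat_mult[symmetric] by (simp add: algebra_simps)
    qed
    also have "\<dots> = (1 - (1 - z) powr \<beta>) ^ Suc n"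
      using S[OF z, of "Suc n"] z le
      by (subst integral_eq_nn_integral) auto
    finally show "(\<integral>x. exp (-(l * max x 0)) \<partial>\<mu> n)
        = (1 - (1 - exp (-(l * real (Suc n) powr (-1/\<beta>)))) powr \<beta>) ^ Suc n"
      by (simp add: z_def h_def)
  qed
qed

text \<open>
  By Bernoulli's inequality the approximants satisfy \<open>1 - E exp(-l X) \<le> l\<^sup>\<beta>\<close>, uniformly in \<open>n\<close>. This is the
  source of their tightness.
\<close>

lemma sibuya_laplace_lower:
  assumes "0 < \<beta>" "\<beta> < 1" "0 < l"
  shows "1 - l powr \<beta> \<le> (1 - (1 - exp (-(l * real (Suc n) powr (-1/\<beta>)))) powr \<beta>) ^ Suc n"
proof -
  define y where "y = l * real (Suc n) powr (-1/\<beta>)"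
  define w where "w = (1 - exp (-y)) powr \<beta>"
  have y: "0 < y" using assms by (simp add: y_def)
  have "1 - exp (-y) \<le> y" using exp_ge_add_one_self[of "-y"] by simp
  hence "w \<le> y powr \<beta>" unfolding w_def using y assms by (intro powr_mono2) auto
  also have "y powr \<beta> = l powr \<beta> / real (Suc n)"
  proof -
    have "(real (Suc n) powr (-1/\<beta>)) powr \<beta> = real (Suc n) powr (-1)"
      using assms by (simp only: powr_powr) simp
    also have "\<dots> = 1 / real (Suc n)" by (subst powr_minus_divide) (simp only: powr_one)
    finally show ?thesis using assms by (simp only: y_def powr_mult) simp
  qed
  finally have w: "real (Suc n) * w \<le> l powr \<beta>" by (simp add: field_simps)
  have "w \<le> 1" unfolding w_def using y assms by (intro powr_le1) auto
  hence "1 + real (Suc n) * (-w) \<le> (1 + (-w)) ^ Suc n" by (intro Bernoulli_inequality) auto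
  with w show ?thesis unfolding w_def y_def by simp
qed

text \<open>
  Tightness: \<open>1 - exp(-x/R)\<close> is at least a positive constant on \<open>x > R\<close>, so the Laplace transform at \<open>1/R\<close>
  controls the tail beyond \<open>R\<close>. Helly's selection theorem then gives a weak limit, and testing it with
  the bounded continuous functions \<open>exp(-l max x 0)\<close> computes its Laplace transform.
\<close>

lemma stable_law_limit:
  assumes \<beta>: "0 < \<beta>" "\<beta> < 1"
  obtains M :: "real measure" where "real_distribution M" 
    "\<And>l. 0 < l \<Longrightarrow> (\<integral>x. exp (-(l * max x 0)) \<partial>M) = exp (-(l powr \<beta>))"
proof -
  obtain \<mu> :: "nat \<Rightarrow> real measure" where
    \<mu>: "\<And>n. real_distribution (\<mu> n)" "\<And>n. AE x in \<mu> n. 0 \<le> x"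
    "\<And>n l. 0 < l \<Longrightarrow> (\<integral>x. exp (-(l * max x 0)) \<partial>\<mu> n)
        = (1 - (1 - exp (-(l * real (Suc n) powr (-1/\<beta>)))) powr \<beta>) ^ Suc n"
    using stable_law_approximants[OF \<beta>] by blast
  have tight: "tight \<mu>"
    unfolding tight_def
  proof (intro conjI allI impI)
    show "real_distribution (\<mu> n)" for n by fact
    fix \<epsilon> :: real assume \<epsilon>: "0 < \<epsilon>"
    define q where "q = 1 - exp (-1::real)"
    have q: "0 < q" by (simp add: q_def)
    \<comment> \<open>chosen so that the tail bound \<open>R\<^sup>-\<^sup>\<beta>/q\<close> equals \<open>\<epsilon>/2\<close>\<close>
    define R where "R = (\<epsilon> * q / 2) powr (-1/\<beta>)"
    have R: "0 < R" using \<epsilon> q by (simp add: R_def)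
    have Rp: "(1/R) powr \<beta> = \<epsilon> * q / 2"
    proof -
      have "1/R = (\<epsilon> * q / 2) powr (1/\<beta>)" by (simp add: R_def powr_minus_divide)
      hence "(1/R) powr \<beta> = (\<epsilon> * q / 2) powr (1/\<beta> * \<beta>)" by (simp only: powr_powr)
      thus ?thesis using \<epsilon> q \<beta> by simp
    qed
    have "1 - \<epsilon> < measure (\<mu> n) {-1<..R}" for n
    proof -
      interpret real_distribution "\<mu> n" by (rule \<mu>)
      have int: "integrable (\<mu> n) (\<lambda>x. exp (-(1/R * max x 0)))"
        using R by (intro integrable_const_bound[where B=1] AE_I2) auto
      have "(\<integral>x. 1 - (1 - exp (-(1/R * max x 0))) / q \<partial>\<mu> n) \<le> (\<integral>x. indicator {-1<..R} x \<partial>\<mu> n)"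
      proof (rule integral_mono_AE)
        show "AE x in \<mu> n. 1 - (1 - exp (-(1/R * max x 0))) / q \<le> indicat_real {-1<..R} x"
          using \<mu>(2)[of n]
        proof eventually_elim
          case (elim x)
          show ?case
          proof (cases "x \<le> R")
            case True
            then show ?thesis using elim q R by (auto simp: indicator_def)
          next
            case False
            hence "1 \<le> 1/R * max x 0" using R elim by (simp add: field_simps)
            hence "exp (-(1/R * max x 0)) \<le> exp (-1)" by (subst exp_le_cancel_iff) simp
            hence "q \<le> 1 - exp (-(1/R * max x 0))" by (simp add: q_def)
            thus ?thesis using q False by (simp add: field_simps)
          qed
        qed
      next
        show "integrable (\<mu> n) (indicat_real {-1<..R})"
          by (intro integrable_const_bound[where B=1] AE_I2) (auto simp: indicator_def)
      qed (use int in auto)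
      also have "(\<integral>x. indicator {-1<..R} x \<partial>\<mu> n) = measure (\<mu> n) {-1<..R}" by simp
      finally have "1 - (1 - (\<integral>x. exp (-(1/R * max x 0)) \<partial>\<mu> n)) / q \<le> measure (\<mu> n) {-1<..R}"
        using int prob_space by simp
      moreover have "1 - (\<integral>x. exp (-(1/R * max x 0)) \<partial>\<mu> n) \<le> \<epsilon> * q / 2"
        using \<mu>(3)[of "1/R" n] sibuya_laplace_lower[OF \<beta>, of "1/R" n] R Rp by simp
      hence "(1 - (\<integral>x. exp (-(1/R * max x 0)) \<partial>\<mu> n)) / q \<le> \<epsilon> / 2"
        using q by (simp add: field_simps)
      ultimately show ?thesis using \<epsilon> by linarith
    qed
    then show "\<exists>a b. a < b \<and> (\<forall>n. 1 - \<epsilon> < measure (\<mu> n) {a<..b})"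
      using R by (intro exI[of _ "-1"] exI[of _ R]) auto
  qed
  obtain r M where r: "strict_mono (r::nat\<Rightarrow>nat)" and M: "real_distribution M"
    and wc: "weak_conv_m (\<mu> \<circ> id \<circ> r) M"
    using tight_imp_convergent_subsubsequence[OF tight strict_mono_id] by blast
  show thesis
  proof (rule that[OF M])
    fix l :: real assume l: "0 < l"
    have "(\<lambda>n. \<integral>x. exp (-(l * max x 0)) \<partial>((\<mu> \<circ> id \<circ> r) n)) \<longlonglongrightarrow> (\<integral>x. exp (-(l * max x 0)) \<partial>M)"
    proof (rule weak_conv_imp_integral_bdd_continuous_conv[OF _ M wc])
      show "real_distribution ((\<mu> \<circ> id \<circ> r) n)" for n using \<mu>(1) by simp
      show "isCont (\<lambda>x. exp (-(l * max x 0))) x" for x by (intro continuous_intros)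
      show "norm (exp (-(l * max x 0))) \<le> 1" for x using l by simp
    qed
    moreover have "(\<lambda>n. \<integral>x. exp (-(l * max x 0)) \<partial>((\<mu> \<circ> id \<circ> r) n)) \<longlonglongrightarrow> exp (-(l powr \<beta>))"
      using LIMSEQ_subseq_LIMSEQ[OF sibuya_laplace_limit[OF \<beta> l] r] by (simp add: \<mu>(3)[OF l] o_def)
    ultimately show "(\<integral>x. exp (-(l * max x 0)) \<partial>M) = exp (-(l powr \<beta>))"
      by (rule LIMSEQ_unique)
  qed
qed

definition stable_law :: "real \<Rightarrow> real measure \<Rightarrow> bool" where
  "stable_law \<beta> M \<longleftrightarrow> real_distribution M \<and> (AE x in M. 0 < x) \<and>
     (\<forall>l>0. (\<integral>x. exp (-(l * x)) \<partial>M) = exp (-(l powr \<beta>)))"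

text \<open>
  The limit charges only positive numbers, since its Laplace transform, which dominates the mass of
  \<open>{..0}\<close>, vanishes at infinity. For \<open>\<beta> = 1\<close> the law is the point mass at \<open>1\<close>.
\<close>

lemma stable_law_exists:
  assumes \<beta>: "0 < \<beta>" "\<beta> \<le> 1"
  shows "\<exists>M. stable_law \<beta> M"
proof -
  have "\<exists>M. real_distribution M \<and> (\<forall>l>0. (\<integral>x. exp (-(l * max x 0)) \<partial>M) = exp (-(l powr \<beta>)))"
  proof (cases "\<beta> = 1")
    case True
    have "real_distribution (return borel (1::real))"
      unfolding real_distribution_def real_distribution_axioms_def
      by (auto intro!: prob_space_return)
    thus ?thesis using True by (intro exI[of _ "return borel 1"]) (auto simp: integral_return)
  next
    case False
    with \<beta> have "\<beta> < 1" by simp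
    from stable_law_limit[OF \<beta>(1) this] show ?thesis by metis
  qed
  then obtain M where M: "real_distribution M"
    and L: "\<And>l. 0 < l \<Longrightarrow> (\<integral>x. exp (-(l * max x 0)) \<partial>M) = exp (-(l powr \<beta>))" by blast
  interpret real_distribution M by fact
  have "measure M {..0} \<le> exp (-(l powr \<beta>))" if l: "0 < l" for l
  proof -
    have "(\<integral>x. indicator {..0} x \<partial>M) \<le> (\<integral>x. exp (-(l * max x 0)) \<partial>M)"
      using l by (intro integral_mono integrable_const_bound[where B=1] AE_I2) (auto simp: indicator_def)
    thus ?thesis using L[OF l] by simp
  qed
  moreover have "((\<lambda>l. exp (-(l powr \<beta>))) \<longlongrightarrow> 0) at_top" using \<beta> by real_asymp
  ultimately have "measure M {..0} \<le> 0"
    by (intro tendsto_lowerbound[of "\<lambda>l. exp (-(l powr \<beta>))" 0 at_top])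
       (auto intro: eventually_mono[OF eventually_gt_at_top[of 0]])
  hence m0: "measure M {..0} = 0" by (simp add: measure_le_0_iff)
  have pos: "AE x in M. 0 < x"
  proof (rule AE_I)
    show "{x \<in> space M. \<not> 0 < x} \<subseteq> {..0}" by auto
    show "emeasure M {..0} = 0" using m0 by (simp add: emeasure_eq_measure)
  qed simp
  have "(\<integral>x. exp (-(l * x)) \<partial>M) = exp (-(l powr \<beta>))" if l: "0 < l" for l
  proof -
    have "(\<integral>x. exp (-(l * x)) \<partial>M) = (\<integral>x. exp (-(l * max x 0)) \<partial>M)"
    proof (rule integral_cong_AE)
      show "AE x in M. exp (-(l * x)) = exp (-(l * max x 0))"
        using pos by eventually_elim (simp add: max_def)
    qed simp_all
    thus ?thesis using L[OF l] by simp
  qed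
  with M pos show ?thesis unfolding stable_law_def by blast
qed

section \<open>The Mittag-Leffler function and negative moments of stable laws\<close>

text \<open>
  Concavity of \<open>1 - exp(-y)\<close>. Via this bound, estimates for expectations of functions like \<open>min 1 (X/A)\<close>
  reduce to the Laplace transform \<open>E[1 - exp(-X/A)] = 1 - exp(-A\<^sup>-\<^sup>\<alpha>)\<close>.
\<close>

lemma one_minus_exp_ge:
  assumes "0 \<le> (y::real)" shows "(1 - exp (-1)) * min 1 y \<le> 1 - exp (-y)"
proof (cases "y \<le> 1")
  case True
  have "exp ((1 - y) *\<^sub>R 0 + y *\<^sub>R (-1)) \<le> (1 - y) * exp 0 + y * exp (-1::real)"
    using convex_onD[OF exp_convex, of y 0 "-1"] assms True by simp
  thus ?thesis using True by (simp add: algebra_simps)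
next
  case False
  then show ?thesis by simp
qed

lemma powr_times_exp_bounded:
  assumes "0 < (\<kappa>::real)" "0 < v" shows "v powr \<kappa> * exp (-v) \<le> \<kappa> powr \<kappa>"
proof -
  have "v / \<kappa> \<le> exp (v / \<kappa>)" using exp_ge_add_one_self[of "v/\<kappa>"] by linarith
  hence "v \<le> \<kappa> * exp (v / \<kappa>)" using assms by (simp add: field_simps)
  hence "v powr \<kappa> \<le> (\<kappa> * exp (v / \<kappa>)) powr \<kappa>" using assms by (intro powr_mono2) auto
  also have "\<dots> = \<kappa> powr \<kappa> * exp v" using assms by (simp add: powr_mult exp_powr_real)
  finally show ?thesis using assms by (simp add: exp_minus field_simps)
qed

text \<open>
  The Gamma integral after the substitution \<open>u = c s\<^sup>\<alpha>\<close>.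
\<close>

lemma nn_integral_powr_exp:
  assumes "0 < \<alpha>" "0 < \<rho>" "0 < (c::real)"
  shows "(\<integral>\<^sup>+s. ennreal (indicator {0<..} s * (s powr (\<rho> - 1) * exp (-(c * s powr \<alpha>)))) \<partial>lborel)
       = ennreal (c powr (-\<rho>/\<alpha>) * Gamma (\<rho>/\<alpha>) / \<alpha>)"
proof -
  define f where "f u = u powr (\<rho>/\<alpha> - 1) * exp (-u)" for u :: real
  define g where "g s = c * s powr \<alpha>" for s :: real
  define g' where "g' s = c * (\<alpha> * s powr (\<alpha> - 1))" for s :: real
  have f0: "f u \<ge> 0" for u by (simp add: f_def)
  have pos: "0 < \<rho>/\<alpha>" using assms by simp
  have "(f has_integral Gamma (\<rho>/\<alpha>)) {0..}"
    using Gamma_integral_real[OF pos] unfolding f_def exp_minus divide_inverse[symmetric] .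
  hence "((\<lambda>x. if x \<in> {0<..} then f x else 0) has_integral Gamma (\<rho>/\<alpha>)) {0..}"
    by (rule has_integral_spike[of "{0}", rotated 2]) auto
  hence hi: "(f has_integral Gamma (\<rho>/\<alpha>)) {0<..}"
    by (subst (asm) has_integral_restrict) auto
  hence ai: "f absolutely_integrable_on {0<..}"
    by (intro nonnegative_absolutely_integrable_1) (use f0 in auto)
  have img: "g ` {0<..} = {0<..}"
  proof (intro equalityI subsetI)
    fix y :: real assume "y \<in> {0<..}"
    hence "y = g ((y/c) powr (1/\<alpha>))" "(y/c) powr (1/\<alpha>) \<in> {0<..}"
      using assms by (auto simp: g_def powr_powr)
    thus "y \<in> g ` {0<..}" by blast
  qed (use assms in \<open>auto simp: g_def\<close>)
  have "(\<lambda>x. \<bar>g' x\<bar> * f (g x)) absolutely_integrable_on {0<..} \<and>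
        integral {0<..} (\<lambda>x. \<bar>g' x\<bar> * f (g x)) = Gamma (\<rho>/\<alpha>)"
  proof (rule has_absolute_integral_change_of_variables_1'[where S="{0<..}" and g=g and g'=g' and f=f, THEN iffD2])
    show "(g has_field_derivative g' x) (at x within {0<..})" if "x \<in> {0<..}" for x
    proof -
      have "((\<lambda>s. s powr \<alpha>) has_field_derivative \<alpha> * x powr (\<alpha> - 1)) (at x within {0<..})"
        using has_real_derivative_powr[of x \<alpha>] that by (auto intro: has_field_derivative_at_within)
      from DERIV_cmult[OF this, of c] show ?thesis unfolding g_def g'_def .
    qed
    show "inj_on g {0<..}"
    proof (rule inj_on_inverseI)
      show "(g s / c) powr (1/\<alpha>) = s" if "s \<in> {0<..}" for s
        using assms that by (simp add: g_def powr_powr)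
    qed
    show "f absolutely_integrable_on g ` {0<..} \<and> integral (g ` {0<..}) f = Gamma (\<rho>/\<alpha>)"
      using ai hi unfolding img by (auto simp: integral_unique)
  qed simp
  hence "((\<lambda>x. \<bar>g' x\<bar> * f (g x)) has_integral Gamma (\<rho>/\<alpha>)) {0<..}"
    using set_lebesgue_integral_eq_integral(1) by (metis has_integral_integral)
  hence "((\<lambda>x. (c powr (-\<rho>/\<alpha>) / \<alpha>) * (\<bar>g' x\<bar> * f (g x))) has_integral (c powr (-\<rho>/\<alpha>) / \<alpha> * Gamma (\<rho>/\<alpha>))) {0<..}"
    by (rule has_integral_mult_right)
  moreover have "(c powr (-\<rho>/\<alpha>) / \<alpha>) * (\<bar>g' s\<bar> * f (g s)) = s powr (\<rho> - 1) * exp (-(c * s powr \<alpha>))" if "s \<in> {0<..}" for s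
  proof -
    have s: "0 < s" using that by simp
    have e: "(s powr \<alpha>) powr (\<rho>/\<alpha> - 1) = s powr (\<rho> - \<alpha>)"
      using assms by (simp add: powr_powr algebra_simps)
    have "c powr (-\<rho>/\<alpha>) * (c * c powr (\<rho>/\<alpha> - 1)) = c powr (-\<rho>/\<alpha>) * (c powr 1 * c powr (\<rho>/\<alpha> - 1))"
      using assms by simp
    also have "\<dots> = c powr (-\<rho>/\<alpha> + (1 + (\<rho>/\<alpha> - 1)))" by (simp only: powr_add)
    also have "-\<rho>/\<alpha> + (1 + (\<rho>/\<alpha> - 1)) = 0" by simp
    finally have c: "c powr (-\<rho>/\<alpha>) * (c * c powr (\<rho>/\<alpha> - 1)) = 1" using assms by simp
    have sp: "s powr (\<alpha> - 1) * s powr (\<rho> - \<alpha>) = s powr (\<rho> - 1)"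
      by (simp add: powr_add[symmetric])
    have "(c powr (-\<rho>/\<alpha>) / \<alpha>) * (\<bar>g' s\<bar> * f (g s)) =
       (c powr (-\<rho>/\<alpha>) * (c * c powr (\<rho>/\<alpha> - 1))) * (s powr (\<alpha> - 1) * s powr (\<rho> - \<alpha>)) * exp (-(c * s powr \<alpha>))"
      using assms s by (simp add: f_def g_def g'_def powr_mult e)
    thus ?thesis unfolding c sp by simp
  qed
  ultimately have "((\<lambda>s. s powr (\<rho> - 1) * exp (-(c * s powr \<alpha>))) has_integral (c powr (-\<rho>/\<alpha>) / \<alpha> * Gamma (\<rho>/\<alpha>))) {0<..}"
    by (rule has_integral_eq[rotated]) 
  from nn_integral_has_integral_lebesgue[OF _ this] show ?thesis by (simp add: mult_ac)
qed

text \<open>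
  Write \<open>\<Gamma>(\<rho>) x\<^sup>-\<^sup>\<rho>\<close> as the integral of \<open>s\<^sup>\<rho>\<^sup>-\<^sup>1 exp(-s x)\<close> and take the expectation inside: the inner
  expectation is \<open>exp(-s\<^sup>\<alpha>)\<close>, and a second Gamma integral remains.
\<close>

lemma stable_law_neg_moment:
  assumes M: "stable_law \<alpha> M" and "0 < \<alpha>" "0 < \<rho>"
  shows "(\<integral>\<^sup>+x. ennreal (x powr (-\<rho>)) \<partial>M) = ennreal (Gamma (\<rho>/\<alpha>) / (\<alpha> * Gamma \<rho>))"
proof -
  interpret real_distribution M using M by (simp add: stable_law_def)
  have pos: "AE x in M. 0 < x" and L: "\<And>l. 0 < l \<Longrightarrow> (\<integral>x. exp (-(l * x)) \<partial>M) = exp (-(l powr \<alpha>))"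
    using M by (auto simp: stable_law_def)
  have L': "(\<integral>\<^sup>+x. ennreal (exp (-(l * x))) \<partial>M) = ennreal (exp (-(l powr \<alpha>)))" if l: "0 < l" for l
  proof (subst nn_integral_eq_integral)
    show "integrable M (\<lambda>x. exp (-(l * x)))"
      by (rule integrable_const_bound[where B=1]) (use pos l in \<open>auto elim!: eventually_mono\<close>)
  qed (use L[OF l] in auto)
  have G: "Gamma \<rho> > 0" using assms by (intro Gamma_real_pos) auto
  have "ennreal (Gamma \<rho>) * (\<integral>\<^sup>+x. ennreal (x powr (-\<rho>)) \<partial>M)
     = (\<integral>\<^sup>+x. ennreal (x powr (-\<rho>) * Gamma \<rho>) \<partial>M)"
    using G by (subst nn_integral_cmult[symmetric]) (auto simp: ennreal_mult' mult.commute intro!: nn_integral_cong)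
  also have "\<dots> = (\<integral>\<^sup>+x. \<integral>\<^sup>+s. ennreal (indicator {0<..} s * (s powr (\<rho> - 1) * exp (-(x * s)))) \<partial>lborel \<partial>M)"
  proof (rule nn_integral_cong_AE, use pos in eventually_elim)
    case (elim x)
    have "(\<integral>\<^sup>+s. ennreal (indicator {0<..} s * (s powr (\<rho> - 1) * exp (-(x * s)))) \<partial>lborel)
       = (\<integral>\<^sup>+s. ennreal (indicator {0<..} s * (s powr (\<rho> - 1) * exp (-(x * s powr 1)))) \<partial>lborel)"
      by (intro nn_integral_cong) (auto simp: indicator_def)
    also have "\<dots> = ennreal (x powr (-\<rho>) * Gamma \<rho>)"
      using nn_integral_powr_exp[of 1 \<rho> x] elim assms by simp
    finally show ?case by simp
  qed
  also have "\<dots> = (\<integral>\<^sup>+s. \<integral>\<^sup>+x. ennreal (indicator {0<..} s * (s powr (\<rho> - 1) * exp (-(x * s)))) \<partial>M \<partial>lborel)"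
    by (rule pair_sigma_finite.Fubini'[symmetric]) (auto intro!: pair_sigma_finite.intro sigma_finite_lborel sigma_finite_measure_axioms)
  also have "\<dots> = (\<integral>\<^sup>+s. ennreal (indicator {0<..} s * (s powr (\<rho> - 1) * exp (-(1 * s powr \<alpha>)))) \<partial>lborel)"
  proof (rule nn_integral_cong)
    fix s :: real
    show "(\<integral>\<^sup>+x. ennreal (indicator {0<..} s * (s powr (\<rho> - 1) * exp (-(x * s)))) \<partial>M)
       = ennreal (indicator {0<..} s * (s powr (\<rho> - 1) * exp (-(1 * s powr \<alpha>))))"
    proof (cases "0 < s")
      case True
      then show ?thesis using L'[OF True]
        by (simp add: ennreal_mult' nn_integral_cmult mult.commute[of _ s])
    qed auto
  qed
  also have "\<dots> = ennreal (Gamma (\<rho>/\<alpha>) / \<alpha>)"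
    using nn_integral_powr_exp[of \<alpha> \<rho> 1] assms by simp
  finally have eq: "ennreal (Gamma \<rho>) * (\<integral>\<^sup>+x. ennreal (x powr (-\<rho>)) \<partial>M) = ennreal (Gamma (\<rho>/\<alpha>) / \<alpha>)" .
  have "(\<integral>\<^sup>+x. ennreal (x powr (-\<rho>)) \<partial>M) = ennreal (1 / Gamma \<rho>) * (ennreal (Gamma \<rho>) * (\<integral>\<^sup>+x. ennreal (x powr (-\<rho>)) \<partial>M))"
    using G by (simp add: mult.assoc[symmetric] ennreal_mult'[symmetric])
  also have "\<dots> = ennreal (Gamma (\<rho>/\<alpha>) / (\<alpha> * Gamma \<rho>))"
    unfolding eq using G by (subst ennreal_mult'[symmetric]) (auto simp: field_simps)
  finally show ?thesis .
qed

text \<open>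
  Superexponential growth of \<open>\<Gamma>\<close>, from the part of its integral over \<open>{R..}\<close>; it makes the Mittag-Leffler
  series converge everywhere.
\<close>

lemma Gamma_ge_powr:
  assumes "1 \<le> x" "0 \<le> R" shows "R powr (x - 1) * exp (-R) \<le> (Gamma x :: real)"
proof -
  have "ennreal (R powr (x - 1) * exp (-R)) = (\<integral>\<^sup>+t. ennreal (R powr (x - 1)) * (ennreal (exp (-t)) * indicator {R..} t) \<partial>lborel)"
  proof (subst nn_integral_cmult)
    have "((\<lambda>t. exp (-1 * t)) has_integral exp (-1 * R) / 1) {R..}"
      by (rule has_integral_exp_minus_to_infinity) simp
    hence "(\<integral>\<^sup>+t. ennreal (exp (-t)) * indicator {R..} t \<partial>lborel) = ennreal (exp (-R))"
      by (intro nn_integral_has_integral_lebesgue') auto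
    thus "ennreal (R powr (x - 1) * exp (-R)) = ennreal (R powr (x - 1)) * (\<integral>\<^sup>+t. ennreal (exp (-t)) * indicator {R..} t \<partial>lborel)"
      by (simp add: ennreal_mult')
  qed auto
  also have "\<dots> \<le> (\<integral>\<^sup>+t. ennreal (indicator {0..} t * t powr (x - 1) / exp t) \<partial>lborel)"
  proof (rule nn_integral_mono)
    fix t :: real
    show "ennreal (R powr (x - 1)) * (ennreal (exp (-t)) * indicator {R..} t) \<le> ennreal (indicator {0..} t * t powr (x - 1) / exp t)"
    proof (cases "R \<le> t")
      case True
      have "R powr (x - 1) \<le> t powr (x - 1)" using True assms by (intro powr_mono2) auto
      thus ?thesis using True assms by (simp add: ennreal_mult'[symmetric] exp_minus divide_inverse)
    qed auto
  qed
  also have "\<dots> = ennreal (Gamma x)" using Gamma_conv_nn_integral_real[of x] assms by simp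
  finally show ?thesis using Gamma_real_pos[of x] assms by (simp add: ennreal_le_iff)
qed

lemma mittag_leffler_summable:
  assumes "0 < \<alpha>" "0 < b" "0 \<le> (z::real)"
  shows "summable (\<lambda>k. z ^ k / Gamma (\<alpha> * real k + b))"
proof -
  \<comment> \<open>with \<open>R\<^sup>\<alpha> = 2z + 1\<close> the growth of \<open>\<Gamma>\<close> gives a geometric majorant of ratio below \<open>1/2\<close>\<close>
  define R where "R = (2 * z + 1) powr (1/\<alpha>)"
  have R: "0 < R" using assms by (simp add: R_def)
  have Ra: "R powr \<alpha> = 2 * z + 1" using assms by (simp add: R_def powr_powr)
  define D where "D = exp R * R powr (1 - b)"
  have "eventually (\<lambda>k. norm (z ^ k / Gamma (\<alpha> * real k + b)) \<le> D * (1/2) ^ k) sequentially"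
  proof -
    have "eventually (\<lambda>k. real k \<ge> 1/\<alpha>) sequentially"
      by (rule eventually_compose_filterlim[OF eventually_ge_at_top filterlim_real_sequentially])
    then show ?thesis
    proof eventually_elim
      case (elim k)
      have x: "1 \<le> \<alpha> * real k + b" using elim assms by (simp add: field_simps)
      have "R powr (\<alpha> * real k + b - 1) = R powr (b - 1) * (2 * z + 1) ^ k"
      proof -
        have "(2 * z + 1) ^ k = R powr (\<alpha> * real k)"
          using R by (simp only: Ra[symmetric] powr_powr[symmetric]) (simp add: powr_realpow)
        moreover have "R powr (\<alpha> * real k + b - 1) = R powr (b - 1) * R powr (\<alpha> * real k)"
          by (simp add: powr_add[symmetric] algebra_simps)
        ultimately show ?thesis by simp
      qed
      hence G: "R powr (b - 1) * (2 * z + 1) ^ k * exp (-R) \<le> Gamma (\<alpha> * real k + b)"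
        using Gamma_ge_powr[OF x, of R] R by simp
      have p: "0 < R powr (b - 1) * (2 * z + 1) ^ k * exp (-R)" using R assms by simp
      have Gp: "0 < Gamma (\<alpha> * real k + b)" using p G by linarith
      have "z ^ k / Gamma (\<alpha> * real k + b) \<le> z ^ k / (R powr (b - 1) * (2 * z + 1) ^ k * exp (-R))"
        using G p Gp assms by (intro divide_left_mono mult_pos_pos) auto
      also have "\<dots> = D * (z / (2 * z + 1)) ^ k"
        using R by (simp add: D_def exp_minus powr_diff power_divide field_simps)
      also have "\<dots> \<le> D * (1/2) ^ k"
        using assms R by (intro mult_left_mono power_mono) (auto simp: D_def field_simps)
      finally show ?case using Gp assms by simp
    qed
  qed
  moreover have "summable (\<lambda>k. D * (1/2::real) ^ k)" by (intro summable_mult summable_geometric) auto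
  ultimately show ?thesis by (rule summable_comparison_test_ev)
qed

text \<open>
  Expanding the exponential, the \<open>k\<close>-th term has expectation \<open>(-z)\<^sup>k/k!\<close> times a negative moment of \<open>X\<close>,
  and the moment formula turns this into the \<open>k\<close>-th term of the Mittag-Leffler series.
\<close>

lemma mittag_leffler_stable:
  assumes M: "stable_law \<alpha> M" and a: "0 < \<alpha>" and z: "0 \<le> z"
  shows "integrable M (\<lambda>x. x powr (-\<alpha>) * exp (-(z * x powr (-\<alpha>))))"
    and "mittag_leffler \<alpha> \<alpha> (-z) = \<alpha> * (\<integral>x. x powr (-\<alpha>) * exp (-(z * x powr (-\<alpha>))) \<partial>M)"
proof -
  interpret real_distribution M using M by (simp add: stable_law_def)
  have pos: "AE x in M. 0 < x" using M by (auto simp: stable_law_def)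
  define m where "m k x = x powr (-(\<alpha> * (real k + 1)))" for k :: nat and x :: real
  have G: "0 < Gamma (\<alpha> * real k + \<alpha>)" for k using a by (intro Gamma_real_pos) (simp add: add_nonneg_pos)
  have mom: "(\<integral>\<^sup>+x. ennreal (m k x) \<partial>M) = ennreal (fact k / (\<alpha> * Gamma (\<alpha> * real k + \<alpha>)))" for k
  proof -
    have "\<alpha> * (real k + 1) / \<alpha> = 1 + real k" "0 < \<alpha> * real k + \<alpha>"
      using a by (simp_all add: add_nonneg_pos)
    thus ?thesis
      using stable_law_neg_moment[OF M a, of "\<alpha> * (real k + 1)"] a Gamma_fact[of k, where ?'a=real]
      by (simp add: m_def distrib_left)
  qed
  have mm [measurable]: "m k \<in> borel_measurable M" for k unfolding m_def by measurable
  have mi: "integrable M (m k)" for k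
    by (rule integrableI_nonneg) (use mom[of k] in \<open>auto simp: m_def\<close>)
  have mI: "(\<integral>x. m k x \<partial>M) = fact k / (\<alpha> * Gamma (\<alpha> * real k + \<alpha>))" for k
    using mom[of k] G[of k] a by (subst integral_eq_nn_integral) (auto simp: m_def)
  define f where "f k x = \<alpha> * ((-z) ^ k / fact k) * m k x" for k x
  have fi: "integrable M (f k)" for k unfolding f_def using mi[of k] by simp
  have fI: "(\<integral>x. f k x \<partial>M) = (-z) ^ k / Gamma (\<alpha> * real k + \<alpha>)" for k
    using a G[of k] by (simp add: f_def mI)
  have nI: "(\<integral>x. norm (f k x) \<partial>M) = z ^ k / Gamma (\<alpha> * real k + \<alpha>)" for k
  proof -
    have "(\<integral>x. norm (f k x) \<partial>M) = (\<integral>x. \<alpha> * (z ^ k / fact k) * m k x \<partial>M)"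
      using a z by (intro Bochner_Integration.integral_cong) (auto simp: f_def abs_mult m_def power_abs)
    thus ?thesis using a G[of k] by (simp add: mI)
  qed
  have mk: "m k x = x powr (-\<alpha>) * (x powr (-\<alpha>)) ^ k" if "0 < x" for k x
    using that by (simp add: m_def powr_realpow[symmetric] powr_powr powr_add[symmetric] algebra_simps)
  have fs: "(\<lambda>k. f k x) sums (\<alpha> * (x powr (-\<alpha>) * exp (-(z * x powr (-\<alpha>)))))" if "0 < x" for x
  proof -
    have "(\<lambda>k. (-(z * x powr (-\<alpha>))) ^ k /\<^sub>R fact k) sums exp (-(z * x powr (-\<alpha>)))"
      by (rule exp_converges)
    from sums_mult[OF this, of "\<alpha> * x powr (-\<alpha>)"] show ?thesis
      by (simp add: f_def mk[OF that] power_mult_distrib power_minus[of "z * _"] power_minus[of z] divide_inverse mult_ac)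
  qed
  have ns: "AE x in M. summable (\<lambda>k. norm (f k x))"
    using pos
  proof eventually_elim
    case (elim x)
    have "summable (\<lambda>k. \<alpha> * x powr (-\<alpha>) * ((z * x powr (-\<alpha>)) ^ k /\<^sub>R fact k))"
      by (intro summable_mult sums_summable[OF exp_converges])
    moreover have "norm (f k x) = \<alpha> * x powr (-\<alpha>) * ((z * x powr (-\<alpha>)) ^ k /\<^sub>R fact k)" for k
      using a z by (simp add: f_def mk[OF elim] abs_mult power_abs power_mult_distrib divide_inverse mult_ac)
    ultimately show ?case by simp
  qed
  have sI: "summable (\<lambda>k. \<integral>x. norm (f k x) \<partial>M)"
    unfolding nI by (rule mittag_leffler_summable[OF a a z])
  have AEeq: "AE x in M. (\<Sum>k. f k x) = \<alpha> * (x powr (-\<alpha>) * exp (-(z * x powr (-\<alpha>))))"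
    using pos by eventually_elim (use fs in \<open>auto simp: sums_iff\<close>)
  have "integrable M (\<lambda>x. x powr (-\<alpha>))" using mi[of 0] unfolding m_def by simp
  thus "integrable M (\<lambda>x. x powr (-\<alpha>) * exp (-(z * x powr (-\<alpha>))))"
    by (rule Bochner_Integration.integrable_bound) (use z in \<open>auto intro!: AE_I2 mult_left_le\<close>)
  have "(\<integral>x. (\<Sum>k. f k x) \<partial>M) = (\<Sum>k. \<integral>x. f k x \<partial>M)"
    by (rule integral_suminf[OF fi ns sI])
  also have "(\<Sum>k. \<integral>x. f k x \<partial>M) = mittag_leffler \<alpha> \<alpha> (-z)"
    by (simp add: fI mittag_leffler_def)
  also have "(\<integral>x. (\<Sum>k. f k x) \<partial>M) = (\<integral>x. \<alpha> * (x powr (-\<alpha>) * exp (-(z * x powr (-\<alpha>)))) \<partial>M)"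
    by (rule integral_cong_AE) (use AEeq fi in \<open>auto intro!: borel_measurable_suminf\<close>)
  finally show "mittag_leffler \<alpha> \<alpha> (-z) = \<alpha> * (\<integral>x. x powr (-\<alpha>) * exp (-(z * x powr (-\<alpha>))) \<partial>M)"
    by simp
qed

lemma stable_law_laplace:
  assumes M: "stable_law \<alpha> M" and l: "0 < l"
  shows "integrable M (\<lambda>x. exp (-(l * x)))" "(\<integral>x. exp (-(l * x)) \<partial>M) = exp (-(l powr \<alpha>))"
proof -
  interpret real_distribution M using M by (simp add: stable_law_def)
  have pos: "AE x in M. 0 < x" using M by (auto simp: stable_law_def)
  show "integrable M (\<lambda>x. exp (-(l * x)))"
    by (rule integrable_const_bound[where B=1]) (use pos l in \<open>auto elim!: eventually_mono\<close>)
  show "(\<integral>x. exp (-(l * x)) \<partial>M) = exp (-(l powr \<alpha>))" using M l by (auto simp: stable_law_def)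
qed

text \<open>
  With \<open>v = z X\<^sup>-\<^sup>\<alpha>\<close> the right-hand side is a function of \<open>z\<^sup>-\<^sup>1\<^sup>/\<^sup>\<alpha> X\<close> whose expectation is known
  explicitly. Small \<open>X\<close> means large \<open>v\<close>, where the exponential beats every power.
\<close>

lemma times_exp_le_one_minus_exp:
  assumes "0 < \<alpha>" 
  obtains C :: real where "0 < C" "\<And>v. 0 < v \<Longrightarrow> v * exp (-v) \<le> C * (1 - exp (-(v powr (-1/\<alpha>))))"
proof -
  define q where "q = 1 - exp (-1::real)"
  have q: "0 < q" by (simp add: q_def)
  define D where "D = max 1 ((1 + 1/\<alpha>) powr (1 + 1/\<alpha>))"
  show thesis
  proof (rule that[of "D / q"])
    show "0 < D / q" using q by (simp add: D_def)
    fix v :: real assume v: "0 < v"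
    define y where "y = v powr (-1/\<alpha>)"
    have y: "0 < y" using v by (simp add: y_def)
    have "v * exp (-v) \<le> D * min 1 y"
    proof (cases "y \<ge> 1")
      case True
      have "v powr 1 * exp (-v) \<le> 1 powr 1" by (rule powr_times_exp_bounded) (use v in auto)
      thus ?thesis using True v by (simp add: D_def min_def)
    next
      case False
      have "v powr (1 + 1/\<alpha>) * exp (-v) \<le> (1 + 1/\<alpha>) powr (1 + 1/\<alpha>)"
        by (rule powr_times_exp_bounded) (use v assms in \<open>auto simp: add_pos_pos\<close>)
      hence "v powr (1 + 1/\<alpha>) * exp (-v) * y \<le> D * y" using y by (intro mult_right_mono) (auto simp: D_def)
      moreover have "v powr (1 + 1/\<alpha>) * y = v" 
        using v by (simp add: y_def powr_add[symmetric] del: powr_mult_base)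
      moreover have "v powr (1 + 1/\<alpha>) * exp (-v) * y = (v powr (1 + 1/\<alpha>) * y) * exp (-v)"
        by (simp only: mult_ac)
      ultimately show ?thesis using False by (simp add: min_def)
    qed
    also have "D * min 1 y \<le> D * ((1 - exp (-y)) / q)"
      using one_minus_exp_ge[of y] y q by (intro mult_left_mono) (auto simp: D_def q_def field_simps)
    finally show "v * exp (-v) \<le> D / q * (1 - exp (-(v powr (-1/\<alpha>))))" by (simp add: y_def)
  qed
qed

lemma mittag_leffler_nonneg:
  assumes M: "stable_law \<alpha> M" and a: "0 < \<alpha>" and z: "0 \<le> z"
  shows "0 \<le> mittag_leffler \<alpha> \<alpha> (-z)"
  unfolding mittag_leffler_stable(2)[OF assms] using a by (intro mult_nonneg_nonneg integral_nonneg_AE) auto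

text \<open>
  The integrand is \<open>z\<^sup>-\<^sup>1 v exp(-v)\<close> with \<open>v = z X\<^sup>-\<^sup>\<alpha>\<close>, and the expectation of \<open>v exp(-v)\<close> is at most a
  constant times \<open>1 - exp(-1/z) \<le> 1/z\<close>.
\<close>

lemma mittag_leffler_upper:
  assumes M: "stable_law \<alpha> M" and a: "0 < \<alpha>"
  obtains C where "0 < C" "\<And>z. 0 < z \<Longrightarrow> mittag_leffler \<alpha> \<alpha> (-z) \<le> C * z powr (-2)"
proof -
  interpret real_distribution M using M by (simp add: stable_law_def)
  have pos: "AE x in M. 0 < x" using M by (auto simp: stable_law_def)
  obtain C :: real where C: "0 < C" "\<And>v. 0 < v \<Longrightarrow> v * exp (-v) \<le> C * (1 - exp (-(v powr (-1/\<alpha>))))"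
    using times_exp_le_one_minus_exp[OF a] by blast
  show thesis
  proof (rule that[of "\<alpha> * C"])
    show "0 < \<alpha> * C" using C a by simp
    fix z :: real assume z: "0 < z"
    define l where "l = z powr (-1/\<alpha>)"
    have l: "0 < l" using z by (simp add: l_def)
    have la: "l powr \<alpha> = 1 / z"
    proof -
      have "l powr \<alpha> = z powr (-1/\<alpha> * \<alpha>)" by (simp only: l_def powr_powr)
      also have "-1/\<alpha> * \<alpha> = -1" using a by simp
      finally show ?thesis using z by (simp add: powr_minus_divide)
    qed
    have "(\<integral>x. x powr (-\<alpha>) * exp (-(z * x powr (-\<alpha>))) \<partial>M) \<le> (\<integral>x. C / z * (1 - exp (-(l * x))) \<partial>M)"
    proof (rule integral_mono_AE)
      show "integrable M (\<lambda>x. x powr (-\<alpha>) * exp (-(z * x powr (-\<alpha>))))"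
        by (rule mittag_leffler_stable(1)[OF M a]) (use z in simp)
      show "integrable M (\<lambda>x. C / z * (1 - exp (-(l * x))))"
        using stable_law_laplace(1)[OF M l] by simp
      show "AE x in M. x powr (-\<alpha>) * exp (-(z * x powr (-\<alpha>))) \<le> C / z * (1 - exp (-(l * x)))"
        using pos
      proof eventually_elim
        case (elim x)
        have "(z * x powr (-\<alpha>)) powr (-1/\<alpha>) = l * (x powr (-\<alpha>)) powr (-1/\<alpha>)"
          using z elim by (simp add: powr_mult l_def)
        also have "(x powr (-\<alpha>)) powr (-1/\<alpha>) = x" using a elim by (simp add: powr_powr)
        finally have "z * x powr (-\<alpha>) * exp (-(z * x powr (-\<alpha>))) \<le> C * (1 - exp (-(l * x)))"
          using C(2)[of "z * x powr (-\<alpha>)"] z elim by simp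
        thus ?case using z by (simp add: field_simps)
      qed
    qed
    also have "\<dots> = C / z * (1 - exp (-(1 / z)))"
      using stable_law_laplace[OF M l] prob_space by (simp add: la)
    also have "\<dots> \<le> C / z * (1 / z)"
      using C z exp_ge_add_one_self[of "-(1/z)"] by (intro mult_left_mono) auto
    also have "\<dots> = C * z powr (-2)" using z by (simp add: powr_minus_divide power2_eq_square)
    finally show "mittag_leffler \<alpha> \<alpha> (-z) \<le> \<alpha> * C * z powr (-2)"
      using a z by (simp add: mittag_leffler_stable(2)[OF M a] mult.assoc mult_left_mono)
  qed
qed

text \<open>
  From \<open>1 - exp(-v) \<le> v\<close> and the finiteness of the moment of order \<open>-2\<alpha>\<close>.
\<close>

lemma mittag_leffler_diff_zero:
  assumes M: "stable_law \<alpha> M" and a: "0 < \<alpha>"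
  obtains C where "0 < C" "\<And>z. 0 \<le> z \<Longrightarrow> mittag_leffler \<alpha> \<alpha> 0 - mittag_leffler \<alpha> \<alpha> (-z) \<le> C * z"
proof -
  interpret real_distribution M using M by (simp add: stable_law_def)
  have pos: "AE x in M. 0 < x" using M by (auto simp: stable_law_def)
  have mi: "integrable M (\<lambda>x. x powr (-(2 * \<alpha>)))"
    using stable_law_neg_moment[OF M a, of "2 * \<alpha>"] a by (intro integrableI_nonneg) auto
  define m where "m = (\<integral>x. x powr (-(2 * \<alpha>)) \<partial>M)"
  have m: "0 \<le> m" unfolding m_def by (intro integral_nonneg_AE) auto
  show thesis
  proof (rule that[of "\<alpha> * m + 1"])
    show "0 < \<alpha> * m + 1" using a m by (simp add: add_nonneg_pos)
    fix z :: real assume z: "0 \<le> z"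
    note i = mittag_leffler_stable(1)[OF M a]
    have "mittag_leffler \<alpha> \<alpha> 0 - mittag_leffler \<alpha> \<alpha> (-z)
       = \<alpha> * ((\<integral>x. x powr (-\<alpha>) * exp (-(0 * x powr (-\<alpha>))) \<partial>M) - (\<integral>x. x powr (-\<alpha>) * exp (-(z * x powr (-\<alpha>))) \<partial>M))"
      using mittag_leffler_stable(2)[OF M a z] mittag_leffler_stable(2)[OF M a, of 0] by (simp add: algebra_simps)
    also have "(\<integral>x. x powr (-\<alpha>) * exp (-(0 * x powr (-\<alpha>))) \<partial>M) - (\<integral>x. x powr (-\<alpha>) * exp (-(z * x powr (-\<alpha>))) \<partial>M)
       = (\<integral>x. x powr (-\<alpha>) * exp (-(0 * x powr (-\<alpha>))) - x powr (-\<alpha>) * exp (-(z * x powr (-\<alpha>))) \<partial>M)"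
      using i[of 0] i[OF z] by (subst Bochner_Integration.integral_diff) auto
    also have "\<dots> \<le> (\<integral>x. z * x powr (-(2 * \<alpha>)) \<partial>M)"
    proof (rule integral_mono_AE)
      show "integrable M (\<lambda>x. x powr (-\<alpha>) * exp (-(0 * x powr (-\<alpha>))) - x powr (-\<alpha>) * exp (-(z * x powr (-\<alpha>))))"
        using i[of 0] i[OF z] by (intro Bochner_Integration.integrable_diff) auto
      show "integrable M (\<lambda>x. z * x powr (-(2 * \<alpha>)))" using mi by simp
      show "AE x in M. x powr (-\<alpha>) * exp (-(0 * x powr (-\<alpha>))) - x powr (-\<alpha>) * exp (-(z * x powr (-\<alpha>))) \<le> z * x powr (-(2 * \<alpha>))"
      proof (rule AE_I2)
        fix x
        have "1 - exp (-(z * x powr (-\<alpha>))) \<le> z * x powr (-\<alpha>)"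
          using exp_ge_add_one_self[of "-(z * x powr (-\<alpha>))"] by simp
        hence "x powr (-\<alpha>) * (1 - exp (-(z * x powr (-\<alpha>)))) \<le> x powr (-\<alpha>) * (z * x powr (-\<alpha>))"
          by (rule mult_left_mono) simp
        also have "\<dots> = z * x powr (-(2 * \<alpha>))" by (simp add: powr_add[symmetric])
        finally show "x powr (-\<alpha>) * exp (-(0 * x powr (-\<alpha>))) - x powr (-\<alpha>) * exp (-(z * x powr (-\<alpha>))) \<le> z * x powr (-(2 * \<alpha>))"
          by (simp add: algebra_simps)
      qed
    qed
    also have "\<dots> = z * m" by (simp add: m_def)
    finally have "mittag_leffler \<alpha> \<alpha> 0 - mittag_leffler \<alpha> \<alpha> (-z) \<le> \<alpha> * (z * m)"
      using a by simp
    thus "mittag_leffler \<alpha> \<alpha> 0 - mittag_leffler \<alpha> \<alpha> (-z) \<le> (\<alpha> * m + 1) * z"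
      using z by (simp add: algebra_simps)
  qed
qed

text \<open>
  With \<open>y = z\<^sup>-\<^sup>1\<^sup>/\<^sup>\<alpha> X\<close> and \<open>v = y\<^sup>-\<^sup>\<alpha>\<close>, the function \<open>v exp(-v)\<close> is bounded below by a multiple of
  \<open>exp(-y) - exp(-2y)\<close> as long as \<open>y\<close> stays above a fixed \<open>\<epsilon>\<close>. The expectation of that difference is of order
  \<open>1/z\<close>. Its part on \<open>y \<le> \<epsilon>\<close> is at most \<open>\<epsilon>\<close> times a multiple of \<open>E[1 - exp(-y/\<epsilon>)]\<close>, hence of order
  \<open>\<epsilon>\<^sup>1\<^sup>-\<^sup>\<alpha>/z\<close>, which is negligible for small \<open>\<epsilon>\<close> because \<open>\<alpha> < 1\<close>.
\<close>

lemma mittag_leffler_lower: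
  assumes M: "stable_law \<alpha> M" and a: "0 < \<alpha>" "\<alpha> < 1"
  obtains c where "0 < c" "\<And>z. 1 \<le> z \<Longrightarrow> c * z powr (-2) \<le> mittag_leffler \<alpha> \<alpha> (-z)"
proof -
  interpret real_distribution M using M by (simp add: stable_law_def)
  have pos: "AE x in M. 0 < x" using M by (auto simp: stable_law_def)
  define q where "q = 1 - exp (-1::real)"
  have q: "0 < q" by (simp add: q_def)
  define c2 where "c2 = exp (-1) * (q * (2 powr \<alpha> - 1))"
  have t1: "1 < 2 powr \<alpha>" "2 powr \<alpha> < 2"
    using a powr_less_mono[of 0 \<alpha> 2] powr_less_mono[of \<alpha> 1 2] by auto
  have c2: "0 < c2" using q t1 by (simp add: c2_def)
  \<comment> \<open>makes the loss \<open>\<epsilon>\<^sup>1\<^sup>-\<^sup>\<alpha>/q\<close> on small \<open>y\<close> half of the gain \<open>c2\<close>\<close>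
  define \<epsilon> where "\<epsilon> = (c2 * q / 2) powr (1 / (1 - \<alpha>))"
  have \<epsilon>: "0 < \<epsilon>" using c2 q by (simp add: \<epsilon>_def)
  have \<epsilon>p: "\<epsilon> powr (1 - \<alpha>) = c2 * q / 2" using c2 q a by (simp add: \<epsilon>_def powr_powr)
  define c1 where "c1 = exp (-(\<epsilon> powr (-\<alpha>)))"
  have c1: "0 < c1" by (simp add: c1_def)
  have key: "c1 * (exp (-y) - exp (-(2*y)) - \<epsilon>/q * (1 - exp (-(y/\<epsilon>)))) \<le> y powr (-\<alpha>) * exp (-(y powr (-\<alpha>)))"
    if y: "0 < y" for y
  proof (cases "y \<le> \<epsilon>")
    case True
    have "exp (-y) - exp (-(2*y)) = exp (-y) * (1 - exp (-y))" by (simp add: algebra_simps exp_add[symmetric])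
    also have "\<dots> \<le> 1 * y" using y exp_ge_add_one_self[of "-y"] by (intro mult_mono) auto
    also have "1 * y = \<epsilon> * min 1 (y/\<epsilon>)" using True \<epsilon> by simp
    also have "\<epsilon> * min 1 (y/\<epsilon>) \<le> \<epsilon> * ((1 - exp (-(y/\<epsilon>))) / q)"
      using one_minus_exp_ge[of "y/\<epsilon>"] y \<epsilon> q by (intro mult_left_mono) (auto simp: q_def field_simps)
    finally have "exp (-y) - exp (-(2*y)) - \<epsilon>/q * (1 - exp (-(y/\<epsilon>))) \<le> 0" by simp
    hence "c1 * (exp (-y) - exp (-(2*y)) - \<epsilon>/q * (1 - exp (-(y/\<epsilon>)))) \<le> 0"
      using c1 by (simp add: mult_le_0_iff)
    also have "0 \<le> y powr (-\<alpha>) * exp (-(y powr (-\<alpha>)))" by simp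
    finally show ?thesis .
  next
    case False
    have "exp (-y) - exp (-(2*y)) - \<epsilon>/q * (1 - exp (-(y/\<epsilon>))) \<le> exp (-y)"
    proof -
      have "0 \<le> \<epsilon>/q * (1 - exp (-(y/\<epsilon>)))" using y \<epsilon> q by (intro mult_nonneg_nonneg) auto
      thus ?thesis using exp_ge_zero[of "-(2*y)"] by linarith
    qed
    also have "exp (-y) \<le> y powr (-\<alpha>)"
    proof -
      have "y powr \<alpha> \<le> max 1 y powr \<alpha>" using y a by (intro powr_mono2) auto
      also have "\<dots> \<le> max 1 y powr 1" using a by (intro powr_mono) auto
      also have "\<dots> \<le> 1 + y" using y by simp
      also have "\<dots> \<le> exp y" by (rule exp_ge_add_one_self)
      finally show ?thesis using y by (simp add: powr_minus exp_minus)
    qed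
    finally have 1: "exp (-y) - exp (-(2*y)) - \<epsilon>/q * (1 - exp (-(y/\<epsilon>))) \<le> y powr (-\<alpha>)" .
    have "y powr (-\<alpha>) \<le> \<epsilon> powr (-\<alpha>)" using False \<epsilon> a by (intro powr_mono2') auto
    hence 2: "c1 \<le> exp (-(y powr (-\<alpha>)))" by (simp add: c1_def)
    have "c1 * (exp (-y) - exp (-(2*y)) - \<epsilon>/q * (1 - exp (-(y/\<epsilon>)))) \<le> c1 * y powr (-\<alpha>)"
      using 1 c1 by (intro mult_left_mono) auto
    also have "\<dots> \<le> exp (-(y powr (-\<alpha>))) * y powr (-\<alpha>)" using 2 by (intro mult_right_mono) auto
    finally show ?thesis by (simp add: mult.commute)
  qed
  show thesis
  proof (rule that[of "\<alpha> * (c1 * (c2 / 2))"])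
    show "0 < \<alpha> * (c1 * (c2 / 2))" using a c1 c2 by simp
    fix z :: real assume z: "1 \<le> z"
    define l where "l = z powr (-1/\<alpha>)"
    have l: "0 < l" using z by (simp add: l_def)
    have la: "l powr \<alpha> = 1 / z"
    proof -
      have "l powr \<alpha> = z powr (-1/\<alpha> * \<alpha>)" by (simp only: l_def powr_powr)
      also have "-1/\<alpha> * \<alpha> = -1" using a by simp
      finally show ?thesis using z by (simp add: powr_minus_divide)
    qed
    have l2a: "(2 * l) powr \<alpha> = 2 powr \<alpha> / z" using l by (simp add: powr_mult la)
    have lea: "(l / \<epsilon>) powr \<alpha> = \<epsilon> powr (-\<alpha>) / z"
      using l \<epsilon> by (simp add: powr_divide la powr_minus field_simps)
    note L1 = stable_law_laplace[OF M l, unfolded la]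
    have "0 < 2 * l" using l by simp
    note L2 = stable_law_laplace[OF M this, unfolded l2a]
    have "0 < l / \<epsilon>" using l \<epsilon> by simp
    note L3 = stable_law_laplace[OF M this, unfolded lea]
    define w where "w = 1 / z"
    have w: "0 < w" "w \<le> 1" using z by (auto simp: w_def)
    have "(\<integral>x. c1 / z * (exp (-(l * x)) - exp (-(2 * l * x)) - \<epsilon>/q * (1 - exp (-(l / \<epsilon> * x)))) \<partial>M)
        \<le> (\<integral>x. x powr (-\<alpha>) * exp (-(z * x powr (-\<alpha>))) \<partial>M)"
    proof (rule integral_mono_AE)
      show "integrable M (\<lambda>x. x powr (-\<alpha>) * exp (-(z * x powr (-\<alpha>))))"
        by (rule mittag_leffler_stable(1)[OF M a(1)]) (use z in simp)
      show "integrable M (\<lambda>x. c1 / z * (exp (-(l * x)) - exp (-(2 * l * x)) - \<epsilon>/q * (1 - exp (-(l / \<epsilon> * x)))))"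
        using L1(1) L2(1) L3(1)
          by (intro integrable_mult_right Bochner_Integration.integrable_diff integrable_const) auto
      show "AE x in M. c1 / z * (exp (-(l * x)) - exp (-(2 * l * x)) - \<epsilon>/q * (1 - exp (-(l / \<epsilon> * x))))
          \<le> x powr (-\<alpha>) * exp (-(z * x powr (-\<alpha>)))"
        using pos
      proof eventually_elim
        case (elim x)
        have "(l * x) powr (-\<alpha>) = l powr (-\<alpha>) * x powr (-\<alpha>)" using l elim by (simp add: powr_mult)
        also have "l powr (-\<alpha>) = z" using la z l by (simp add: powr_minus)
        finally have "c1 * (exp (-(l * x)) - exp (-(2 * l * x)) - \<epsilon>/q * (1 - exp (-(l / \<epsilon> * x))))
          \<le> z * x powr (-\<alpha>) * exp (-(z * x powr (-\<alpha>)))"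
          using key[of "l * x"] l elim by (simp add: mult.assoc)
        thus ?case using z by (simp add: field_simps)
      qed
    qed
    also have "(\<integral>x. c1 / z * (exp (-(l * x)) - exp (-(2 * l * x)) - \<epsilon>/q * (1 - exp (-(l / \<epsilon> * x)))) \<partial>M)
       = c1 / z * (exp (-(1 / z)) - exp (-(2 powr \<alpha> / z)) - \<epsilon>/q * (1 - exp (-(\<epsilon> powr (-\<alpha>) / z))))"
      using L1 L2 L3 prob_space by simp
    finally have A: "c1 / z * (exp (-(1 / z)) - exp (-(2 powr \<alpha> / z)) - \<epsilon>/q * (1 - exp (-(\<epsilon> powr (-\<alpha>) / z))))
      \<le> (\<integral>x. x powr (-\<alpha>) * exp (-(z * x powr (-\<alpha>))) \<partial>M)" .
    have B: "c2 * w \<le> exp (-(1 / z)) - exp (-(2 powr \<alpha> / z))"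
    proof -
      have "exp (-(1 / z)) - exp (-(2 powr \<alpha> / z)) = exp (-w) * (1 - exp (-((2 powr \<alpha> - 1) * w)))"
        by (simp add: w_def algebra_simps exp_add[symmetric] diff_divide_distrib)
      also have "\<dots> \<ge> exp (-1) * (q * min 1 ((2 powr \<alpha> - 1) * w))"
        using one_minus_exp_ge[of "(2 powr \<alpha> - 1) * w"] w t1 q by (intro mult_mono) (auto simp: q_def)
      moreover have "(2 powr \<alpha> - 1) * w \<le> 1 * 1" using w t1 by (intro mult_mono) auto
      ultimately show ?thesis by (simp add: c2_def mult_ac)
    qed
    have "\<epsilon>/q * (1 - exp (-(\<epsilon> powr (-\<alpha>) / z))) \<le> \<epsilon>/q * (\<epsilon> powr (-\<alpha>) * w)"
      using \<epsilon> q exp_ge_add_one_self[of "-(\<epsilon> powr (-\<alpha>) / z)"]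
        by (intro mult_left_mono) (auto simp: w_def)
    also have "\<dots> = (\<epsilon> * \<epsilon> powr (-\<alpha>)) / q * w" by simp
    also have "\<epsilon> * \<epsilon> powr (-\<alpha>) = \<epsilon> powr (1 - \<alpha>)"
      using \<epsilon> powr_add[of \<epsilon> 1 "-\<alpha>"] by simp
    also have "\<epsilon> powr (1 - \<alpha>) / q * w = c2 / 2 * w" unfolding \<epsilon>p using q by simp
    finally have "c2 / 2 * w \<le> exp (-(1 / z)) - exp (-(2 powr \<alpha> / z)) - \<epsilon>/q * (1 - exp (-(\<epsilon> powr (-\<alpha>) / z)))"
      using B by linarith
    hence "c1 / z * (c2 / 2 * w) \<le> c1 / z * (exp (-(1 / z)) - exp (-(2 powr \<alpha> / z)) - \<epsilon>/q * (1 - exp (-(\<epsilon> powr (-\<alpha>) / z))))"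
      using c1 z by (intro mult_left_mono) auto
    with A have "c1 / z * (c2 / 2 * w) \<le> (\<integral>x. x powr (-\<alpha>) * exp (-(z * x powr (-\<alpha>))) \<partial>M)" by linarith
    hence "\<alpha> * (c1 / z * (c2 / 2 * w)) \<le> \<alpha> * (\<integral>x. x powr (-\<alpha>) * exp (-(z * x powr (-\<alpha>))) \<partial>M)"
      using a by (intro mult_left_mono) auto
    hence "\<alpha> * (c1 / z * (c2 / 2 * w)) \<le> mittag_leffler \<alpha> \<alpha> (-z)"
      using z by (simp only: mittag_leffler_stable(2)[OF M a(1)])
    moreover have "z powr (-2) = 1 / z * w" using z by (simp add: w_def powr_minus_divide power2_eq_square)
    ultimately show "\<alpha> * (c1 * (c2 / 2)) * z powr (-2) \<le> mittag_leffler \<alpha> \<alpha> (-z)"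
      by (simp add: mult_ac)
  qed
qed

section \<open>Gaussian heat kernels and uniqueness of the Fourier transform\<close>

definition heat :: "real \<Rightarrow> 'a::euclidean_space \<Rightarrow> real" where
  "heat s x = (4 * pi * s) powr (-(real DIM('a) / 2)) * exp (-((norm x)\<^sup>2 / (4 * s)))"

lemma heat_measurable [measurable]:
  "(\<lambda>(s, x). heat s x) \<in> borel_measurable (borel \<Otimes>\<^sub>M (borel :: 'a::euclidean_space measure))"
  unfolding heat_def by measurable

lemma heat_nonneg [simp]: "0 \<le> heat s x" by (simp add: heat_def)

lemma fourier_gauss_real:
  fixes k s :: real
  assumes s: "0 < s"
  shows "(\<integral>x. cis (-(x * k)) * complex_of_real (exp (-(x\<^sup>2 / (4 * s)))) \<partial>lborel)
       = complex_of_real (sqrt (4 * pi * s) * exp (-(s * k\<^sup>2)))"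
proof -
  define c where "c = sqrt (2 * s)"
  have c: "0 < c" "c\<^sup>2 = 2 * s" using s by (auto simp: c_def)
  define f where "f x = cis (-(x * k)) * complex_of_real (exp (-(x\<^sup>2 / (4 * s))))" for x
  have "char std_normal_distribution (-(c * k)) = (\<integral>y. std_normal_density y *\<^sub>R iexp (-(c * k) * y) \<partial>lborel)"
    unfolding char_def by (subst integral_density) auto
  also have "\<dots> = (\<integral>y. complex_of_real (1 / sqrt (2 * pi)) * f (0 + c * y) \<partial>lborel)"
  proof (rule Bochner_Integration.integral_cong[OF refl])
    fix y :: real
    have "(c * y)\<^sup>2 / (4 * s) = y\<^sup>2 / 2" using s c by (simp add: power_mult_distrib)
    thus "std_normal_density y *\<^sub>R iexp (-(c * k) * y) = complex_of_real (1 / sqrt (2 * pi)) * f (0 + c * y)"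
      by (simp add: f_def std_normal_density_def cis_conv_exp scaleR_conv_of_real mult_ac)
  qed
  also have "\<dots> = complex_of_real (1 / sqrt (2 * pi)) * (\<integral>y. f (0 + c * y) \<partial>lborel)" by simp
  finally have 1: "complex_of_real (1 / sqrt (2 * pi)) * (\<integral>y. f (0 + c * y) \<partial>lborel) = complex_of_real (exp (-(s * k\<^sup>2)))"
    by (simp add: char_std_normal_distribution power_mult_distrib c)
  have "(\<integral>x. f x \<partial>lborel) = \<bar>c\<bar> *\<^sub>R (\<integral>y. f (0 + c * y) \<partial>lborel)"
    using c by (intro lborel_integral_real_affine) auto
  also have "(\<integral>y. f (0 + c * y) \<partial>lborel) = complex_of_real (sqrt (2 * pi)) * complex_of_real (exp (-(s * k\<^sup>2)))"
    unfolding 1[symmetric] by (simp add: mult.assoc[symmetric] of_real_mult[symmetric] del: of_real_mult)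
  also have "\<bar>c\<bar> *\<^sub>R \<dots> = complex_of_real (c * sqrt (2 * pi) * exp (-(s * k\<^sup>2)))"
    using c by (simp add: scaleR_conv_of_real mult.assoc)
  also have "c * sqrt (2 * pi) = sqrt (4 * pi * s)" by (simp add: c_def real_sqrt_mult[symmetric] mult_ac)
  finally show ?thesis by (simp add: f_def)
qed

text \<open>
  Lebesgue measure is a product measure in the coordinates of the standard basis, which reduces
  Gaussian integrals to one dimension.
\<close>

lemma lborel_integral_prod:
  fixes f :: "'a::euclidean_space \<Rightarrow> real \<Rightarrow> complex"
  assumes f: "\<And>b. b \<in> Basis \<Longrightarrow> integrable lborel (f b)"
  shows "(\<integral>x. (\<Prod>b\<in>Basis. f b (x \<bullet> b)) \<partial>lborel) = (\<Prod>b\<in>Basis. \<integral>u. f b u \<partial>lborel)"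
proof -
  interpret product_sigma_finite "\<lambda>_::'a. lborel :: real measure"
    by (simp add: product_sigma_finite_def sigma_finite_lborel)
  have [measurable]: "f b \<in> borel_measurable borel" if "b \<in> Basis" for b
    using borel_measurable_integrable[OF f[OF that]] by simp
  have "(\<integral>x. (\<Prod>b\<in>Basis. f b (x \<bullet> b)) \<partial>(lborel::'a measure))
    = (\<integral>g. (\<Prod>b\<in>Basis. f b ((\<Sum>b\<in>Basis. g b *\<^sub>R b) \<bullet> b)) \<partial>(\<Pi>\<^sub>M b\<in>(Basis::'a set). lborel))"
    by (subst lborel_eq, subst integral_distr) auto
  also have "\<dots> = (\<integral>g. (\<Prod>b\<in>Basis. f b (g b)) \<partial>(\<Pi>\<^sub>M b\<in>(Basis::'a set). lborel))"
    by (intro Bochner_Integration.integral_cong refl prod.cong) simp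
  also have "\<dots> = (\<Prod>b\<in>Basis. \<integral>u. f b u \<partial>lborel)"
    by (rule product_integral_prod) (use f in auto)
  finally show ?thesis .
qed

lemma fourier_heat:
  fixes \<xi> :: "'a::euclidean_space"
  assumes s: "0 < s"
  shows "(\<integral>x. cis (-(x \<bullet> \<xi>)) * complex_of_real (heat s x) \<partial>lborel) = complex_of_real (exp (-(s * (norm \<xi>)\<^sup>2)))"
proof -
  define f where "f b u = cis (-(u * (\<xi> \<bullet> b))) * complex_of_real (exp (-(u\<^sup>2 / (4 * s))))" for b :: 'a and u
  have fI: "(\<integral>u. f b u \<partial>lborel) = complex_of_real (sqrt (4 * pi * s) * exp (-(s * (\<xi> \<bullet> b)\<^sup>2)))" for b
    unfolding f_def by (rule fourier_gauss_real[OF s])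
  have fi: "integrable lborel (f b)" for b
  proof (rule ccontr)
    assume "\<not> ?thesis"
    hence "(\<integral>u. f b u \<partial>lborel) = 0" by (rule not_integrable_integral_eq)
    thus False using s unfolding fI by (simp del: of_real_mult)
  qed
  have nsq: "(norm y)\<^sup>2 = (\<Sum>b\<in>Basis. (y \<bullet> b)\<^sup>2)" for y :: 'a
    unfolding power2_norm_eq_inner by (subst euclidean_inner) (simp add: power2_eq_square)
  have prod: "cis (-(x \<bullet> \<xi>)) * complex_of_real (exp (-((norm x)\<^sup>2 / (4 * s)))) = (\<Prod>b\<in>Basis. f b (x \<bullet> b))" for x
  proof -
    have "(\<Prod>b\<in>Basis. f b (x \<bullet> b)) = exp (\<Sum>b\<in>Basis. \<i> * complex_of_real (-((x \<bullet> b) * (\<xi> \<bullet> b))) + complex_of_real (-((x \<bullet> b)\<^sup>2 / (4 * s))))"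
      by (subst exp_sum) (auto simp: f_def cis_conv_exp exp_add[symmetric] exp_of_real[symmetric] simp del: exp_of_real)
    also have "(\<Sum>b\<in>Basis. \<i> * complex_of_real (-((x \<bullet> b) * (\<xi> \<bullet> b))) + complex_of_real (-((x \<bullet> b)\<^sup>2 / (4 * s))))
       = \<i> * complex_of_real (-(x \<bullet> \<xi>)) + complex_of_real (-((norm x)\<^sup>2 / (4 * s)))"
      by (simp add: sum.distrib nsq euclidean_inner[of x \<xi>] sum_distrib_left sum_negf sum_subtractf sum_divide_distrib)
    finally show ?thesis by (simp add: cis_conv_exp exp_add[symmetric] exp_of_real[symmetric] del: exp_of_real)
  qed
  have "(\<integral>x. cis (-(x \<bullet> \<xi>)) * complex_of_real (heat s x) \<partial>lborel)
     = (\<integral>x. complex_of_real ((4 * pi * s) powr (-(real DIM('a) / 2))) * (\<Prod>b\<in>Basis. f b (x \<bullet> b)) \<partial>lborel)"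
    by (intro Bochner_Integration.integral_cong refl) (simp add: heat_def prod[symmetric] mult_ac)
  also have "\<dots> = complex_of_real ((4 * pi * s) powr (-(real DIM('a) / 2))) * (\<Prod>b\<in>Basis. \<integral>u. f b u \<partial>lborel)"
    using lborel_integral_prod[of f, OF fi] by simp
  also have "(\<Prod>b\<in>Basis. \<integral>u. f b u \<partial>lborel) = complex_of_real (sqrt (4 * pi * s) ^ DIM('a) * exp (-(s * (norm \<xi>)\<^sup>2)))"
    by (simp add: fI prod.distrib exp_sum[symmetric] nsq sum_negf sum_distrib_left of_real_prod[symmetric] del: of_real_prod)
  also have "sqrt (4 * pi * s) ^ DIM('a) = (4 * pi * s) powr (real DIM('a) / 2)"
    using s by (simp add: powr_half_sqrt[symmetric] powr_realpow[symmetric] powr_powr del: powr_half_sqrt)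
  finally have "(\<integral>x. cis (-(x \<bullet> \<xi>)) * complex_of_real (heat s x) \<partial>lborel) =
    complex_of_real ((4 * pi * s) powr (-(real DIM('a) / 2)) * ((4 * pi * s) powr (real DIM('a) / 2) * exp (-(s * (norm \<xi>)\<^sup>2))))"
    by (simp only: of_real_mult)
  also have "(4 * pi * s) powr (-(real DIM('a) / 2)) * ((4 * pi * s) powr (real DIM('a) / 2) * exp (-(s * (norm \<xi>)\<^sup>2))) = exp (-(s * (norm \<xi>)\<^sup>2))"
    using s by (simp add: powr_minus)
  finally show ?thesis .
qed

lemma heat_integral:
  assumes "0 < s"
  shows "integrable lborel (heat s :: 'a::euclidean_space \<Rightarrow> real)" "(\<integral>x. heat s (x::'a) \<partial>lborel) = 1"
proof -
  have e: "(\<integral>x. complex_of_real (heat s (x::'a)) \<partial>lborel) = 1"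
    using fourier_heat[OF assms, of "0::'a"] by simp
  have "integrable lborel (\<lambda>x. complex_of_real (heat s (x::'a)))"
    using not_integrable_integral_eq e by fastforce
  thus "integrable lborel (heat s :: 'a \<Rightarrow> real)" using complex_of_real_integrable_eq by blast
  from e show "(\<integral>x. heat s (x::'a) \<partial>lborel) = 1" by simp
qed

lemma heat_nn_integral:
  "0 < s \<Longrightarrow> (\<integral>\<^sup>+x. ennreal (heat s (x::'a::euclidean_space)) \<partial>lborel) = 1"
  using heat_integral[of s, where 'a='a] by (subst nn_integral_eq_integral) auto

text \<open>
  Half of the Gaussian exponent is spent on the factor \<open>exp(-\<delta>\<^sup>2/8s)\<close>; the other half is a heat kernel at
  time \<open>2s\<close>, of mass one.
\<close>

lemma heat_tail:
  assumes s: "0 < s" and d: "0 \<le> \<delta>"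
  shows "(\<integral>\<^sup>+x. ennreal (heat s x) * indicator {x. \<delta> \<le> norm x} x \<partial>(lborel::'a::euclidean_space measure))
     \<le> ennreal (2 powr (real DIM('a) / 2) * exp (-(\<delta>\<^sup>2 / (8 * s))))"
proof -
  have "(\<integral>\<^sup>+x. ennreal (heat s x) * indicator {x. \<delta> \<le> norm x} x \<partial>(lborel::'a measure))
     \<le> (\<integral>\<^sup>+x. ennreal (2 powr (real DIM('a) / 2) * exp (-(\<delta>\<^sup>2 / (8 * s)))) * ennreal (heat (2 * s) (x::'a)) \<partial>lborel)"
  proof (rule nn_integral_mono)
    fix x :: 'a
    show "ennreal (heat s x) * indicator {x. \<delta> \<le> norm x} x
       \<le> ennreal (2 powr (real DIM('a) / 2) * exp (-(\<delta>\<^sup>2 / (8 * s)))) * ennreal (heat (2 * s) x)"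
    proof (cases "\<delta> \<le> norm x")
      case True
      have e: "exp (-((norm x)\<^sup>2 / (4 * s))) = exp (-((norm x)\<^sup>2 / (8 * s))) * exp (-((norm x)\<^sup>2 / (4 * (2 * s))))"
        by (simp add: exp_add[symmetric] field_simps)
      have p: "(4 * pi * (2 * s)) powr (-(real DIM('a) / 2)) = 2 powr (-(real DIM('a) / 2)) * (4 * pi * s) powr (-(real DIM('a) / 2))"
        using s by (simp add: powr_mult[symmetric] mult_ac)
      have "heat s x = 2 powr (real DIM('a) / 2) * exp (-((norm x)\<^sup>2 / (8 * s))) * heat (2 * s) x"
        unfolding heat_def e p by (simp add: powr_minus)
      also have "\<dots> \<le> 2 powr (real DIM('a) / 2) * exp (-(\<delta>\<^sup>2 / (8 * s))) * heat (2 * s) x"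
        using True d s by (intro mult_right_mono mult_left_mono) (auto intro!: divide_right_mono power_mono)
      finally show ?thesis using True by (simp add: ennreal_mult'[symmetric] ennreal_leI)
    qed auto
  qed
  also have "\<dots> = ennreal (2 powr (real DIM('a) / 2) * exp (-(\<delta>\<^sup>2 / (8 * s))))"
    using heat_nn_integral[of "2 * s", where 'a='a] s by (subst nn_integral_cmult) auto
  finally show ?thesis .
qed

text \<open>
  A Gaussian is its own Fourier transform up to scaling, which yields the inversion formula for the heat
  kernel without any general theory.
\<close>

lemma heat_inversion:
  fixes z :: "'a::euclidean_space"
  assumes s: "0 < s"
  shows "integrable lborel (\<lambda>\<xi>::'a. exp (-(s * (norm \<xi>)\<^sup>2)))"
    and "(\<integral>\<xi>. cis (z \<bullet> \<xi>) * complex_of_real (exp (-(s * (norm \<xi>)\<^sup>2))) \<partial>lborel)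
      = complex_of_real ((pi / s) powr (real DIM('a) / 2) * (4 * pi * s) powr (real DIM('a) / 2) * heat s z)"
proof -
  define r where "r = 1 / (4 * s)"
  have r: "0 < r" using s by (simp add: r_def)
  define c where "c = (4 * pi * r) powr (real DIM('a) / 2)"
  have c: "c = (pi / s) powr (real DIM('a) / 2)" by (simp add: c_def r_def)
  have h: "exp (-(s * (norm \<xi>)\<^sup>2)) = c * heat r \<xi>" for \<xi> :: 'a
    using r s by (simp add: c_def heat_def powr_minus r_def mult.commute)
  show "integrable lborel (\<lambda>\<xi>::'a. exp (-(s * (norm \<xi>)\<^sup>2)))"
    unfolding h using heat_integral[OF r, where 'a='a] by simp
  have "(\<integral>\<xi>. cis (z \<bullet> \<xi>) * complex_of_real (exp (-(s * (norm \<xi>)\<^sup>2))) \<partial>lborel)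
     = (\<integral>\<xi>. complex_of_real c * (cis (-(\<xi> \<bullet> (-z))) * complex_of_real (heat r \<xi>)) \<partial>lborel)"
    unfolding h by (intro Bochner_Integration.integral_cong refl) (simp add: mult_ac inner_commute)
  also have "\<dots> = complex_of_real (c * exp (-(r * (norm z)\<^sup>2)))"
    using fourier_heat[OF r, of "-z"] by simp
  also have "c * exp (-(r * (norm z)\<^sup>2)) = (pi / s) powr (real DIM('a) / 2) * (4 * pi * s) powr (real DIM('a) / 2) * heat s z"
    using s by (simp add: c heat_def powr_minus r_def)
  finally show "(\<integral>\<xi>. cis (z \<bullet> \<xi>) * complex_of_real (exp (-(s * (norm \<xi>)\<^sup>2))) \<partial>lborel)
      = complex_of_real ((pi / s) powr (real DIM('a) / 2) * (4 * pi * s) powr (real DIM('a) / 2) * heat s z)" .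
qed

lemma measurable_heat_comp [measurable (raw)]:
  assumes "f \<in> borel_measurable M" "g \<in> borel_measurable M"
  shows "(\<lambda>x. heat (f x) (g x :: 'a::euclidean_space)) \<in> borel_measurable M"
  using measurable_compose[OF measurable_Pair[OF assms] heat_measurable] by simp

lemma nn_integral_reflect:
  fixes y :: "'a::euclidean_space"
  assumes [measurable]: "f \<in> borel_measurable borel"
  shows "(\<integral>\<^sup>+x. f (y - x) \<partial>lborel) = (\<integral>\<^sup>+x. f x \<partial>(lborel :: 'a measure))"
proof -
  have "(lborel :: 'a measure) = distr lborel borel (\<lambda>x. y + (-1) *\<^sub>R x)"
    by (subst lborel_affine[of "-1" y]) (simp_all add: density_1)
  hence "(\<integral>\<^sup>+x. f x \<partial>(lborel :: 'a measure)) = (\<integral>\<^sup>+x. f x \<partial>(distr lborel borel (\<lambda>x. y + (-1) *\<^sub>R x)))" by simp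
  also have "\<dots> = (\<integral>\<^sup>+x. f (y - x) \<partial>lborel)" by (subst nn_integral_distr) auto
  finally show ?thesis by simp
qed

lemma nn_integral_translate:
  fixes y :: "'a::euclidean_space"
  assumes [measurable]: "f \<in> borel_measurable borel"
  shows "(\<integral>\<^sup>+x. f (x - y) \<partial>lborel) = (\<integral>\<^sup>+x. f x \<partial>(lborel :: 'a measure))"
  using nn_integral_reflect[of "\<lambda>x. f (- x)" y] nn_integral_reflect[of f 0] by simp

lemma heat_translate_mass:
  "0 < s \<Longrightarrow> (\<integral>\<^sup>+x. ennreal (heat s (x - y)) \<partial>(lborel :: 'a::euclidean_space measure)) = 1"
  using nn_integral_translate[of "\<lambda>x. ennreal (heat s x)" y] heat_nn_integral[of s, where 'a='a] by simp

text \<open>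
  By Fubini the convolution with a heat kernel depends on \<open>h\<close> only through its Fourier transform.
\<close>

lemma heat_convolution_zero:
  fixes h :: "'a::euclidean_space \<Rightarrow> real"
  assumes h: "integrable lborel h" and F: "\<And>\<xi>. (\<integral>x. cis (-(x \<bullet> \<xi>)) * complex_of_real (h x) \<partial>lborel) = 0"
    and s: "0 < s"
  shows "(\<integral>y. h y * heat s (x - y) \<partial>lborel) = 0"
proof -
  have [measurable]: "h \<in> borel_measurable borel" using h by simp
  define c where "c = (pi / s) powr (real DIM('a) / 2) * (4 * pi * s) powr (real DIM('a) / 2)"
  have c: "0 < c" using s by (simp add: c_def)
  define G where "G \<xi> = exp (-(s * (norm \<xi>)\<^sup>2))" for \<xi> :: 'a
  have [measurable]: "G \<in> borel_measurable borel" unfolding G_def by measurable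
  have Gi: "integrable lborel G" unfolding G_def by (rule heat_inversion(1)[OF s])
  define k where "k y \<xi> = complex_of_real (h y) * (cis ((x - y) \<bullet> \<xi>) * complex_of_real (G \<xi>))" for y \<xi>
  have [measurable]: "(\<lambda>(y, \<xi>). k y \<xi>) \<in> borel_measurable (lborel \<Otimes>\<^sub>M lborel)"
    unfolding k_def cis_conv_exp by measurable
  have ki: "integrable (lborel \<Otimes>\<^sub>M lborel) (\<lambda>(y, \<xi>). k y \<xi>)"
  proof (rule lborel_pair.Fubini_integrable)
    have "(\<lambda>y. \<integral>\<xi>. norm (k y \<xi>) \<partial>lborel) = (\<lambda>y. norm (h y) * (\<integral>\<xi>. G \<xi> \<partial>lborel))"
      by (simp add: k_def norm_mult G_def)
    thus "integrable lborel (\<lambda>y. \<integral>\<xi>. norm ((\<lambda>(y, \<xi>). k y \<xi>) (y, \<xi>)) \<partial>lborel)" using h by simp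
    show "AE y in lborel. integrable lborel (\<lambda>\<xi>. (\<lambda>(y, \<xi>). k y \<xi>) (y, \<xi>))"
    proof (rule AE_I2)
      fix y
      have "integrable lborel (\<lambda>\<xi>. norm (h y) * G \<xi>)" using Gi by simp
      thus "integrable lborel (\<lambda>\<xi>. (\<lambda>(y, \<xi>). k y \<xi>) (y, \<xi>))"
        by (rule Bochner_Integration.integrable_bound)
          (auto simp: k_def norm_mult G_def intro!: AE_I2, unfold cis_conv_exp, measurable)
    qed
  qed measurable
  have "(\<integral>y. \<integral>\<xi>. k y \<xi> \<partial>lborel \<partial>lborel) = (\<integral>\<xi>. \<integral>y. k y \<xi> \<partial>lborel \<partial>lborel)"
    using lborel_pair.Fubini_integral[OF ki] by simp
  also have "\<dots> = (\<integral>\<xi>. cis (x \<bullet> \<xi>) * complex_of_real (G \<xi>) * (\<integral>y. cis (-(y \<bullet> \<xi>)) * complex_of_real (h y) \<partial>lborel) \<partial>lborel)"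
  proof (rule Bochner_Integration.integral_cong[OF refl])
    fix \<xi> :: 'a
    have "(\<integral>y. k y \<xi> \<partial>lborel) = (\<integral>y. cis (x \<bullet> \<xi>) * complex_of_real (G \<xi>) * (cis (-(y \<bullet> \<xi>)) * complex_of_real (h y)) \<partial>lborel)"
    proof (intro Bochner_Integration.integral_cong refl)
      fix y
      have "cis ((x - y) \<bullet> \<xi>) = cis (x \<bullet> \<xi>) * cis (-(y \<bullet> \<xi>))"
        by (simp add: cis_mult inner_diff_left)
      thus "k y \<xi> = cis (x \<bullet> \<xi>) * complex_of_real (G \<xi>) * (cis (-(y \<bullet> \<xi>)) * complex_of_real (h y))"
        by (simp add: k_def)
    qed
    thus "(\<integral>y. k y \<xi> \<partial>lborel) = cis (x \<bullet> \<xi>) * complex_of_real (G \<xi>) * (\<integral>y. cis (-(y \<bullet> \<xi>)) * complex_of_real (h y) \<partial>lborel)"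
      by simp
  qed
  also have "\<dots> = 0" by (simp add: F)
  finally have zero: "(\<integral>y. \<integral>\<xi>. k y \<xi> \<partial>lborel \<partial>lborel) = 0" .
  have "(\<integral>y. \<integral>\<xi>. k y \<xi> \<partial>lborel \<partial>lborel) = (\<integral>y. complex_of_real (c * (h y * heat s (x - y))) \<partial>lborel)"
  proof (rule Bochner_Integration.integral_cong[OF refl])
    fix y
    have "(\<integral>\<xi>. k y \<xi> \<partial>lborel) = complex_of_real (h y) * (\<integral>\<xi>. cis ((x - y) \<bullet> \<xi>) * complex_of_real (G \<xi>) \<partial>lborel)"
      by (simp add: k_def)
    also have "(\<integral>\<xi>. cis ((x - y) \<bullet> \<xi>) * complex_of_real (G \<xi>) \<partial>lborel) = complex_of_real (c * heat s (x - y))"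
      unfolding G_def c_def by (rule heat_inversion(2)[OF s])
    finally show "(\<integral>\<xi>. k y \<xi> \<partial>lborel) = complex_of_real (c * (h y * heat s (x - y)))" by simp
  qed
  also have "\<dots> = complex_of_real (\<integral>y. c * (h y * heat s (x - y)) \<partial>lborel)"
    by (rule integral_complex_of_real)
  also have "(\<integral>y. c * (h y * heat s (x - y)) \<partial>lborel) = c * (\<integral>y. h y * heat s (x - y) \<partial>lborel)" by (rule integral_mult_right_zero)
  finally have "complex_of_real (c * (\<integral>y. h y * heat s (x - y) \<partial>lborel)) = 0"
    unfolding zero by (rule sym)
  thus ?thesis using c by (simp only: of_real_eq_0_iff mult_eq_0_iff) simp
qed

text \<open>
  Boxes are used as test sets because their boundary is a null set, so that the convergence holds at
  almost every point.
\<close>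

lemma heat_approx_box:
  fixes y :: "'a::euclidean_space"
  assumes y: "y \<notin> cbox a b - box a b"
  shows "(\<lambda>n. \<integral>x. indicator (box a b) x * heat (1 / real (Suc n)) (x - y) \<partial>lborel) \<longlonglongrightarrow> indicator (box a b) y"
proof -
  define s where "s n = 1 / real (Suc n)" for n
  have s: "0 < s n" for n by (simp add: s_def)
  obtain \<delta> where d: "0 < \<delta>" and D: "ball y \<delta> \<subseteq> box a b \<or> ball y \<delta> \<inter> box a b = {}"
  proof (cases "y \<in> box a b")
    case True then show ?thesis using open_contains_ball[of "box a b"] that by (auto simp: open_box)
  next
    case False
    hence "y \<in> - cbox a b" using y by auto
    moreover have "open (- cbox a b)" using closed_cbox by blast
    ultimately obtain \<delta> where "0 < \<delta>" "ball y \<delta> \<subseteq> - cbox a b"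
      using open_contains_ball by blast
    then show ?thesis using that[of \<delta>] box_subset_cbox[of a b] by blast
  qed
  define I where "I n = (\<integral>x. indicator (box a b) x * heat (s n) (x - y) \<partial>lborel)" for n
  define T where "T n = 2 powr (real DIM('a) / 2) * exp (-(\<delta>\<^sup>2 / (8 * s n)))" for n
  have hn: "heat r (x - y) = heat r (y - x)" for r x by (simp add: heat_def norm_minus_commute)
  note hi = heat_translate_mass[OF s, of _ y]
  have tail: "(\<integral>\<^sup>+x. ennreal (heat (s n) (x - y)) * indicator (- ball y \<delta>) x \<partial>lborel) \<le> ennreal (T n)" for n
  proof -
    have "(\<integral>\<^sup>+x. ennreal (heat (s n) (x - y)) * indicator (- ball y \<delta>) x \<partial>lborel)
      = (\<integral>\<^sup>+x. ennreal (heat (s n) (y - x)) * indicator {x. \<delta> \<le> norm x} (y - x) \<partial>lborel)"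
      by (intro nn_integral_cong) (auto simp: hn indicator_def dist_norm)
    also have "\<dots> = (\<integral>\<^sup>+x. ennreal (heat (s n) x) * indicator {x. \<delta> \<le> norm x} x \<partial>(lborel::'a measure))"
      by (rule nn_integral_reflect) measurable
    also have "\<dots> \<le> ennreal (T n)" unfolding T_def using heat_tail[OF s, of \<delta> n] d by simp
    finally show ?thesis .
  qed
  have hint: "integrable lborel (\<lambda>x. heat (s n) (x - y))" for n
    by (rule integrableI_nonneg) (auto simp: hi)
  have hint1: "(\<integral>x. heat (s n) (x - y) \<partial>lborel) = 1" for n
    by (subst integral_eq_nn_integral) (auto simp: hi)
  have hiA: "integrable lborel (\<lambda>x. heat (s n) (x - y) * indicator A x)"
    "integrable lborel (\<lambda>x. indicator A x * heat (s n) (x - y))" if "A \<in> sets borel" for A n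
    using integrable_real_mult_indicator[OF _ hint[of n], of A] that by (simp_all add: mult.commute)
  have tl: "(\<integral>x. heat (s n) (x - y) * indicator (- ball y \<delta>) x \<partial>lborel) \<le> T n" for n
  proof (subst integral_eq_nn_integral)
    show "enn2real (\<integral>\<^sup>+x. ennreal (heat (s n) (x - y) * indicator (- ball y \<delta>) x) \<partial>lborel) \<le> T n"
      using tail[of n] by (intro enn2real_leI) (auto simp: T_def ennreal_mult' ennreal_indicator)
  qed auto
  have "\<bar>I n - indicator (box a b) y\<bar> \<le> T n" for n
    using D
  proof
    assume D: "ball y \<delta> \<subseteq> box a b"
    hence yb: "y \<in> box a b" using d by auto
    have "1 - I n = (\<integral>x. heat (s n) (x - y) - indicator (box a b) x * heat (s n) (x - y) \<partial>lborel)"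
      unfolding I_def using hint1[of n] hiA(2)[of "box a b" n] hint[of n]
      by (subst Bochner_Integration.integral_diff) auto
    also have "\<dots> \<le> (\<integral>x. heat (s n) (x - y) * indicator (- ball y \<delta>) x \<partial>lborel)"
      using D by (intro integral_mono Bochner_Integration.integrable_diff hiA hint)
        (auto simp: indicator_def subset_iff)
    also have "\<dots> \<le> T n" by (rule tl)
    finally have "1 - I n \<le> T n" .
    moreover have "I n \<le> (\<integral>x. heat (s n) (x - y) \<partial>lborel)" unfolding I_def
      by (intro integral_mono hiA hint) (auto simp: indicator_def)
    ultimately show ?thesis using hint1[of n] yb by simp
  next
    assume D: "ball y \<delta> \<inter> box a b = {}"
    hence yb: "y \<notin> box a b" using d centre_in_ball[of y \<delta>] by blast
    have "I n \<le> (\<integral>x. heat (s n) (x - y) * indicator (- ball y \<delta>) x \<partial>lborel)"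
      unfolding I_def
      using D by (intro integral_mono hiA) (auto simp: indicator_def)
    also have "\<dots> \<le> T n" by (rule tl)
    finally have "I n \<le> T n" .
    moreover have "0 \<le> I n" unfolding I_def by (intro integral_nonneg_AE) auto
    ultimately show ?thesis using yb by simp
  qed
  hence bd: "\<forall>\<^sub>F n in sequentially. norm (I n - indicator (box a b) y) \<le> T n" by simp
  define c where "c = \<delta>\<^sup>2 / 8"
  have c: "0 < c" using d by (simp add: c_def)
  have "(\<lambda>n. exp (-c * real (Suc n))) \<longlonglongrightarrow> 0" using c by real_asymp
  hence "(\<lambda>n. 2 powr (real DIM('a) / 2) * exp (-c * real (Suc n))) \<longlonglongrightarrow> 0"
    by (rule tendsto_mult_right_zero)
  moreover have "T = (\<lambda>n. 2 powr (real DIM('a) / 2) * exp (-c * real (Suc n)))"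
    by (simp add: T_def s_def c_def fun_eq_iff)
  ultimately have "T \<longlonglongrightarrow> 0" by simp
  with bd have "(\<lambda>n. I n - indicator (box a b) y) \<longlonglongrightarrow> 0" by (rule Lim_null_comparison)
  thus ?thesis unfolding I_def s_def LIM_zero_iff .
qed

text \<open>
  The integral of \<open>h\<close> over a box is the limit of integrals of its Gaussian regularisations, which
  vanish. Boxes generate the Borel sets, so the positive and negative parts of \<open>h\<close> have the same measure.
\<close>

lemma fourier_zero_imp_AE_zero:
  fixes h :: "'a::euclidean_space \<Rightarrow> real"
  assumes h: "integrable lborel h" and F: "\<And>\<xi>. (\<integral>x. cis (-(x \<bullet> \<xi>)) * complex_of_real (h x) \<partial>lborel) = 0"
  shows "AE x in lborel. h x = 0"
proof -
  have [measurable]: "h \<in> borel_measurable borel" using h by simp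
  have box0: "(\<integral>y. h y * indicator (box a b) y \<partial>lborel) = 0" for a b
  proof -
    define J where "J n y = (\<integral>x. indicator (box a b) x * heat (1 / real (Suc n)) (x - y) \<partial>lborel)" for n and y :: 'a
    have zero: "(\<integral>y. h y * J n y \<partial>lborel) = 0" for n
    proof -
      define s where "s = 1 / real (Suc n)"
      have s: "0 < s" by (simp add: s_def)
      define k where "k x y = h y * (indicator (box a b) x * heat s (x - y))" for x y
      have [measurable]: "(\<lambda>(x, y). k x y) \<in> borel_measurable (lborel \<Otimes>\<^sub>M lborel)"
        unfolding k_def by measurable
      have ki: "integrable (lborel \<Otimes>\<^sub>M lborel) (\<lambda>(x, y). k x y)"
      proof (rule integrableI_bounded)
        have "(\<integral>\<^sup>+z. ennreal (norm (case z of (x, y) \<Rightarrow> k x y)) \<partial>(lborel \<Otimes>\<^sub>M lborel))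
          = (\<integral>\<^sup>+y. \<integral>\<^sup>+x. ennreal (norm (k x y)) \<partial>lborel \<partial>lborel)"
          by (subst lborel_pair.nn_integral_snd[symmetric]) auto
        also have "\<dots> \<le> (\<integral>\<^sup>+y. ennreal (norm (h y)) * (\<integral>\<^sup>+x. ennreal (heat s (x - y)) \<partial>lborel) \<partial>lborel)"
          by (subst nn_integral_cmult[symmetric])
             (auto intro!: nn_integral_mono simp: k_def abs_mult indicator_def ennreal_mult')
        also have "\<dots> = (\<integral>\<^sup>+y. ennreal (norm (h y)) \<partial>lborel)"
          by (simp add: heat_translate_mass[OF s])
        also have "\<dots> < \<infinity>" using h by (simp add: integrable_iff_bounded)
        finally show "(\<integral>\<^sup>+z. ennreal (norm (case z of (x, y) \<Rightarrow> k x y)) \<partial>(lborel \<Otimes>\<^sub>M lborel)) < \<infinity>" .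
      qed measurable
      have "(\<integral>y. h y * J n y \<partial>lborel) = (\<integral>y. \<integral>x. k x y \<partial>lborel \<partial>lborel)"
        by (simp add: J_def k_def s_def)
      also have "\<dots> = (\<integral>x. \<integral>y. k x y \<partial>lborel \<partial>lborel)"
        using lborel_pair.Fubini_integral[OF ki] by simp
      also have "\<dots> = (\<integral>x. indicator (box a b) x * (\<integral>y. h y * heat s (x - y) \<partial>lborel) \<partial>lborel)"
        by (intro Bochner_Integration.integral_cong refl) (auto simp: k_def indicator_def)
      also have "\<dots> = 0" by (simp add: heat_convolution_zero[OF h F s])
      finally show ?thesis .
    qed
    have "(\<lambda>n. \<integral>y. h y * J n y \<partial>lborel) \<longlonglongrightarrow> (\<integral>y. h y * indicator (box a b) y \<partial>lborel)"
    proof (rule integral_dominated_convergence[where w="\<lambda>y. norm (h y)"])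
      have "AE y in lborel. y \<notin> cbox a b - box a b"
      proof (rule AE_I'[of "cbox a b - box a b"])
        show "cbox a b - box a b \<in> null_sets lborel"
          using negligible_frontier_interval[of a b]
          by (simp add: negligible_iff_null_sets null_sets_completion_iff)
      qed auto
      thus "AE y in lborel. (\<lambda>n. h y * J n y) \<longlonglongrightarrow> h y * indicator (box a b) y"
      proof eventually_elim
        case (elim y)
        show ?case unfolding J_def by (intro tendsto_mult_left heat_approx_box elim)
      qed
      show "AE y in lborel. norm (h y * J n y) \<le> norm (h y)" for n
      proof (rule AE_I2)
        fix y
        have s: "0 < 1 / real (Suc n)" by simp
        note hi = heat_translate_mass[OF s, of y]
        have "\<bar>J n y\<bar> \<le> 1" 
        proof -
          have "0 \<le> J n y" unfolding J_def by (intro integral_nonneg_AE) auto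
          moreover have "J n y \<le> 1" unfolding J_def
          proof (subst integral_eq_nn_integral)
            have "(\<integral>\<^sup>+x. ennreal (indicator (box a b) x * heat (1 / real (Suc n)) (x - y)) \<partial>lborel)
              \<le> (\<integral>\<^sup>+x. ennreal (heat (1 / real (Suc n)) (x - y)) \<partial>lborel)"
              by (intro nn_integral_mono) (auto simp: indicator_def)
            hence "(\<integral>\<^sup>+x. ennreal (indicator (box a b) x * heat (1 / real (Suc n)) (x - y)) \<partial>lborel) \<le> 1"
              by (simp only: hi)
            thus "enn2real (\<integral>\<^sup>+x. ennreal (indicator (box a b) x * heat (1 / real (Suc n)) (x - y)) \<partial>lborel) \<le> 1"
              by (intro enn2real_leI) auto
          qed auto
          ultimately show ?thesis by simp
        qed
        thus "norm (h y * J n y) \<le> norm (h y)" by (simp add: abs_mult mult_left_le)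
      qed
      show "(\<lambda>y. h y * J n y) \<in> borel_measurable lborel" for n unfolding J_def by measurable
    qed (use h in auto)
    hence "(\<lambda>n::nat. 0::real) \<longlonglongrightarrow> (\<integral>y. h y * indicator (box a b) y \<partial>lborel)"
      by (simp only: zero)
    from LIMSEQ_unique[OF this tendsto_const] show ?thesis by simp
  qed
  define hp where "hp y = max 0 (h y)" for y
  define hm where "hm y = max 0 (- h y)" for y
  have hpi: "integrable lborel hp" and hmi: "integrable lborel hm"
    unfolding hp_def hm_def using h by auto
  have [measurable]: "hp \<in> borel_measurable borel" "hm \<in> borel_measurable borel" using hpi hmi by auto
  have eq: "density lborel (\<lambda>y. ennreal (hp y)) = density lborel (\<lambda>y. ennreal (hm y))"
  proof (rule measure_eqI_generator_eq)
    let ?E = "range (\<lambda>(a, b). box a b::'a set)"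
    show "Int_stable ?E" by (auto simp: Int_stable_def box_Int_box)
    show "?E \<subseteq> Pow UNIV" by simp
    show "sets (density lborel (\<lambda>y. ennreal (hp y))) = sigma_sets UNIV ?E"
         "sets (density lborel (\<lambda>y. ennreal (hm y))) = sigma_sets UNIV ?E"
      by (simp_all add: borel_eq_box)
    let ?A = "\<lambda>n::nat. box (- (real n *\<^sub>R One)) (real n *\<^sub>R One) :: 'a set"
    show "range ?A \<subseteq> ?E" "(\<Union>i. ?A i) = UNIV" unfolding UN_box_eq_UNIV by auto
    have em: "emeasure (density lborel (\<lambda>y. ennreal (g y))) X = ennreal (\<integral>y. g y * indicator X y \<partial>lborel)"
      if "integrable lborel g" "\<And>y. 0 \<le> g y" "X \<in> sets borel" for g and X :: "'a set"
    proof -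
      have [measurable]: "g \<in> borel_measurable borel" "X \<in> sets borel" using that by auto
      have "emeasure (density lborel (\<lambda>y. ennreal (g y))) X = (\<integral>\<^sup>+y. ennreal (g y * indicator X y) \<partial>lborel)"
        using that by (subst emeasure_density) (auto intro!: nn_integral_cong simp: ennreal_mult' ennreal_indicator)
      also have "\<dots> = ennreal (\<integral>y. g y * indicator X y \<partial>lborel)"
        using that by (intro nn_integral_eq_integral integrable_real_mult_indicator) auto
      finally show ?thesis .
    qed
    show "emeasure (density lborel (\<lambda>y. ennreal (hp y))) (?A i) \<noteq> \<infinity>" for i
      using em[OF hpi, of "?A i"] by (simp add: hp_def)
    fix X assume "X \<in> ?E"
    then obtain a b where X: "X = box a b" by auto
    have "(\<integral>y. hp y * indicator X y \<partial>lborel) - (\<integral>y. hm y * indicator X y \<partial>lborel)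
       = (\<integral>y. hp y * indicator X y - hm y * indicator X y \<partial>lborel)"
      using hpi hmi by (intro Bochner_Integration.integral_diff[symmetric] integrable_real_mult_indicator) (auto simp: X)
    also have "\<dots> = (\<integral>y. h y * indicator X y \<partial>lborel)"
      by (intro Bochner_Integration.integral_cong refl) (auto simp: hp_def hm_def indicator_def)
    finally have "(\<integral>y. hp y * indicator X y \<partial>lborel) = (\<integral>y. hm y * indicator X y \<partial>lborel)"
      using box0[of a b] by (simp add: X)
    thus "emeasure (density lborel (\<lambda>y. ennreal (hp y))) X = emeasure (density lborel (\<lambda>y. ennreal (hm y))) X"
      using em[OF hpi, of X] em[OF hmi, of X] by (simp add: X hp_def hm_def)
  qed
  have "AE y in lborel. ennreal (hp y) = ennreal (hm y)"
    using eq sigma_finite_measure.density_unique_iff[OF sigma_finite_lborel, of "\<lambda>y. ennreal (hp y)" "\<lambda>y. ennreal (hm y)"] by simp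
  thus ?thesis
  proof eventually_elim
    case (elim y)
    moreover have "0 \<le> hp y" "0 \<le> hm y" by (simp_all add: hp_def hm_def)
    ultimately have "hp y = hm y" using ennreal_inj by blast
    thus ?case unfolding hp_def hm_def by linarith
  qed
qed

section \<open>The kernel as a mixture of heat kernels\<close>

text \<open>
  Both sides are integrable and have the same Fourier transform.
\<close>

lemma heat_mixture:
  fixes h :: "'a::euclidean_space \<Rightarrow> real"
  assumes fin: "finite_measure Q" and sets[measurable_cong]: "sets Q = sets borel" and pos: "AE s in Q. 0 < s"
    and h: "integrable lborel h"
    and F: "\<And>\<xi>. (\<integral>x. cis (-(x \<bullet> \<xi>)) * complex_of_real (h x) \<partial>lborel)
        = complex_of_real (\<integral>s. exp (-(s * (norm \<xi>)\<^sup>2)) \<partial>Q)"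
  shows "AE x in lborel. ennreal (h x) = (\<integral>\<^sup>+s. ennreal (heat s x) \<partial>Q)"
proof -
  interpret Q: finite_measure Q by fact
  interpret pair_sigma_finite "lborel :: 'a measure" Q
    by (simp add: pair_sigma_finite_def sigma_finite_lborel Q.sigma_finite_measure_axioms)
  have ki: "integrable (lborel \<Otimes>\<^sub>M Q) (\<lambda>(x::'a, s). heat s x)"
  proof (rule integrableI_bounded)
    have "(\<integral>\<^sup>+z. ennreal (norm (case z of (x::'a, s) \<Rightarrow> heat s x)) \<partial>(lborel \<Otimes>\<^sub>M Q))
        = (\<integral>\<^sup>+s. \<integral>\<^sup>+x. ennreal (heat s (x::'a)) \<partial>lborel \<partial>Q)"
      by (subst nn_integral_snd[symmetric]) auto
    also have "\<dots> = (\<integral>\<^sup>+s. 1 \<partial>Q)"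
      by (rule nn_integral_cong_AE) (use pos in \<open>eventually_elim, simp add: heat_nn_integral\<close>)
    also have "\<dots> < \<infinity>" using Q.emeasure_finite[of "space Q"] by (simp add: less_top[symmetric])
    finally show "(\<integral>\<^sup>+z. ennreal (norm (case z of (x::'a, s) \<Rightarrow> heat s x)) \<partial>(lborel \<Otimes>\<^sub>M Q)) < \<infinity>" .
  qed measurable
  define G where "G x = (\<integral>s. heat s (x::'a) \<partial>Q)" for x
  have Gi: "integrable lborel G" using integrable_fst[OF ki] unfolding G_def by simp
  have AEi: "AE x in lborel. integrable Q (\<lambda>s. heat s (x::'a))" using AE_integrable_fst[OF ki] by simp
  have GF: "(\<integral>x. cis (-(x \<bullet> \<xi>)) * complex_of_real (G x) \<partial>lborel) = complex_of_real (\<integral>s. exp (-(s * (norm \<xi>)\<^sup>2)) \<partial>Q)" for \<xi>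
  proof -
    have ki': "integrable (lborel \<Otimes>\<^sub>M Q) (\<lambda>(x, s). cis (-(x \<bullet> \<xi>)) * complex_of_real (heat s x))"
    proof (rule Bochner_Integration.integrable_bound[OF ki])
      show "(\<lambda>(x, s). cis (-(x \<bullet> \<xi>)) * complex_of_real (heat s x)) \<in> borel_measurable (lborel \<Otimes>\<^sub>M Q)"
        unfolding cis_conv_exp by measurable
    qed (auto simp: norm_mult)
    have "(\<integral>x. cis (-(x \<bullet> \<xi>)) * complex_of_real (G x) \<partial>lborel)
      = (\<integral>x. \<integral>s. cis (-(x \<bullet> \<xi>)) * complex_of_real (heat s x) \<partial>Q \<partial>lborel)"
      by (intro Bochner_Integration.integral_cong refl) (simp add: G_def)
    also have "\<dots> = (\<integral>s. \<integral>x. cis (-(x \<bullet> \<xi>)) * complex_of_real (heat s x) \<partial>lborel \<partial>Q)"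
      using Fubini_integral[OF ki'] by simp
    also have "\<dots> = (\<integral>s. complex_of_real (exp (-(s * (norm \<xi>)\<^sup>2))) \<partial>Q)"
    proof (rule integral_cong_AE)
      show "AE s in Q. (\<integral>x. cis (-(x \<bullet> \<xi>)) * complex_of_real (heat s x) \<partial>lborel) = complex_of_real (exp (-(s * (norm \<xi>)\<^sup>2)))"
        using pos by eventually_elim (rule fourier_heat)
      show "(\<lambda>s. \<integral>x. cis (-(x \<bullet> \<xi>)) * complex_of_real (heat s x) \<partial>lborel) \<in> borel_measurable Q"
        unfolding cis_conv_exp by measurable
    qed measurable
    also have "\<dots> = complex_of_real (\<integral>s. exp (-(s * (norm \<xi>)\<^sup>2)) \<partial>Q)"
      by (rule integral_complex_of_real)
    finally show ?thesis .
  qed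
  have ci: "integrable lborel (\<lambda>x. cis (-(x \<bullet> \<xi>)) * complex_of_real (g x))" if "integrable lborel g" for g :: "'a \<Rightarrow> real" and \<xi>
  proof (rule Bochner_Integration.integrable_bound[OF that])
    have [measurable]: "g \<in> borel_measurable borel" using that by simp
    show "(\<lambda>x. cis (-(x \<bullet> \<xi>)) * complex_of_real (g x)) \<in> borel_measurable lborel"
      unfolding cis_conv_exp by measurable
  qed (auto simp: norm_mult)
  have "AE x in lborel. h x - G x = 0"
  proof (rule fourier_zero_imp_AE_zero)
    show "integrable lborel (\<lambda>x. h x - G x)" using h Gi by simp
    fix \<xi>
    have "(\<integral>x. cis (-(x \<bullet> \<xi>)) * complex_of_real (h x - G x) \<partial>lborel)
      = (\<integral>x. cis (-(x \<bullet> \<xi>)) * complex_of_real (h x) - cis (-(x \<bullet> \<xi>)) * complex_of_real (G x) \<partial>lborel)"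
      by (simp add: algebra_simps)
    also have "\<dots> = 0"
      using ci[OF h] ci[OF Gi] F GF by (subst Bochner_Integration.integral_diff) auto
    finally show "(\<integral>x. cis (-(x \<bullet> \<xi>)) * complex_of_real (h x - G x) \<partial>lborel) = 0" .
  qed
  with AEi show ?thesis
  proof eventually_elim
    case (elim x)
    thus ?case by (simp add: G_def nn_integral_eq_integral)
  qed
qed

text \<open>
  Here \<open>c\<close> stands for \<open>t\<^sup>\<alpha>\<close>, and \<open>l\<close> for the value of \<open>|\<xi>|\<^sup>2\<close>.
\<close>

definition mixing_law :: "real \<Rightarrow> real \<Rightarrow> real \<Rightarrow> real measure \<Rightarrow> bool" where
  "mixing_law \<alpha> \<beta> c Q \<longleftrightarrow> finite_measure Q \<and> sets Q = sets borel \<and> (AE s in Q. 0 < s) \<and>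
     (\<forall>l\<ge>0. (\<integral>s. exp (-(s * l)) \<partial>Q) = mittag_leffler \<alpha> \<alpha> (-(l powr \<beta> * c)))"

lemma mixing_lawD:
  assumes "mixing_law \<alpha> \<beta> c Q"
  shows "finite_measure Q" "sets Q = sets borel" "AE s in Q. 0 < s"
    "\<And>l. 0 \<le> l \<Longrightarrow> (\<integral>s. exp (-(s * l)) \<partial>Q) = mittag_leffler \<alpha> \<alpha> (-(l powr \<beta> * c))"
  using assms by (auto simp: mixing_law_def)

text \<open>
  \<open>Q\<close> is the distribution of \<open>(c X\<^sup>-\<^sup>\<alpha>)\<^sup>1\<^sup>/\<^sup>\<beta> X'\<close> under the weight \<open>\<alpha> X\<^sup>-\<^sup>\<alpha>\<close>, where \<open>X\<close> and \<open>X'\<close> are independent stable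
  variables of index \<open>\<alpha>\<close> and \<open>\<beta>\<close>: integrating out \<open>X'\<close> turns \<open>exp(-l s)\<close> into \<open>exp(-l\<^sup>\<beta> c X\<^sup>-\<^sup>\<alpha>)\<close>.
\<close>

lemma mixing_law_exists:
  assumes a: "0 < \<alpha>" "\<alpha> < 1" and b: "0 < \<beta>" "\<beta> \<le> 1" and c: "0 < c"
  shows "\<exists>Q. mixing_law \<alpha> \<beta> c Q"
proof -
  obtain M where M: "stable_law \<alpha> M" using stable_law_exists[of \<alpha>] a by auto
  obtain M' where M': "stable_law \<beta> M'" using stable_law_exists[of \<beta>] b by auto
  interpret M: real_distribution M using M by (simp add: stable_law_def)
  interpret M': real_distribution M' using M' by (simp add: stable_law_def)
  interpret pair_sigma_finite M M'
    by (simp add: pair_sigma_finite_def M.sigma_finite_measure_axioms M'.sigma_finite_measure_axioms)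
  have pos: "AE x in M. 0 < x" and pos': "AE x in M'. 0 < x" using M M' by (auto simp: stable_law_def)
  define w where "w = (\<lambda>(x::real, y::real). ennreal (\<alpha> * x powr (-\<alpha>)))"
  define S where "S = (\<lambda>(x::real, y::real). (c * x powr (-\<alpha>)) powr (1/\<beta>) * y)"
  have [measurable]: "w \<in> borel_measurable (M \<Otimes>\<^sub>M M')" "S \<in> borel_measurable (M \<Otimes>\<^sub>M M')"
    unfolding w_def S_def by measurable
  define Q where "Q = distr (density (M \<Otimes>\<^sub>M M') w) borel S"
  have int: "(\<integral>\<^sup>+s. f s \<partial>Q) = (\<integral>\<^sup>+x. \<integral>\<^sup>+y. ennreal (\<alpha> * x powr (-\<alpha>)) * f ((c * x powr (-\<alpha>)) powr (1/\<beta>) * y) \<partial>M' \<partial>M)"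
    if [measurable]: "f \<in> borel_measurable borel" for f
  proof -
    have "(\<integral>\<^sup>+s. f s \<partial>Q) = (\<integral>\<^sup>+z. w z * f (S z) \<partial>(M \<Otimes>\<^sub>M M'))"
      unfolding Q_def by (simp add: nn_integral_distr nn_integral_density)
    also have "\<dots> = (\<integral>\<^sup>+x. \<integral>\<^sup>+y. w (x, y) * f (S (x, y)) \<partial>M' \<partial>M)"
      by (rule M'.nn_integral_fst[symmetric]) measurable
    finally show ?thesis by (simp add: w_def S_def)
  qed
  have int0: "(\<integral>\<^sup>+x. ennreal (x powr (-\<alpha>)) \<partial>M) < \<infinity>"
    using stable_law_neg_moment[OF M a(1), of \<alpha>] a by simp
  have sQ: "sets Q = sets borel" by (simp add: Q_def)
  have "emeasure Q (space Q) = (\<integral>\<^sup>+s. 1 \<partial>Q)" by simp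
  also have "\<dots> = ennreal \<alpha> * (\<integral>\<^sup>+x. ennreal (x powr (-\<alpha>)) \<partial>M)"
    using a M'.emeasure_space_1 by (subst int) (auto simp: ennreal_mult' nn_integral_cmult)
  also have "\<dots> \<noteq> \<infinity>" using int0 by (simp add: ennreal_mult_eq_top_iff)
  finally have finQ: "finite_measure Q" by (rule finite_measureI)
  have "(\<integral>\<^sup>+s. indicator {..0} s \<partial>Q) = (\<integral>\<^sup>+x. \<integral>\<^sup>+y. 0 \<partial>M' \<partial>M)"
  proof (subst int)
    show "(\<integral>\<^sup>+x. \<integral>\<^sup>+y. ennreal (\<alpha> * x powr (-\<alpha>)) * indicator {..0} ((c * x powr (-\<alpha>)) powr (1/\<beta>) * y) \<partial>M' \<partial>M) = (\<integral>\<^sup>+x. \<integral>\<^sup>+y. 0 \<partial>M' \<partial>M)"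
    proof (intro nn_integral_cong_AE, use pos in eventually_elim)
      case (elim x)
      have "0 < (c * x powr (-\<alpha>)) powr (1/\<beta>)" using elim c by simp
      hence "AE y in M'. (c * x powr (-\<alpha>)) powr (1/\<beta>) * y > 0" using pos' by auto
      hence "AE y in M'. ennreal (\<alpha> * x powr (-\<alpha>)) * indicator {..0} ((c * x powr (-\<alpha>)) powr (1/\<beta>) * y) = 0"
      proof eventually_elim
        case (elim y)
        hence "(c * x powr (-\<alpha>)) powr (1/\<beta>) * y \<notin> {..0}" by (simp only: atMost_iff not_le)
        hence "indicator {..0} ((c * x powr (-\<alpha>)) powr (1/\<beta>) * y) = (0::ennreal)"
          by (rule indicator_simps(2))
        thus ?case by (simp only: mult_zero_right)
      qed
      thus ?case by (intro nn_integral_cong_AE)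
    qed
  qed measurable
  hence "emeasure Q {..0} = 0" using sQ by (simp add: nn_integral_indicator)
  hence posQ: "AE s in Q. 0 < s"
    using sQ by (intro AE_I[of _ _ "{..0}"]) (auto simp: not_less)
  have laplace: "(\<integral>s. exp (-(s * l)) \<partial>Q) = mittag_leffler \<alpha> \<alpha> (-(l powr \<beta> * c))" if l: "0 \<le> l" for l
  proof -
    have L': "(\<integral>\<^sup>+y. ennreal (exp (-(r * y))) \<partial>M') = ennreal (exp (-(r powr \<beta>)))" if "0 \<le> r" for r
    proof (cases "r = 0")
      case True thus ?thesis using M'.emeasure_space_1 by simp
    next
      case False
      hence "0 < r" using that by simp
      thus ?thesis using stable_law_laplace[OF M', of r] by (simp add: nn_integral_eq_integral)
    qed
    have lb: "0 \<le> l powr \<beta> * c" using c by simp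
    have "(\<integral>\<^sup>+s. ennreal (exp (-(s * l))) \<partial>Q)
       = (\<integral>\<^sup>+x. \<integral>\<^sup>+y. ennreal (\<alpha> * x powr (-\<alpha>)) * ennreal (exp (-((c * x powr (-\<alpha>)) powr (1/\<beta>) * y * l))) \<partial>M' \<partial>M)"
      by (subst int) auto
    also have "\<dots> = (\<integral>\<^sup>+x. ennreal (\<alpha> * (x powr (-\<alpha>) * exp (-(l powr \<beta> * c * x powr (-\<alpha>))))) \<partial>M)"
    proof (intro nn_integral_cong_AE, use pos in eventually_elim)
      case (elim x)
      define r where "r = (c * x powr (-\<alpha>)) powr (1/\<beta>) * l"
      have r: "0 \<le> r" using l by (simp add: r_def)
      have "r powr \<beta> = l powr \<beta> * (c * x powr (-\<alpha>))"
        using l c b elim by (simp add: r_def powr_mult powr_powr)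
      moreover have "(\<integral>\<^sup>+y. ennreal (exp (-((c * x powr (-\<alpha>)) powr (1/\<beta>) * y * l))) \<partial>M') = ennreal (exp (-(r powr \<beta>)))"
        using L'[OF r] by (simp add: r_def mult_ac)
      ultimately show ?case using a by (simp add: nn_integral_cmult ennreal_mult' mult.assoc)
    qed
    also have "\<dots> = ennreal (\<alpha> * (\<integral>x. x powr (-\<alpha>) * exp (-(l powr \<beta> * c * x powr (-\<alpha>))) \<partial>M))"
      using mittag_leffler_stable(1)[OF M a(1) lb] a by (subst nn_integral_eq_integral) auto
    also have "\<dots> = ennreal (mittag_leffler \<alpha> \<alpha> (-(l powr \<beta> * c)))"
      using mittag_leffler_stable(2)[OF M a(1) lb] by simp
    finally have "(\<integral>\<^sup>+s. ennreal (exp (-(s * l))) \<partial>Q) = ennreal (mittag_leffler \<alpha> \<alpha> (-(l powr \<beta> * c)))" .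
    moreover have "(\<lambda>s. exp (-(s * l))) \<in> borel_measurable Q" using sQ by (simp cong: measurable_cong_sets)
    ultimately show ?thesis
      using mittag_leffler_nonneg[OF M a(1) lb] by (subst integral_eq_nn_integral) auto
  qed
  show ?thesis unfolding mixing_law_def using finQ sQ posQ laplace by blast
qed

lemma power2_powr: "0 \<le> (y::real) \<Longrightarrow> (y\<^sup>2) powr a = y powr (2 * a)"
  by (cases "y = 0") (simp_all only: powr_powr[of y 2 a, symmetric], simp_all)

section \<open>Bounds for the heat kernel by exponentials in time\<close>

lemma nn_integral_powr_0:
  fixes a m :: real
  assumes "0 < a" "0 \<le> m"
  shows "(\<integral>\<^sup>+u. ennreal (indicator {0..m} u * u powr (a - 1)) \<partial>lborel) = ennreal (m powr a / a)"
proof -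
  have "((\<lambda>x. x powr (a - 1)) has_integral (m powr (a - 1 + 1) / (a - 1 + 1))) {0..m}"
    by (rule has_integral_powr_from_0) (use assms in auto)
  from nn_integral_has_integral_lebesgue[OF _ this] show ?thesis by simp
qed

text \<open>
  In terms of \<open>y = s/|x|\<^sup>2\<close> the heat kernel is \<open>|x|\<^sup>-\<^sup>N\<close> times a function of \<open>y\<close> that decays faster than any
  power at \<open>0\<close> and like \<open>y\<^sup>-\<^sup>N\<^sup>/\<^sup>2\<close> at infinity.
\<close>

lemma heat_le_scaled:
  assumes "0 < \<kappa>"
  obtains C where "0 < C" 
   "\<And>s x. 0 < s \<Longrightarrow> x \<noteq> 0 \<Longrightarrow> heat s (x::'a::euclidean_space) \<le> C * norm x powr (-real DIM('a)) * min 1 (s / (norm x)\<^sup>2) powr \<kappa>"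
   "\<And>s x. 0 < s \<Longrightarrow> x \<noteq> 0 \<Longrightarrow> heat s (x::'a) \<le> C * norm x powr (-real DIM('a)) * min 1 ((norm x)\<^sup>2 / s) powr (real DIM('a) / 2)"
proof -
  define n where "n = real DIM('a) / 2"
  have n: "0 < n" by (simp add: n_def)
  define C where "C = pi powr (-n) * ((n + \<kappa>) powr (n + \<kappa>) * 4 powr \<kappa>  + 1 + n powr n)"
  have pl: "pi powr (-n) * a \<le> C" if "a \<le> (n + \<kappa>) powr (n + \<kappa>) * 4 powr \<kappa> \<or> a \<le> 1 \<or> a \<le> n powr n" for a
  proof -
    have "0 \<le> (n + \<kappa>) powr (n + \<kappa>) * 4 powr \<kappa>" "0 \<le> n powr n" by simp_all
    with that have "a \<le> (n + \<kappa>) powr (n + \<kappa>) * 4 powr \<kappa> + 1 + n powr n" by linarith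
    thus ?thesis unfolding C_def by (intro mult_left_mono) auto
  qed
  have C0: "0 < C" using pl[of 1] by (simp add: order_less_le_trans[of 0 "pi powr (-n)"])
  have scaled: "heat s x = norm x powr (-real DIM('a)) * (pi powr (-n) * (v powr n * exp (-v)))"
    if s: "0 < s" and x: "x \<noteq> 0" and v: "v = (norm x)\<^sup>2 / (4 * s)" for s v and x :: 'a
  proof -
    have v0: "0 < v" using s x by (simp add: v)
    have e: "4 * pi * s = pi * ((norm x)\<^sup>2 * (1 / v))" using s x by (simp add: v)
    have "(4 * pi * s) powr (-n) = pi powr (-n) * (((norm x)\<^sup>2) powr (-n) * (1 / v) powr (-n))"
      unfolding e powr_mult[of pi] powr_mult[of "(norm x)\<^sup>2"] ..
    moreover have "(1 / v) powr (-n) = v powr n" using v0 by (simp add: powr_minus powr_divide)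
    ultimately have "(4 * pi * s) powr (-n) = pi powr (-n) * ((norm x)\<^sup>2) powr (-n) * v powr n" by simp
    moreover have "((norm x)\<^sup>2) powr (-n) = norm x powr (-real DIM('a))"
      by (simp add: power2_powr n_def)
    ultimately show ?thesis by (simp add: heat_def n_def[symmetric] v)
  qed
  show thesis
  proof (rule that[OF C0])
    fix s :: real and x :: 'a assume s: "0 < s" and x: "x \<noteq> 0"
    define v where "v = (norm x)\<^sup>2 / (4 * s)"
    have v: "0 < v" using s x by (simp add: v_def)
    have y: "s / (norm x)\<^sup>2 = 1 / (4 * v)" "(norm x)\<^sup>2 / s = 4 * v" using s x by (auto simp: v_def)
    have vn: "v powr n * exp (-v) \<le> n powr n" by (rule powr_times_exp_bounded[OF n v])
    have vnk: "v powr (n + \<kappa>) * exp (-v) \<le> (n + \<kappa>) powr (n + \<kappa>)"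
      by (rule powr_times_exp_bounded) (use n assms v in auto)
    have 1: "pi powr (-n) * (v powr n * exp (-v)) \<le> C * min 1 (1 / (4 * v)) powr \<kappa>"
    proof (cases "1 / (4 * v) \<le> 1")
      case True
      have "v powr n * exp (-v) = (v powr (n + \<kappa>) * exp (-v)) * 4 powr \<kappa> * (1 / (4 * v)) powr \<kappa>"
        using v by (simp add: powr_add powr_divide powr_mult)
      also have "\<dots> \<le> (n + \<kappa>) powr (n + \<kappa>) * 4 powr \<kappa> * (1 / (4 * v)) powr \<kappa>"
        by (intro mult_right_mono vnk) auto
      finally have "pi powr (-n) * (v powr n * exp (-v)) \<le> (pi powr (-n) * ((n + \<kappa>) powr (n + \<kappa>) * 4 powr \<kappa>)) * (1 / (4 * v)) powr \<kappa>"
        by (simp only: mult.assoc) (rule mult_left_mono, auto)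
      also have "\<dots> \<le> C * (1 / (4 * v)) powr \<kappa>" by (intro mult_right_mono pl) auto
      finally show ?thesis by (simp only: min_absorb2[OF True])
    next
      case False
      thus ?thesis using pl[of "v powr n * exp (-v)"] vn by (simp add: min_def)
    qed
    show "heat s x \<le> C * norm x powr (-real DIM('a)) * min 1 (s / (norm x)\<^sup>2) powr \<kappa>"
      unfolding scaled[OF s x v_def] y
        using mult_left_mono[OF 1, of "norm x powr (-real DIM('a))"] by (simp add: mult_ac)
    have 2: "pi powr (-n) * (v powr n * exp (-v)) \<le> C * min 1 (4 * v) powr n"
    proof (cases "4 * v \<le> 1")
      case True
      have "v powr n * exp (-v) \<le> (4 * v) powr n * 1" using v n by (intro mult_mono powr_mono2) auto
      hence "pi powr (-n) * (v powr n * exp (-v)) \<le> (pi powr (-n) * 1) * (4 * v) powr n"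
        by (simp add: mult_left_mono)
      also have "\<dots> \<le> C * (4 * v) powr n" by (intro mult_right_mono pl) auto
      finally show ?thesis by (simp only: min_absorb2[OF True])
    next
      case False
      thus ?thesis using pl[of "v powr n * exp (-v)"] vn by (simp add: min_def)
    qed
    show "heat s x \<le> C * norm x powr (-real DIM('a)) * min 1 ((norm x)\<^sup>2 / s) powr (real DIM('a) / 2)"
      unfolding scaled[OF s x v_def] y
        using mult_left_mono[OF 2, of "norm x powr (-real DIM('a))"] by (simp add: mult_ac n_def)
  qed
qed

text \<open>
  The superposition of exponentials is at least its part over \<open>u \<le> min 1 (|x|\<^sup>2/s)\<close>, where the exponential
  is at least \<open>exp(-1)\<close>, and this part majorises the heat kernel up to a constant.
\<close>

lemma heat_le_laplace:
  obtains C where "0 < C" 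
   "\<And>s x. 0 < s \<Longrightarrow> x \<noteq> 0 \<Longrightarrow> ennreal (heat s (x::'a::euclidean_space)) \<le> 
      ennreal (C * norm x powr (-real DIM('a))) *
      (\<integral>\<^sup>+u. ennreal (indicator {0..1} u * u powr (real DIM('a) / 2 - 1) * exp (-(s * (u / (norm x)\<^sup>2)))) \<partial>lborel)"
proof -
  define n where "n = real DIM('a) / 2"
  have n: "0 < n" by (simp add: n_def)
  obtain C where C: "0 < C" "\<And>s x. 0 < s \<Longrightarrow> x \<noteq> 0 \<Longrightarrow> heat s (x::'a) \<le> C * norm x powr (-real DIM('a)) * min 1 ((norm x)\<^sup>2 / s) powr (real DIM('a) / 2)"
    by (rule heat_le_scaled[of 1, where 'a='a, OF zero_less_one]) (erule that, assumption)
  show thesis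
  proof (rule that[of "C * exp 1 * n"])
    show "0 < C * exp 1 * n" using C n by simp
    fix s :: real and x :: 'a assume s: "0 < s" and x: "x \<noteq> 0"
    define m where "m = min 1 ((norm x)\<^sup>2 / s)"
    have m: "0 < m" using s x by (simp add: m_def)
    define D where "D = norm x powr (-real DIM('a))"
    have D: "0 \<le> D" by (simp add: D_def)
    have "ennreal (m powr n / n) * ennreal (exp (-1))
       = (\<integral>\<^sup>+u. ennreal (indicator {0..m} u * u powr (n - 1)) * ennreal (exp (-1)) \<partial>lborel)"
      using nn_integral_powr_0[of n m] n m by (subst nn_integral_multc) auto
    also have "\<dots> \<le> (\<integral>\<^sup>+u. ennreal (indicator {0..1} u * u powr (n - 1) * exp (-(s * (u / (norm x)\<^sup>2)))) \<partial>lborel)"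
    proof (rule nn_integral_mono)
      fix u :: real
      show "ennreal (indicator {0..m} u * u powr (n - 1)) * ennreal (exp (-1))
         \<le> ennreal (indicator {0..1} u * u powr (n - 1) * exp (-(s * (u / (norm x)\<^sup>2))))"
      proof (cases "u \<in> {0..m}")
        case True
        hence "u * s \<le> (norm x)\<^sup>2" using s by (simp add: m_def pos_le_divide_eq)
        hence "s * (u / (norm x)\<^sup>2) \<le> 1" using x by (simp add: field_simps)
        moreover have "u \<in> {0..1}" using True by (simp add: m_def)
        ultimately show ?thesis using True
          by (subst ennreal_mult'[symmetric]) (auto intro!: ennreal_leI mult_left_mono)
      qed auto
    qed
    finally have I: "ennreal (m powr n / n * exp (-1)) \<le> (\<integral>\<^sup>+u. ennreal (indicator {0..1} u * u powr (n - 1) * exp (-(s * (u / (norm x)\<^sup>2)))) \<partial>lborel)"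
      using n by (subst ennreal_mult') auto
    have "heat s x \<le> C * D * m powr n" using C(2)[OF s x] by (simp add: D_def m_def n_def)
    also have "\<dots> = (C * exp 1 * n * D) * (m powr n / n * exp (-1))"
      using n by (simp add: exp_minus)
    finally have "ennreal (heat s x) \<le> ennreal (C * exp 1 * n * D) * ennreal (m powr n / n * exp (-1))"
      using C n D by (simp add: ennreal_mult'[symmetric] ennreal_leI)
    also have "\<dots> \<le> ennreal (C * exp 1 * n * D) * (\<integral>\<^sup>+u. ennreal (indicator {0..1} u * u powr (n - 1) * exp (-(s * (u / (norm x)\<^sup>2)))) \<partial>lborel)"
      by (intro mult_left_mono I) auto
    finally show "ennreal (heat s x) \<le> 
      ennreal (C * exp 1 * n * norm x powr (-real DIM('a))) *
      (\<integral>\<^sup>+u. ennreal (indicator {0..1} u * u powr (real DIM('a) / 2 - 1) * exp (-(s * (u / (norm x)\<^sup>2)))) \<partial>lborel)"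
      by (simp add: D_def n_def)
  qed
qed

text \<open>
  For small \<open>s\<close> the tail bound leaves at least half of the mass in the ball. For other \<open>s\<close> the kernel is at
  least a multiple of \<open>s\<^sup>-\<^sup>N\<^sup>/\<^sup>2\<close> there. The weaker bound \<open>c exp(-s)\<close> is stated because its integral
  against a mixing measure is a value of the Laplace transform.
\<close>

lemma heat_ball_mass:
  obtains c where "0 < c" 
    "\<And>s. 0 < s \<Longrightarrow> ennreal (c * exp (-s)) \<le> (\<integral>\<^sup>+x. ennreal (heat s x) * indicator (cball 0 1) x \<partial>(lborel::'a::euclidean_space measure))"
proof -
  define n where "n = real DIM('a) / 2"
  have n: "0 < n" by (simp add: n_def)
  have "((\<lambda>s. 2 powr n * exp (-(1 / (8 * s)))) \<longlongrightarrow> 0) (at_right 0)"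
  proof -
    have "((\<lambda>s::real. exp (-(1 / (8 * s)))) \<longlongrightarrow> 0) (at_right 0)" by real_asymp
    thus ?thesis by (rule tendsto_mult_right_zero)
  qed
  hence "\<forall>\<^sub>F s in at_right 0. 2 powr n * exp (-(1 / (8 * s))) < 1/2" by (rule order_tendstoD) simp
  then obtain s0 where s0: "0 < s0" "\<And>s. 0 < s \<Longrightarrow> s < s0 \<Longrightarrow> 2 powr n * exp (-(1 / (8 * s))) < 1/2"
    by (auto simp: eventually_at_right_field)
  define V where "V = measure lborel (cball (0::'a) 1)"
  have V: "0 < V" unfolding V_def by (simp add: content_cball_pos)
  have [measurable]: "cball (0::'a) 1 \<in> sets borel" by simp
  have emV: "emeasure lborel (cball (0::'a) 1) = ennreal V"
    unfolding V_def using emeasure_lborel_cball_finite[of "0::'a" 1] by (intro emeasure_eq_ennreal_measure) auto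
  define D where "D = (4 * pi) powr (-n) * exp (-(1 / (4 * s0))) * V / (n powr n)"
  have D: "0 < D" using V n by (simp add: D_def)
  show thesis
  proof (rule that[of "min (1/2) D"])
    show "0 < min (1/2) D" using D by simp
    fix s :: real assume s: "0 < s"
    show "ennreal (min (1/2) D * exp (-s)) \<le> (\<integral>\<^sup>+x. ennreal (heat s x) * indicator (cball 0 1) x \<partial>(lborel::'a measure))"
    proof (cases "s < s0")
      case True
      have "1 = (\<integral>\<^sup>+x. ennreal (heat s (x::'a)) \<partial>lborel)"
        using heat_nn_integral[OF s, where 'a='a] by simp
      also have "\<dots> \<le> (\<integral>\<^sup>+x. ennreal (heat s x) * indicator (cball 0 1) x + ennreal (heat s x) * indicator {x. 1 \<le> norm x} x \<partial>(lborel::'a measure))"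
        by (intro nn_integral_mono) (auto simp: indicator_def)
      also have "\<dots> = (\<integral>\<^sup>+x. ennreal (heat s x) * indicator (cball 0 1) x \<partial>(lborel::'a measure)) + (\<integral>\<^sup>+x. ennreal (heat s x) * indicator {x. 1 \<le> norm x} x \<partial>(lborel::'a measure))"
        by (rule nn_integral_add) auto
      also have "\<dots> \<le> (\<integral>\<^sup>+x. ennreal (heat s x) * indicator (cball 0 1) x \<partial>(lborel::'a measure)) + ennreal (1/2)"
      proof (rule add_left_mono)
        have "(\<integral>\<^sup>+x. ennreal (heat s x) * indicator {x. 1 \<le> norm x} x \<partial>(lborel::'a measure)) \<le> ennreal (2 powr n * exp (-(1 / (8 * s))))"
          using heat_tail[OF s, of 1, where 'a='a] by (simp add: n_def)
        also have "\<dots> \<le> ennreal (1/2)" by (rule ennreal_leI) (use s0(2)[OF s True] in simp)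
        finally show "(\<integral>\<^sup>+x. ennreal (heat s x) * indicator {x. 1 \<le> norm x} x \<partial>(lborel::'a measure)) \<le> ennreal (1/2)" .
      qed
      finally have *: "1 \<le> (\<integral>\<^sup>+x. ennreal (heat s x) * indicator (cball 0 1) x \<partial>(lborel::'a measure)) + ennreal (1/2)" .
      have "ennreal (1/2) + ennreal (1/2) = 1" by (subst ennreal_plus[symmetric]) auto
      with * have "ennreal (1/2) + ennreal (1/2) \<le> ennreal (1/2) + (\<integral>\<^sup>+x. ennreal (heat s x) * indicator (cball 0 1) x \<partial>(lborel::'a measure))"
        by (simp only: add.commute)
      hence "ennreal (1/2) \<le> (\<integral>\<^sup>+x. ennreal (heat s x) * indicator (cball 0 1) x \<partial>(lborel::'a measure))"
        unfolding ennreal_add_left_cancel_le infinity_ennreal_def using ennreal_neq_top by blast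
      moreover have "min (1/2) D * exp (-s) \<le> 1/2 * 1" using s D by (intro mult_mono) auto
      then have "ennreal (min (1/2) D * exp (-s)) \<le> ennreal (1/2)" by (intro ennreal_leI) simp
      ultimately show ?thesis by (rule order_trans[rotated])
    next
      case False
      have "D * exp (-s) \<le> (4 * pi * s) powr (-n) * exp (-(1 / (4 * s))) * V"
      proof -
        have "exp (-(1 / (4 * s0))) \<le> exp (-(1 / (4 * s)))" using False s0 s by (auto simp: field_simps)
        moreover have "exp (-s) / n powr n \<le> s powr (-n)"
          using powr_times_exp_bounded[OF n s] s n by (simp add: powr_minus field_simps)
        ultimately have "exp (-(1 / (4 * s0))) * (exp (-s) / n powr n) \<le> exp (-(1 / (4 * s))) * s powr (-n)"
          by (intro mult_mono) auto
        hence "((4 * pi) powr (-n) * V) * (exp (-(1 / (4 * s0))) * (exp (-s) / n powr n)) \<le> ((4 * pi) powr (-n) * V) * (exp (-(1 / (4 * s))) * s powr (-n))"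
          using V by (intro mult_left_mono) auto
        thus ?thesis using s by (simp add: D_def powr_mult mult_ac)
      qed
      moreover have "min (1/2) D * exp (-s) \<le> D * exp (-s)" by (intro mult_right_mono) auto
      ultimately have "min (1/2) D * exp (-s) \<le> (4 * pi * s) powr (-n) * exp (-(1 / (4 * s))) * V"
        by (rule order_trans[rotated])
      hence "ennreal (min (1/2) D * exp (-s)) \<le> ennreal ((4 * pi * s) powr (-n) * exp (-(1 / (4 * s))) * V)"
        by (rule ennreal_leI)
      also have "\<dots> = ennreal ((4 * pi * s) powr (-n) * exp (-(1 / (4 * s)))) * ennreal V"
        by (rule ennreal_mult') simp
      also have "\<dots> = (\<integral>\<^sup>+x. ennreal ((4 * pi * s) powr (-n) * exp (-(1 / (4 * s)))) * indicator (cball 0 1) x \<partial>(lborel::'a measure))"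
        using emV by (simp add: nn_integral_cmult_indicator)
      also have "\<dots> \<le> (\<integral>\<^sup>+x. ennreal (heat s x) * indicator (cball 0 1) x \<partial>(lborel::'a measure))"
        using s by (intro nn_integral_mono)
          (auto simp: indicator_def heat_def n_def intro!: ennreal_leI mult_left_mono divide_right_mono power_le_one)
      finally show ?thesis .
    qed
  qed
qed

section \<open>Pointwise bounds for the kernel and mass of the unit ball\<close>

lemma kernel_as_mixture:
  fixes Y :: "'a::euclidean_space \<Rightarrow> real \<Rightarrow> real"
  assumes a: "0 < \<alpha>" "\<alpha> < 1" and b: "0 < \<beta>" "\<beta> \<le> 1" and Y: "is_kernel_Y \<alpha> \<beta> Y" and t: "0 < t"
  obtains Q :: "real measure" where "mixing_law \<alpha> \<beta> (t powr \<alpha>) Q"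
    "AE x in lborel. ennreal (Y x t) = ennreal (t powr (\<alpha> - 1)) * (\<integral>\<^sup>+s. ennreal (heat s x) \<partial>Q)"
proof -
  have "0 < t powr \<alpha>" using t by simp
  from mixing_law_exists[OF a b this] obtain Q where mix: "mixing_law \<alpha> \<beta> (t powr \<alpha>) Q" by blast
  note Q = mixing_lawD(1-3)[OF mix] and L = mixing_lawD(4)[OF mix]
  have Yi: "integrable lborel (\<lambda>x. Y x t)" and
    YF: "\<And>\<xi>. (\<integral>x. cis (- (x \<bullet> \<xi>)) * complex_of_real (Y x t) \<partial>lborel) =
              complex_of_real (t powr (\<alpha> - 1) * mittag_leffler \<alpha> \<alpha> (- (norm \<xi> powr (2 * \<beta>)) * t powr \<alpha>))"
    using Y t unfolding is_kernel_Y_def by auto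
  define d where "d = t powr (\<alpha> - 1)"
  have d: "0 < d" using t by (simp add: d_def)
  have "AE x in lborel. ennreal (1 / d * Y x t) = (\<integral>\<^sup>+s. ennreal (heat s x) \<partial>Q)"
  proof (rule heat_mixture[OF Q])
    show "integrable lborel (\<lambda>x. 1 / d * Y x t)" using Yi by simp
    fix \<xi> :: 'a
    have sq: "((norm \<xi>)\<^sup>2) powr \<beta> = norm \<xi> powr (2 * \<beta>)"
      by (simp add: power2_powr)
    have "(\<integral>x. cis (-(x \<bullet> \<xi>)) * complex_of_real (1 / d * Y x t) \<partial>lborel)
      = (\<integral>x. complex_of_real (1 / d) * (cis (-(x \<bullet> \<xi>)) * complex_of_real (Y x t)) \<partial>lborel)"
      by (intro Bochner_Integration.integral_cong refl) simp
    also have "\<dots> = complex_of_real (1 / d) * (\<integral>x. cis (-(x \<bullet> \<xi>)) * complex_of_real (Y x t) \<partial>lborel)"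
      by (rule integral_mult_right_zero)
    also have "\<dots> = complex_of_real (1 / d * (d * mittag_leffler \<alpha> \<alpha> (- (norm \<xi> powr (2 * \<beta>)) * t powr \<alpha>)))"
      unfolding YF d_def by (rule of_real_mult[symmetric])
    also have "1 / d * (d * mittag_leffler \<alpha> \<alpha> (- (norm \<xi> powr (2 * \<beta>)) * t powr \<alpha>)) = (\<integral>s. exp (-(s * (norm \<xi>)\<^sup>2)) \<partial>Q)"
      using L[of "(norm \<xi>)\<^sup>2"] d by (simp add: sq)
    finally show "(\<integral>x. cis (-(x \<bullet> \<xi>)) * complex_of_real (1 / d * Y x t) \<partial>lborel)
        = complex_of_real (\<integral>s. exp (-(s * (norm \<xi>)\<^sup>2)) \<partial>Q)" .
  qed
  hence "AE x in lborel. ennreal (Y x t) = ennreal d * (\<integral>\<^sup>+s. ennreal (heat s x) \<partial>Q)"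
  proof eventually_elim
    case (elim x)
    have "ennreal (Y x t) = ennreal d * ennreal (1 / d * Y x t)"
      using d by (subst ennreal_mult'[symmetric]) auto
    with elim show ?case by simp
  qed
  from that[OF mix this[unfolded d_def]] show thesis .
qed

text \<open>
  After Tonelli the integrand is \<open>u\<^sup>N\<^sup>/\<^sup>2\<^sup>-\<^sup>1\<close> times the Laplace transform at \<open>u/|x|\<^sup>2\<close>, which is at most a
  multiple of \<open>(u/|x|\<^sup>2)\<^sup>-\<^sup>2\<^sup>\<beta>\<close>. The resulting integral over \<open>0 < u < 1\<close> converges since \<open>N/2 > 2\<beta>\<close>.
\<close>

lemma mixture_near:
  assumes M: "stable_law \<alpha> M" and a: "0 < \<alpha>" and b: "0 < \<beta>" and N: "4 * \<beta> < real DIM('a::euclidean_space)"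
  obtains C where "0 < C" "\<And>Q c x. mixing_law \<alpha> \<beta> c Q \<Longrightarrow> 0 < c \<Longrightarrow> x \<noteq> 0 \<Longrightarrow>
     (\<integral>\<^sup>+s. ennreal (heat s (x::'a)) \<partial>Q) \<le> ennreal (C * (c powr (-2) * norm x powr (4 * \<beta> - real DIM('a))))"
proof -
  define n where "n = real DIM('a) / 2"
  have n: "2 * \<beta> < n" using N by (simp add: n_def)
  obtain C1 where C1: "0 < C1" 
   "\<And>s x. 0 < s \<Longrightarrow> x \<noteq> 0 \<Longrightarrow> ennreal (heat s (x::'a)) \<le> 
      ennreal (C1 * norm x powr (-real DIM('a))) *
      (\<integral>\<^sup>+u. ennreal (indicator {0..1} u * u powr (real DIM('a) / 2 - 1) * exp (-(s * (u / (norm x)\<^sup>2)))) \<partial>lborel)"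
    using heat_le_laplace[where 'a='a] by blast
  obtain C2 where C2: "0 < C2" "\<And>z. 0 < z \<Longrightarrow> mittag_leffler \<alpha> \<alpha> (-z) \<le> C2 * z powr (-2)"
    using mittag_leffler_upper[OF M a] by blast
  show thesis
  proof (rule that[of "C1 * C2 / (n - 2 * \<beta>)"])
    show "0 < C1 * C2 / (n - 2 * \<beta>)" using C1 C2 n by simp
    fix Q :: "real measure" and c :: real and x :: 'a
    assume mix: "mixing_law \<alpha> \<beta> c Q" and c: "0 < c" and x: "x \<noteq> 0"
    note fQ = mixing_lawD(1)[OF mix] and sQ [measurable_cong] = mixing_lawD(2)[OF mix]
      and pos = mixing_lawD(3)[OF mix] and L = mixing_lawD(4)[OF mix]
    interpret Q: finite_measure Q by fact
    interpret pair_sigma_finite Q "lborel :: real measure"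
      by (simp add: pair_sigma_finite_def sigma_finite_lborel Q.sigma_finite_measure_axioms)
    define A where "A = (norm x)\<^sup>2"
    have A: "0 < A" using x by (simp add: A_def)
    define K where "K = C1 * norm x powr (-real DIM('a))"
    have K: "0 \<le> K" using C1 by (simp add: K_def)
    have "(\<integral>\<^sup>+s. ennreal (heat s x) \<partial>Q) \<le> (\<integral>\<^sup>+s. ennreal K * (\<integral>\<^sup>+u. ennreal (indicator {0..1} u * u powr (n - 1) * exp (-(s * (u / A)))) \<partial>lborel) \<partial>Q)"
    proof (rule nn_integral_mono_AE, use pos in eventually_elim)
      case (elim s)
      from C1(2)[OF elim x] show ?case by (simp add: K_def n_def A_def)
    qed
    also have "\<dots> = ennreal K * (\<integral>\<^sup>+s. \<integral>\<^sup>+u. ennreal (indicator {0..1} u * u powr (n - 1) * exp (-(s * (u / A)))) \<partial>lborel \<partial>Q)"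
      by (rule nn_integral_cmult) measurable
    also have "(\<integral>\<^sup>+s. \<integral>\<^sup>+u. ennreal (indicator {0..1} u * u powr (n - 1) * exp (-(s * (u / A)))) \<partial>lborel \<partial>Q)
       = (\<integral>\<^sup>+u. \<integral>\<^sup>+s. ennreal (indicator {0..1} u * u powr (n - 1) * exp (-(s * (u / A)))) \<partial>Q \<partial>lborel)"
      by (rule Fubini'[symmetric]) measurable
    also have "\<dots> \<le> (\<integral>\<^sup>+u. ennreal (C2 * (c powr (-2) * A powr (2 * \<beta>))) * ennreal (indicator {0..1} u * u powr (n - 2 * \<beta> - 1)) \<partial>lborel)"
    proof (rule nn_integral_mono)
      fix u :: real
      show "(\<integral>\<^sup>+s. ennreal (indicator {0..1} u * u powr (n - 1) * exp (-(s * (u / A)))) \<partial>Q)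
         \<le> ennreal (C2 * (c powr (-2) * A powr (2 * \<beta>))) * ennreal (indicator {0..1} u * u powr (n - 2 * \<beta> - 1))"
      proof (cases "u \<in> {0<..1}")
        case True
        define z where "z = (u / A) powr \<beta> * c"
        have z: "0 < z" using True A c by (simp add: z_def)
        have int: "integrable Q (\<lambda>s. exp (-(s * (u / A))))"
          by (rule Q.integrable_const_bound[where B=1]) (use pos True A in \<open>auto elim!: eventually_mono\<close>)
        have "(\<integral>\<^sup>+s. ennreal (indicator {0..1} u * u powr (n - 1) * exp (-(s * (u / A)))) \<partial>Q) 
           = (\<integral>\<^sup>+s. ennreal (u powr (n - 1)) * ennreal (exp (-(s * (u / A)))) \<partial>Q)"
          using True by (simp add: ennreal_mult')
        also have "\<dots> = ennreal (u powr (n - 1)) * ennreal (mittag_leffler \<alpha> \<alpha> (-z))"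
          using int L[of "u / A"] True A by (subst nn_integral_cmult) (auto simp: nn_integral_eq_integral z_def)
        also have "\<dots> \<le> ennreal (u powr (n - 1)) * ennreal (C2 * z powr (-2))"
          by (intro mult_left_mono ennreal_leI C2(2) z) auto
        also have "\<dots> = ennreal (u powr (n - 1) * (C2 * z powr (-2)))" using C2 by (subst ennreal_mult') auto
        also have "z powr (-2) = c powr (-2) * A powr (2 * \<beta>) * u powr (-(2 * \<beta>))"
          using True A c by (simp add: z_def powr_mult powr_divide powr_powr powr_minus divide_inverse inverse_powr mult_ac)
        also have "u powr (n - 1) * (C2 * (c powr (-2) * A powr (2 * \<beta>) * u powr (-(2 * \<beta>))))
           = C2 * (c powr (-2) * A powr (2 * \<beta>)) * (u powr (n - 1) * u powr (-(2 * \<beta>)))" by (simp add: mult_ac)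
        also have "u powr (n - 1) * u powr (-(2 * \<beta>)) = indicator {0..1} u * u powr (n - 2 * \<beta> - 1)"
          using True by (simp add: powr_add[symmetric] algebra_simps)
        finally show ?thesis using C2 by (simp add: ennreal_mult')
      next
        case False
        hence "u = 0 \<or> u \<notin> {0..1}" by auto
        thus ?thesis by auto
      qed
    qed
    also have "\<dots> = ennreal (C2 * (c powr (-2) * A powr (2 * \<beta>))) * ennreal (1 / (n - 2 * \<beta>))"
      using nn_integral_powr_0[of "n - 2 * \<beta>" 1] n by (subst nn_integral_cmult) auto
    finally have "(\<integral>\<^sup>+s. ennreal (heat s x) \<partial>Q) \<le> ennreal K * (ennreal (C2 * (c powr (-2) * A powr (2 * \<beta>))) * ennreal (1 / (n - 2 * \<beta>)))"
      by (simp add: mult_left_mono)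
    also have "\<dots> = ennreal (K * (C2 * (c powr (-2) * A powr (2 * \<beta>)) * (1 / (n - 2 * \<beta>))))"
    proof -
      have "0 \<le> C2 * (c powr (-2) * A powr (2 * \<beta>))" using C2 by simp
      thus ?thesis using K by (simp only: ennreal_mult')
    qed
    also have "K * (C2 * (c powr (-2) * A powr (2 * \<beta>)) * (1 / (n - 2 * \<beta>)))
       = C1 * C2 / (n - 2 * \<beta>) * (c powr (-2) * norm x powr (4 * \<beta> - real DIM('a)))"
    proof -
      have "A powr (2 * \<beta>) = norm x powr (4 * \<beta>)" by (simp add: A_def power2_powr)
      moreover have "norm x powr (4 * \<beta> - real DIM('a)) = norm x powr (4 * \<beta>) * norm x powr (-real DIM('a))"
        by (simp add: powr_add[symmetric])
      ultimately show ?thesis by (simp add: K_def)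
    qed
    finally show "(\<integral>\<^sup>+s. ennreal (heat s x) \<partial>Q) \<le> ennreal (C1 * C2 / (n - 2 * \<beta>) * (c powr (-2) * norm x powr (4 * \<beta> - real DIM('a))))" .
  qed
qed

text \<open>
  The heat kernel is at most a multiple of \<open>|x|\<^sup>-\<^sup>N (1 - exp(-s/|x|\<^sup>2))\<close>, whose integral is the increment
  of the Laplace transform between \<open>0\<close> and \<open>1/|x|\<^sup>2\<close>.
\<close>

lemma mixture_far:
  assumes M: "stable_law \<alpha> M" and a: "0 < \<alpha>" and b: "0 < \<beta>"
  obtains C where "0 < C" "\<And>Q c x. mixing_law \<alpha> \<beta> c Q \<Longrightarrow> 0 < c \<Longrightarrow> x \<noteq> 0 \<Longrightarrow>
     (\<integral>\<^sup>+s. ennreal (heat s (x::'a::euclidean_space)) \<partial>Q) \<le> ennreal (C * (c * norm x powr (-real DIM('a) - 2 * \<beta>)))"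
proof -
  define q where "q = 1 - exp (-1::real)"
  have q: "0 < q" by (simp add: q_def)
  obtain C1 where C1: "0 < C1" 
   "\<And>s x. 0 < s \<Longrightarrow> x \<noteq> 0 \<Longrightarrow> heat s (x::'a) \<le> C1 * norm x powr (-real DIM('a)) * min 1 (s / (norm x)\<^sup>2) powr 1"
    by (rule heat_le_scaled[of 1, where 'a='a, OF zero_less_one]) (erule that, assumption)
  obtain C2 where C2: "0 < C2" "\<And>z. 0 \<le> z \<Longrightarrow> mittag_leffler \<alpha> \<alpha> 0 - mittag_leffler \<alpha> \<alpha> (-z) \<le> C2 * z"
    using mittag_leffler_diff_zero[OF M a] by blast
  show thesis
  proof (rule that[of "C1 / q * C2"])
    show "0 < C1 / q * C2" using C1 C2 q by simp
    fix Q :: "real measure" and c :: real and x :: 'a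
    assume mix: "mixing_law \<alpha> \<beta> c Q" and c: "0 < c" and x: "x \<noteq> 0"
    note fQ = mixing_lawD(1)[OF mix] and sQ [measurable_cong] = mixing_lawD(2)[OF mix]
      and pos = mixing_lawD(3)[OF mix] and L = mixing_lawD(4)[OF mix]
    interpret Q: finite_measure Q by fact
    define A where "A = (norm x)\<^sup>2"
    have A: "0 < A" using x by (simp add: A_def)
    define K where "K = C1 * norm x powr (-real DIM('a)) / q"
    have K: "0 \<le> K" using C1 q by (simp add: K_def)
    have int: "integrable Q (\<lambda>s. exp (-(s * l)))" if "0 \<le> l" for l
      by (rule Q.integrable_const_bound[where B=1]) (use pos that in \<open>auto elim!: eventually_mono\<close>)
    have "(\<integral>\<^sup>+s. ennreal (heat s x) \<partial>Q) \<le> (\<integral>\<^sup>+s. ennreal (K * (exp (-(s * 0)) - exp (-(s * (1 / A))))) \<partial>Q)"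
    proof (rule nn_integral_mono_AE, use pos in eventually_elim)
      case (elim s)
      have "heat s x \<le> C1 * norm x powr (-real DIM('a)) * min 1 (s / A)"
        using C1(2)[OF elim x] elim A by (simp add: A_def)
      also have "\<dots> = K * (q * min 1 (s / A))" using q by (simp add: K_def)
      also have "\<dots> \<le> K * (1 - exp (-(s / A)))"
        unfolding q_def using one_minus_exp_ge[of "s / A"] elim A K by (intro mult_left_mono) auto
      finally show ?case by (simp add: ennreal_leI)
    qed
    also have "\<dots> = ennreal (\<integral>s. K * (exp (-(s * 0)) - exp (-(s * (1 / A)))) \<partial>Q)"
    proof (rule nn_integral_eq_integral)
      show "integrable Q (\<lambda>s. K * (exp (-(s * 0)) - exp (-(s * (1 / A)))))"
        using int[of 0] int[of "1 / A"] A by (intro integrable_mult_right Bochner_Integration.integrable_diff) auto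
      show "AE s in Q. 0 \<le> K * (exp (-(s * 0)) - exp (-(s * (1 / A))))"
        using pos by eventually_elim (use K A in auto)
    qed
    also have "(\<integral>s. K * (exp (-(s * 0)) - exp (-(s * (1 / A)))) \<partial>Q)
       = K * (mittag_leffler \<alpha> \<alpha> 0 - mittag_leffler \<alpha> \<alpha> (-((1 / A) powr \<beta> * c)))"
    proof -
      have "(\<integral>s. K * (exp (-(s * 0)) - exp (-(s * (1 / A)))) \<partial>Q) = K * ((\<integral>s. exp (-(s * 0)) \<partial>Q) - (\<integral>s. exp (-(s * (1 / A))) \<partial>Q))"
        using int[of 0] int[of "1 / A"] A 
        by (subst integral_mult_right_zero, subst Bochner_Integration.integral_diff) auto
      also have "(\<integral>s. exp (-(s * 0)) \<partial>Q) = mittag_leffler \<alpha> \<alpha> 0" using L[of 0] by simp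
      also have "(\<integral>s. exp (-(s * (1 / A))) \<partial>Q) = mittag_leffler \<alpha> \<alpha> (-((1 / A) powr \<beta> * c))" by (rule L) (use A in simp)
      finally show ?thesis .
    qed
    also have "\<dots> \<le> K * (C2 * ((1 / A) powr \<beta> * c))"
      using K c by (intro mult_left_mono C2(2)) auto
    also have "\<dots> = C1 / q * C2 * (c * norm x powr (-real DIM('a) - 2 * \<beta>))"
    proof -
      have "(1 / A) powr \<beta> = norm x powr (-(2 * \<beta>))"
        by (simp add: A_def power2_powr powr_divide powr_minus divide_inverse inverse_powr)
      moreover have "norm x powr (-real DIM('a) - 2 * \<beta>) = norm x powr (-real DIM('a)) * norm x powr (-(2 * \<beta>))"
        by (simp add: powr_add[symmetric])
      ultimately show ?thesis by (simp add: K_def)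
    qed
    finally show "(\<integral>\<^sup>+s. ennreal (heat s x) \<partial>Q) \<le> ennreal (C1 / q * C2 * (c * norm x powr (-real DIM('a) - 2 * \<beta>)))"
      by (simp add: ennreal_leI)
  qed
qed

lemma kernel_upper:
  fixes Y :: "'a::euclidean_space \<Rightarrow> real \<Rightarrow> real"
  assumes a: "0 < \<alpha>" "\<alpha> < 1" and b: "0 < \<beta>" "\<beta> \<le> 1" and N: "4 * \<beta> < real DIM('a)" and Y: "is_kernel_Y \<alpha> \<beta> Y"
  obtains C where "0 < C" "\<And>t. 0 < t \<Longrightarrow> AE x in lborel. 
     Y x t \<le> C * (t powr (-(1 + \<alpha>)) * norm x powr (4 * \<beta> - real DIM('a))) \<and>
     Y x t \<le> C * (t powr (2 * \<alpha> - 1) * norm x powr (-real DIM('a) - 2 * \<beta>))"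
proof -
  obtain M where M: "stable_law \<alpha> M" using stable_law_exists[of \<alpha>] a by auto
  obtain C1 where C1: "0 < C1" "\<And>Q c x. mixing_law \<alpha> \<beta> c Q \<Longrightarrow> 0 < c \<Longrightarrow> x \<noteq> 0 \<Longrightarrow>
     (\<integral>\<^sup>+s. ennreal (heat s (x::'a)) \<partial>Q) \<le> ennreal (C1 * (c powr (-2) * norm x powr (4 * \<beta> - real DIM('a))))"
    using mixture_near[OF M a(1) b(1) N] by blast
  obtain C2 where C2: "0 < C2" "\<And>Q c x. mixing_law \<alpha> \<beta> c Q \<Longrightarrow> 0 < c \<Longrightarrow> x \<noteq> 0 \<Longrightarrow>
     (\<integral>\<^sup>+s. ennreal (heat s (x::'a)) \<partial>Q) \<le> ennreal (C2 * (c * norm x powr (-real DIM('a) - 2 * \<beta>)))"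
    using mixture_far[OF M a(1) b(1)] by blast
  define C where "C = max C1 C2"
  show thesis
  proof (rule that[of C])
    show "0 < C" using C1 by (simp add: C_def)
    fix t :: real assume t: "0 < t"
    obtain Q :: "real measure" where mix: "mixing_law \<alpha> \<beta> (t powr \<alpha>) Q"
      and eq: "AE x in lborel. ennreal (Y x t) = ennreal (t powr (\<alpha> - 1)) * (\<integral>\<^sup>+s. ennreal (heat s x) \<partial>Q)"
      using kernel_as_mixture[OF a b Y t] by blast
    have ta: "0 < t powr \<alpha>" using t by simp
    have "AE x in lborel. x \<noteq> (0::'a)" by (rule AE_lborel_singleton)
    with eq show "AE x in lborel. Y x t \<le> C * (t powr (-(1 + \<alpha>)) * norm x powr (4 * \<beta> - real DIM('a))) \<and>
     Y x t \<le> C * (t powr (2 * \<alpha> - 1) * norm x powr (-real DIM('a) - 2 * \<beta>))"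
    proof eventually_elim
      case (elim x)
      have le: "Y x t \<le> t powr (\<alpha> - 1) * B" if "(\<integral>\<^sup>+s. ennreal (heat s x) \<partial>Q) \<le> ennreal B" "0 \<le> B" for B
      proof -
        have "ennreal (Y x t) \<le> ennreal (t powr (\<alpha> - 1)) * ennreal B"
          unfolding elim(1) by (intro mult_left_mono that) auto
        also have "\<dots> = ennreal (t powr (\<alpha> - 1) * B)" using that by (subst ennreal_mult') auto
        finally show ?thesis using that by (subst (asm) ennreal_le_iff) auto
      qed
      have "Y x t \<le> t powr (\<alpha> - 1) * (C1 * ((t powr \<alpha>) powr (-2) * norm x powr (4 * \<beta> - real DIM('a))))"
        by (rule le[OF C1(2)[OF mix ta elim(2)]]) (use C1 in auto)
      also have "\<dots> = C1 * ((t powr (\<alpha> - 1) * (t powr \<alpha>) powr (-2)) * norm x powr (4 * \<beta> - real DIM('a)))" by (simp only: mult_ac)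
      also have "t powr (\<alpha> - 1) * (t powr \<alpha>) powr (-2) = t powr (-(1 + \<alpha>))"
        by (simp add: powr_powr powr_add[symmetric] add.commute minus_diff_commute)
      also have "C1 * (t powr (-(1 + \<alpha>)) * norm x powr (4 * \<beta> - real DIM('a))) \<le> C * (t powr (-(1 + \<alpha>)) * norm x powr (4 * \<beta> - real DIM('a)))"
        by (intro mult_right_mono) (auto simp: C_def)
      finally have 1: "Y x t \<le> C * (t powr (-(1 + \<alpha>)) * norm x powr (4 * \<beta> - real DIM('a)))" .
      have "Y x t \<le> t powr (\<alpha> - 1) * (C2 * (t powr \<alpha> * norm x powr (-real DIM('a) - 2 * \<beta>)))"
        by (rule le[OF C2(2)[OF mix ta elim(2)]]) (use C2 in auto)
      also have "\<dots> = C2 * ((t powr (\<alpha> - 1) * t powr \<alpha>) * norm x powr (-real DIM('a) - 2 * \<beta>))" by (simp only: mult_ac)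
      also have "t powr (\<alpha> - 1) * t powr \<alpha> = t powr (2 * \<alpha> - 1)" by (simp add: powr_add[symmetric])
      also have "C2 * (t powr (2 * \<alpha> - 1) * norm x powr (-real DIM('a) - 2 * \<beta>)) \<le> C * (t powr (2 * \<alpha> - 1) * norm x powr (-real DIM('a) - 2 * \<beta>))"
        by (intro mult_right_mono) (auto simp: C_def)
      finally show ?case using 1 by blast
    qed
  qed
qed

lemma kernel_ball_mass:
  fixes Y :: "'a::euclidean_space \<Rightarrow> real \<Rightarrow> real"
  assumes a: "0 < \<alpha>" "\<alpha> < 1" and b: "0 < \<beta>" "\<beta> \<le> 1" and Y: "is_kernel_Y \<alpha> \<beta> Y"
  obtains c where "0 < c" "\<And>t. 1 \<le> t \<Longrightarrow> 
     ennreal (c * t powr (-(1 + \<alpha>))) \<le> (\<integral>\<^sup>+x. ennreal (Y x t) * indicator (cball 0 1) x \<partial>lborel)"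
proof -
  obtain M where M: "stable_law \<alpha> M" using stable_law_exists[of \<alpha>] a by auto
  obtain c1 where c1: "0 < c1" "\<And>z. 1 \<le> z \<Longrightarrow> c1 * z powr (-2) \<le> mittag_leffler \<alpha> \<alpha> (-z)"
    using mittag_leffler_lower[OF M a] by blast
  obtain c2 where c2: "0 < c2" 
    "\<And>s. 0 < s \<Longrightarrow> ennreal (c2 * exp (-s)) \<le> (\<integral>\<^sup>+x. ennreal (heat s x) * indicator (cball 0 1) x \<partial>(lborel::'a measure))"
    using heat_ball_mass by blast
  show thesis
  proof (rule that[of "c1 * c2"])
    show "0 < c1 * c2" using c1 c2 by simp
    fix t :: real assume t: "1 \<le> t"
    hence t0: "0 < t" by simp
    obtain Q :: "real measure" where mix: "mixing_law \<alpha> \<beta> (t powr \<alpha>) Q"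
      and eq: "AE x in lborel. ennreal (Y x t) = ennreal (t powr (\<alpha> - 1)) * (\<integral>\<^sup>+s. ennreal (heat s x) \<partial>Q)"
      using kernel_as_mixture[OF a b Y t0] by blast
    note Q = mixing_lawD(1)[OF mix] and sQ [measurable_cong] = mixing_lawD(2)[OF mix]
      and pos = mixing_lawD(3)[OF mix] and L = mixing_lawD(4)[OF mix]
    interpret Q: finite_measure Q by fact
    interpret pair_sigma_finite Q "lborel :: 'a measure"
      by (simp add: pair_sigma_finite_def sigma_finite_lborel Q.sigma_finite_measure_axioms)
    have [measurable]: "cball (0::'a) 1 \<in> sets borel" by simp
    have int: "integrable Q (\<lambda>s. exp (-s))"
      by (rule Q.integrable_const_bound[where B=1]) (use pos in \<open>auto elim!: eventually_mono\<close>)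
    have "1 powr \<alpha> \<le> t powr \<alpha>" using t a by (intro powr_mono2) auto
    hence "c1 * (t powr \<alpha>) powr (-2) \<le> mittag_leffler \<alpha> \<alpha> (-(t powr \<alpha>))"
      by (intro c1(2)) simp
    hence "c1 * (t powr \<alpha>) powr (-2) \<le> (\<integral>s. exp (-s) \<partial>Q)" using L[of 1] by simp
    hence "ennreal (c1 * (t powr \<alpha>) powr (-2)) \<le> (\<integral>\<^sup>+s. ennreal (exp (-s)) \<partial>Q)"
      using int by (simp add: nn_integral_eq_integral ennreal_leI)
    hence "ennreal (t powr (\<alpha> - 1)) * (ennreal c2 * ennreal (c1 * (t powr \<alpha>) powr (-2)))
       \<le> ennreal (t powr (\<alpha> - 1)) * (ennreal c2 * (\<integral>\<^sup>+s. ennreal (exp (-s)) \<partial>Q))"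
      by (intro mult_left_mono) auto
    also have "ennreal c2 * (\<integral>\<^sup>+s. ennreal (exp (-s)) \<partial>Q) = (\<integral>\<^sup>+s. ennreal (c2 * exp (-s)) \<partial>Q)"
      using c2 by (subst nn_integral_cmult[symmetric]) (auto simp: ennreal_mult')
    also have "\<dots> \<le> (\<integral>\<^sup>+s. \<integral>\<^sup>+x. ennreal (heat s x) * indicator (cball 0 1) x \<partial>(lborel::'a measure) \<partial>Q)"
      by (rule nn_integral_mono_AE) (use pos c2(2) in \<open>auto elim!: eventually_mono\<close>)
    also have "\<dots> = (\<integral>\<^sup>+x. \<integral>\<^sup>+s. ennreal (heat s x) * indicator (cball 0 1) x \<partial>Q \<partial>(lborel::'a measure))"
      by (rule Fubini'[symmetric]) measurable
    also have "\<dots> = (\<integral>\<^sup>+x. (\<integral>\<^sup>+s. ennreal (heat s x) \<partial>Q) * indicator (cball 0 1) x \<partial>(lborel::'a measure))"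
      by (intro nn_integral_cong nn_integral_multc) measurable
    also have "ennreal (t powr (\<alpha> - 1)) * \<dots> = (\<integral>\<^sup>+x. ennreal (t powr (\<alpha> - 1)) * ((\<integral>\<^sup>+s. ennreal (heat s x) \<partial>Q) * indicator (cball 0 1) x) \<partial>(lborel::'a measure))"
      by (rule nn_integral_cmult[symmetric]) measurable
    also have "\<dots> = (\<integral>\<^sup>+x. ennreal (Y x t) * indicator (cball 0 1) x \<partial>lborel)"
      by (rule nn_integral_cong_AE) (use eq in \<open>eventually_elim, simp add: mult.assoc\<close>)
    finally have "ennreal (t powr (\<alpha> - 1)) * (ennreal c2 * ennreal (c1 * (t powr \<alpha>) powr (-2))) \<le> (\<integral>\<^sup>+x. ennreal (Y x t) * indicator (cball 0 1) x \<partial>lborel)"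
      by (simp add: mult_left_mono)
    moreover have "ennreal (t powr (\<alpha> - 1)) * (ennreal c2 * ennreal (c1 * (t powr \<alpha>) powr (-2))) = ennreal (c1 * c2 * (t powr (\<alpha> - 1) * (t powr \<alpha>) powr (-2)))"
      using c1 c2 by (simp add: ennreal_mult'[symmetric] mult_ac)
    moreover have "t powr (\<alpha> - 1) * (t powr \<alpha>) powr (-2) = t powr (-(1 + \<alpha>))"
        by (simp add: powr_powr powr_add[symmetric] add.commute minus_diff_commute)
    ultimately show "ennreal (c1 * c2 * t powr (-(1 + \<alpha>))) \<le> (\<integral>\<^sup>+x. ennreal (Y x t) * indicator (cball 0 1) x \<partial>lborel)" by simp
  qed
qed

section \<open>Convolution in time\<close>

text \<open>
  The time factor \<open>\<omega>\<close> in the product bound for the kernel: integrable at \<open>0\<close>, and with the decay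
  \<open>t\<^sup>-\<^sup>1\<^sup>-\<^sup>\<alpha>\<close> of the kernel at infinity.
\<close>

definition time_weight :: "real \<Rightarrow> real \<Rightarrow> real \<Rightarrow> real" where
  "time_weight \<alpha> \<epsilon> t = (if t \<ge> 1 then t powr (-1 - \<alpha>) else t powr (\<epsilon> - 1))"

lemma time_weight_measurable [measurable]: "time_weight \<alpha> \<epsilon> \<in> borel_measurable borel"
  unfolding time_weight_def[abs_def] by measurable

lemma time_weight_nonneg: "0 \<le> time_weight \<alpha> \<epsilon> t"
  by (simp add: time_weight_def)

lemma nn_integral_powr_tail:
  assumes "0 < (\<alpha>::real)"
  shows "(\<integral>\<^sup>+u. ennreal (indicator {1..} u * u powr (-1 - \<alpha>)) \<partial>lborel) = ennreal (1 / \<alpha>)"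
proof -
  have "((\<lambda>x. x powr (-1 - \<alpha>)) has_integral -(1 powr (-1 - \<alpha> + 1)) / (-1 - \<alpha> + 1)) {1..}"
    by (rule has_integral_powr_to_inf) (use assms in auto)
  from nn_integral_has_integral_lebesgue[OF _ this] show ?thesis by simp
qed

lemma time_weight_integral:
  assumes "0 < \<alpha>" "0 < \<epsilon>"
  shows "(\<integral>\<^sup>+s. ennreal (indicator {0<..<t} s * time_weight \<alpha> \<epsilon> (t - s)) \<partial>lborel) \<le> ennreal (1 / \<epsilon> + 1 / \<alpha>)"
proof -
  have "(\<integral>\<^sup>+s. ennreal (indicator {0<..<t} s * time_weight \<alpha> \<epsilon> (t - s)) \<partial>lborel)
     \<le> (\<integral>\<^sup>+s. ennreal (indicator {0<..} (t - s) * time_weight \<alpha> \<epsilon> (t - s)) \<partial>lborel)"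
    by (intro nn_integral_mono) (auto simp: indicator_def time_weight_nonneg)
  also have "\<dots> = (\<integral>\<^sup>+s. ennreal (indicator {0<..} s * time_weight \<alpha> \<epsilon> s) \<partial>lborel)"
    by (rule nn_integral_reflect[of "\<lambda>s. ennreal (indicator {0<..} s * time_weight \<alpha> \<epsilon> s)" t]) measurable
  also have "\<dots> \<le> (\<integral>\<^sup>+s. ennreal (indicator {0..1} s * s powr (\<epsilon> - 1)) + ennreal (indicator {1..} s * s powr (-1 - \<alpha>)) \<partial>lborel)"
    by (intro nn_integral_mono) (auto simp: indicator_def time_weight_def)
  also have "\<dots> = ennreal (1 / \<epsilon>) + ennreal (1 / \<alpha>)"
    using nn_integral_powr_0[of \<epsilon> 1] nn_integral_powr_tail[of \<alpha>] assms by (subst nn_integral_add) auto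
  also have "\<dots> = ennreal (1 / \<epsilon> + 1 / \<alpha>)" using assms by (subst ennreal_plus) auto
  finally show ?thesis .
qed

lemma powr_le_of_comparable:
  assumes "1 \<le> t" "t / 2 \<le> x" "x \<le> 2 * t"
  shows "x powr \<gamma> \<le> 2 powr \<bar>\<gamma>\<bar> * t powr (\<gamma>::real)"
proof (cases "\<gamma> \<ge> 0")
  case True
  have "x powr \<gamma> \<le> (2 * t) powr \<gamma>" using True assms by (intro powr_mono2) auto
  thus ?thesis using True by (simp add: powr_mult)
next
  case False
  have "x powr \<gamma> \<le> (t / 2) powr \<gamma>" using False assms by (intro powr_mono2') auto
  also have "\<dots> = 2 powr (-\<gamma>) * t powr \<gamma>" unfolding powr_divide powr_minus_divide by simp
  also have "-\<gamma> = \<bar>\<gamma>\<bar>" using False by simp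
  finally show ?thesis .
qed

text \<open>
  Below \<open>\<gamma> = 1 + \<alpha>\<close> the integrand is first enlarged to \<open>(1+s)\<^sup>\<alpha>\<^sup>-\<^sup>\<gamma>\<close>, whose exponent is above \<open>-1\<close>. This
  costs a power of \<open>t\<close> that the factor \<open>t\<^sup>1\<^sup>+\<^sup>\<alpha>\<close> can afford, and it avoids the logarithm at \<open>\<gamma> = 1\<close>.
\<close>

lemma source_time_integral:
  assumes a: "0 < \<alpha>" 
  obtains C where "0 < C" "\<And>t. 2 \<le> t \<Longrightarrow> 
    (\<integral>\<^sup>+s. ennreal (indicator {0<..<t} s * (1 + s) powr (-\<gamma>)) \<partial>lborel) \<le> ennreal (C * (t powr (1 + \<alpha>) * decay_rate \<alpha> \<gamma> t))"
proof (cases "\<gamma> < 1 + \<alpha>")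
  case True
  define d where "d = 1 + \<alpha> - \<gamma>"
  have d: "0 < d" using True by (simp add: d_def)
  show thesis
  proof (rule that[of "2 powr d / d"])
    show "0 < 2 powr d / d" using d by simp
    fix t :: real assume t: "2 \<le> t"
    have "(\<integral>\<^sup>+s. ennreal (indicator {0<..<t} s * (1 + s) powr (-\<gamma>)) \<partial>lborel)
       \<le> (\<integral>\<^sup>+s. ennreal (indicator {0..1 + t} (1 + 1 * s) * (1 + 1 * s) powr (d - 1)) \<partial>lborel)"
      using a by (intro nn_integral_mono ennreal_leI) (auto simp: indicator_def d_def intro!: powr_mono)
    also have "\<dots> = (\<integral>\<^sup>+s. ennreal (indicator {0..1 + t} s * s powr (d - 1)) \<partial>lborel)"
      using nn_integral_real_affine[of "\<lambda>s. ennreal (indicator {0..1 + t} s * s powr (d - 1))" 1 1] by simp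
    also have "\<dots> = ennreal ((1 + t) powr d / d)" by (rule nn_integral_powr_0) (use d t in auto)
    also have "\<dots> \<le> ennreal (2 powr d / d * (t powr (1 + \<alpha>) * decay_rate \<alpha> \<gamma> t))"
    proof (rule ennreal_leI)
      have "(1 + t) powr d \<le> (2 * t) powr d" using d t by (intro powr_mono2) auto
      also have "\<dots> = 2 powr d * t powr d" by (simp add: powr_mult)
      also have "t powr d = t powr (1 + \<alpha>) * decay_rate \<alpha> \<gamma> t"
        using True by (simp add: decay_rate_def d_def powr_add[symmetric])
      finally show "(1 + t) powr d / d \<le> 2 powr d / d * (t powr (1 + \<alpha>) * decay_rate \<alpha> \<gamma> t)"
        using d by (simp add: divide_right_mono)
    qed
    finally show "(\<integral>\<^sup>+s. ennreal (indicator {0<..<t} s * (1 + s) powr (-\<gamma>)) \<partial>lborel) \<le> ennreal (2 powr d / d * (t powr (1 + \<alpha>) * decay_rate \<alpha> \<gamma> t))" .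
  qed
next
  case False
  show thesis
  proof (rule that[of "1 / \<alpha>"])
    show "0 < 1 / \<alpha>" using a by simp
    fix t :: real assume t: "2 \<le> t"
    have "(\<integral>\<^sup>+s. ennreal (indicator {0<..<t} s * (1 + s) powr (-\<gamma>)) \<partial>lborel)
       \<le> (\<integral>\<^sup>+s. ennreal (indicator {1..} (1 + 1 * s) * (1 + 1 * s) powr (-1 - \<alpha>)) \<partial>lborel)"
      using False by (intro nn_integral_mono ennreal_leI) (auto simp: indicator_def intro!: powr_mono)
    also have "\<dots> = (\<integral>\<^sup>+s. ennreal (indicator {1..} s * s powr (-1 - \<alpha>)) \<partial>lborel)"
      using nn_integral_real_affine[of "\<lambda>s. ennreal (indicator {1..} s * s powr (-1 - \<alpha>))" 1 1] by simp
    also have "\<dots> = ennreal (1 / \<alpha>)" by (rule nn_integral_powr_tail[OF a])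
    also have "1 / \<alpha> = 1 / \<alpha> * (t powr (1 + \<alpha>) * decay_rate \<alpha> \<gamma> t)"
      using False t by (cases "\<gamma> = 1 + \<alpha>") (simp_all add: decay_rate_def powr_add[symmetric])
    finally show "(\<integral>\<^sup>+s. ennreal (indicator {0<..<t} s * (1 + s) powr (-\<gamma>)) \<partial>lborel) \<le> ennreal (1 / \<alpha> * (t powr (1 + \<alpha>) * decay_rate \<alpha> \<gamma> t))" .
  qed
qed

text \<open>
  Up to time \<open>t/2\<close> the weight is at most a multiple of \<open>t\<^sup>-\<^sup>1\<^sup>-\<^sup>\<alpha>\<close>; after it the source is at most a multiple of
  \<open>t\<^sup>-\<^sup>\<gamma>\<close> and the weight is integrable.
\<close>

lemma time_convolution:
  assumes a: "0 < \<alpha>" and e: "0 < \<epsilon>"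
  obtains C where "0 < C" "\<And>t. 2 \<le> t \<Longrightarrow> 
    (\<integral>\<^sup>+s. ennreal (indicator {0<..<t} s * (time_weight \<alpha> \<epsilon> (t - s) * (1 + s) powr (-\<gamma>))) \<partial>lborel) \<le> ennreal (C * decay_rate \<alpha> \<gamma> t)"
proof -
  obtain C1 where C1: "0 < C1" "\<And>t. 2 \<le> t \<Longrightarrow> 
    (\<integral>\<^sup>+s. ennreal (indicator {0<..<t} s * (1 + s) powr (-\<gamma>)) \<partial>lborel) \<le> ennreal (C1 * (t powr (1 + \<alpha>) * decay_rate \<alpha> \<gamma> t))"
    using source_time_integral[OF a, of \<gamma>] by blast
  define C2 where "C2 = 2 powr \<bar>\<gamma>\<bar> * (1 / \<epsilon> + 1 / \<alpha>)"
  have C2: "0 < C2" using a e by (simp add: C2_def add_pos_pos)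
  show thesis
  proof (rule that[of "2 powr (1 + \<alpha>) * C1 + C2"])
    show "0 < 2 powr (1 + \<alpha>) * C1 + C2" using C1 C2 by (simp add: add_pos_pos)
    fix t :: real assume t: "2 \<le> t"
    have D: "t powr (-\<gamma>) \<le> decay_rate \<alpha> \<gamma> t" "0 \<le> decay_rate \<alpha> \<gamma> t"
      using t by (auto simp: decay_rate_def intro!: powr_mono)
    have "(\<integral>\<^sup>+s. ennreal (indicator {0<..<t} s * (time_weight \<alpha> \<epsilon> (t - s) * (1 + s) powr (-\<gamma>))) \<partial>lborel)
      \<le> (\<integral>\<^sup>+s. ennreal ((t / 2) powr (-1 - \<alpha>)) * ennreal (indicator {0<..<t} s * (1 + s) powr (-\<gamma>)) 
           + ennreal (2 powr \<bar>\<gamma>\<bar> * t powr (-\<gamma>)) * ennreal (indicator {0<..<t} s * time_weight \<alpha> \<epsilon> (t - s)) \<partial>lborel)"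
    proof (rule nn_integral_mono)
      fix s :: real
      have tw: "0 \<le> time_weight \<alpha> \<epsilon> (t - s)" by (rule time_weight_nonneg)
      show "ennreal (indicator {0<..<t} s * (time_weight \<alpha> \<epsilon> (t - s) * (1 + s) powr (-\<gamma>)))
        \<le> ennreal ((t / 2) powr (-1 - \<alpha>)) * ennreal (indicator {0<..<t} s * (1 + s) powr (-\<gamma>)) 
           + ennreal (2 powr \<bar>\<gamma>\<bar> * t powr (-\<gamma>)) * ennreal (indicator {0<..<t} s * time_weight \<alpha> \<epsilon> (t - s))"
      proof (cases "s \<in> {0<..<t}")
        case True
        have "time_weight \<alpha> \<epsilon> (t - s) * (1 + s) powr (-\<gamma>) \<le> (t / 2) powr (-1 - \<alpha>) * (1 + s) powr (-\<gamma>) + 2 powr \<bar>\<gamma>\<bar> * t powr (-\<gamma>) * time_weight \<alpha> \<epsilon> (t - s)"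
        proof (cases "s \<le> t / 2")
          case le: True
          have "time_weight \<alpha> \<epsilon> (t - s) \<le> (t / 2) powr (-1 - \<alpha>)"
            using le t a by (auto simp: time_weight_def intro!: powr_mono2')
          hence "time_weight \<alpha> \<epsilon> (t - s) * (1 + s) powr (-\<gamma>) \<le> (t / 2) powr (-1 - \<alpha>) * (1 + s) powr (-\<gamma>)" by (intro mult_right_mono) auto
          moreover have "0 \<le> 2 powr \<bar>\<gamma>\<bar> * t powr (-\<gamma>) * time_weight \<alpha> \<epsilon> (t - s)" using tw by simp
          ultimately show ?thesis by linarith
        next
          case gt: False
          have "(1 + s) powr (-\<gamma>) \<le> 2 powr \<bar>-\<gamma>\<bar> * t powr (-\<gamma>)"
            by (rule powr_le_of_comparable) (use gt True t in auto)
          hence "time_weight \<alpha> \<epsilon> (t - s) * (1 + s) powr (-\<gamma>) \<le> time_weight \<alpha> \<epsilon> (t - s) * (2 powr \<bar>-\<gamma>\<bar> * t powr (-\<gamma>))"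
            using tw by (intro mult_left_mono)
          also have "\<dots> = 2 powr \<bar>\<gamma>\<bar> * t powr (-\<gamma>) * time_weight \<alpha> \<epsilon> (t - s)" by simp
          finally have "time_weight \<alpha> \<epsilon> (t - s) * (1 + s) powr (-\<gamma>) \<le> 2 powr \<bar>\<gamma>\<bar> * t powr (-\<gamma>) * time_weight \<alpha> \<epsilon> (t - s)" .
          moreover have "0 \<le> (t / 2) powr (-1 - \<alpha>) * (1 + s) powr (-\<gamma>)" by simp
          ultimately show ?thesis by linarith
        qed
        thus ?thesis using True tw
          by (simp add: ennreal_mult'[symmetric] ennreal_plus[symmetric] ennreal_leI del: ennreal_plus)
      qed auto
    qed
    also have "\<dots> = ennreal ((t / 2) powr (-1 - \<alpha>)) * (\<integral>\<^sup>+s. ennreal (indicator {0<..<t} s * (1 + s) powr (-\<gamma>)) \<partial>lborel)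
       + ennreal (2 powr \<bar>\<gamma>\<bar> * t powr (-\<gamma>)) * (\<integral>\<^sup>+s. ennreal (indicator {0<..<t} s * time_weight \<alpha> \<epsilon> (t - s)) \<partial>lborel)"
      by (subst nn_integral_add, measurable, subst nn_integral_cmult, measurable, subst nn_integral_cmult, measurable)
    also have "\<dots> \<le> ennreal ((t / 2) powr (-1 - \<alpha>)) * ennreal (C1 * (t powr (1 + \<alpha>) * decay_rate \<alpha> \<gamma> t))
       + ennreal (2 powr \<bar>\<gamma>\<bar> * t powr (-\<gamma>)) * ennreal (1 / \<epsilon> + 1 / \<alpha>)"
      by (intro add_mono mult_left_mono C1(2)[OF t] time_weight_integral[OF a e]) auto
    also have "\<dots> = ennreal ((t / 2) powr (-1 - \<alpha>) * (C1 * (t powr (1 + \<alpha>) * decay_rate \<alpha> \<gamma> t)) + 2 powr \<bar>\<gamma>\<bar> * t powr (-\<gamma>) * (1 / \<epsilon> + 1 / \<alpha>))"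
      using C1 D a e by (subst ennreal_plus) (auto simp: ennreal_mult')
    also have "\<dots> \<le> ennreal ((2 powr (1 + \<alpha>) * C1 + C2) * decay_rate \<alpha> \<gamma> t)"
    proof (rule ennreal_leI)
      have "(t / 2) powr (-1 - \<alpha>) * t powr (1 + \<alpha>) = 2 powr (1 + \<alpha>)"
      proof -
        have e: "-1 - \<alpha> = -(1 + \<alpha>)" by simp
        show ?thesis unfolding e using t by (simp only: powr_minus powr_divide) simp
      qed
      moreover have "(t / 2) powr (-1 - \<alpha>) * (C1 * (t powr (1 + \<alpha>) * decay_rate \<alpha> \<gamma> t))
          = ((t / 2) powr (-1 - \<alpha>) * t powr (1 + \<alpha>)) * C1 * decay_rate \<alpha> \<gamma> t"
        by (simp only: mult_ac)
      ultimately have X1: "(t / 2) powr (-1 - \<alpha>) * (C1 * (t powr (1 + \<alpha>) * decay_rate \<alpha> \<gamma> t)) = 2 powr (1 + \<alpha>) * C1 * decay_rate \<alpha> \<gamma> t"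
        by (simp only:)
      have X2: "2 powr \<bar>\<gamma>\<bar> * t powr (-\<gamma>) * (1 / \<epsilon> + 1 / \<alpha>) = C2 * t powr (-\<gamma>)" by (simp add: C2_def)
      have "C2 * t powr (-\<gamma>) \<le> C2 * decay_rate \<alpha> \<gamma> t" using C2 D by (intro mult_left_mono) auto
      thus "(t / 2) powr (-1 - \<alpha>) * (C1 * (t powr (1 + \<alpha>) * decay_rate \<alpha> \<gamma> t)) + 2 powr \<bar>\<gamma>\<bar> * t powr (-\<gamma>) * (1 / \<epsilon> + 1 / \<alpha>)
         \<le> (2 powr (1 + \<alpha>) * C1 + C2) * decay_rate \<alpha> \<gamma> t"
        unfolding X1 X2 distrib_right by simp
    qed
    finally show "(\<integral>\<^sup>+s. ennreal (indicator {0<..<t} s * (time_weight \<alpha> \<epsilon> (t - s) * (1 + s) powr (-\<gamma>))) \<partial>lborel) 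
      \<le> ennreal ((2 powr (1 + \<alpha>) * C1 + C2) * decay_rate \<alpha> \<gamma> t)" .
  qed
qed

section \<open>Space-time convolution in Lebesgue spaces\<close>

lemma powr_tangent:
  fixes y p :: real
  assumes "0 \<le> y" "1 \<le> p" shows "p * y \<le> y powr p + (p - 1)"
proof (cases "y = 0")
  case False
  have "(y powr p) powr (1/p) * 1 powr (1 - 1/p) \<le> 1/p * y powr p + (1 - 1/p) * 1"
    by (rule Youngs_inequality_0) (use assms False in auto)
  also have "(y powr p) powr (1/p) = y" using assms False by (simp add: powr_powr)
  finally have "y * p \<le> (1/p * y powr p + (1 - 1/p)) * p" using assms by (intro mult_right_mono) auto
  also have "\<dots> = y powr p + (p - 1)" using assms by (simp add: field_simps)
  finally show ?thesis by (simp add: mult.commute)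
qed (use assms in simp)

text \<open>
  Jensen's inequality for \<open>x\<^sup>p\<close> and a weight of total mass at most \<open>V\<close>, by integrating the tangent inequality at the point
  \<open>b = u/V\<close>. The number \<open>u\<close> only has to be a finite lower bound of the integral, so that the integral itself
  may be infinite.
\<close>

lemma jensen_powr_nn_integral:
  fixes h w :: "'b \<Rightarrow> real"
  assumes [measurable]: "h \<in> borel_measurable M" "w \<in> borel_measurable M"
    and h: "\<And>z. 0 \<le> h z" and w: "\<And>z. 0 \<le> w z" and p: "1 \<le> p"
    and V: "(\<integral>\<^sup>+z. ennreal (w z) \<partial>M) \<le> ennreal V" "0 < V"
    and u: "0 \<le> u" "ennreal u \<le> (\<integral>\<^sup>+z. ennreal (h z * w z) \<partial>M)"
  shows "ennreal (u powr p) \<le> ennreal (V powr (p - 1)) * (\<integral>\<^sup>+z. ennreal (h z powr p * w z) \<partial>M)"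
proof (cases "u = 0")
  case False
  hence u0: "0 < u" using u by simp
  define b where "b = u / V"
  have b: "0 < b" using u0 V by (simp add: b_def)
  define I where "I = (\<integral>\<^sup>+z. ennreal (h z powr p * w z) \<partial>M)"
  define c where "c = p * b powr (p - 1)"
  have c: "0 \<le> c" using p by (simp add: c_def)
  have tan: "c * h z \<le> h z powr p + (p - 1) * b powr p" for z
  proof -
    have "p * (h z / b) \<le> (h z / b) powr p + (p - 1)" using h b p by (intro powr_tangent) auto
    hence "b powr p * (p * (h z / b)) \<le> b powr p * ((h z / b) powr p + (p - 1))" by (rule mult_left_mono) simp
    also have "\<dots> = h z powr p + (p - 1) * b powr p" using b by (simp add: powr_divide algebra_simps)
    also have "b powr p * (p * (h z / b)) = c * h z" using b by (simp add: c_def powr_diff)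
    finally show ?thesis .
  qed
  have "ennreal (c * u) = ennreal c * ennreal u" using c by (rule ennreal_mult')
  also have "\<dots> \<le> ennreal c * (\<integral>\<^sup>+z. ennreal (h z * w z) \<partial>M)"
    by (intro mult_left_mono u) simp
  also have "\<dots> = (\<integral>\<^sup>+z. ennreal (c * h z * w z) \<partial>M)"
    using c by (subst nn_integral_cmult[symmetric]) (auto simp: ennreal_mult'[symmetric] mult.assoc)
  also have "\<dots> \<le> (\<integral>\<^sup>+z. ennreal (h z powr p * w z) + ennreal ((p - 1) * b powr p) * ennreal (w z) \<partial>M)"
  proof (rule nn_integral_mono)
    fix z
    have "c * h z * w z \<le> (h z powr p + (p - 1) * b powr p) * w z" by (intro mult_right_mono tan w)
    also have "\<dots> = h z powr p * w z + (p - 1) * b powr p * w z" by (simp add: distrib_right)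
    finally have "ennreal (c * h z * w z) \<le> ennreal (h z powr p * w z + (p - 1) * b powr p * w z)"
      by (rule ennreal_leI)
    also have "\<dots> = ennreal (h z powr p * w z) + ennreal ((p - 1) * b powr p) * ennreal (w z)"
      using w[of z] p by (subst ennreal_plus) (auto simp: ennreal_mult')
    finally show "ennreal (c * h z * w z) \<le> ennreal (h z powr p * w z) + ennreal ((p - 1) * b powr p) * ennreal (w z)" .
  qed
  also have "\<dots> = I + ennreal ((p - 1) * b powr p) * (\<integral>\<^sup>+z. ennreal (w z) \<partial>M)"
    unfolding I_def by (subst nn_integral_add, measurable, subst nn_integral_cmult, measurable)
  also have "\<dots> \<le> I + ennreal ((p - 1) * b powr p) * ennreal V"
    by (intro add_left_mono mult_left_mono V) simp
  also have "\<dots> = I + ennreal ((p - 1) * b powr p * V)" 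
    using p by (subst ennreal_mult'[of "(p - 1) * b powr p"]) auto
  finally have main: "ennreal (c * u) \<le> I + ennreal ((p - 1) * b powr p * V)" .
  have k1: "c * u = p * (u powr p / V powr (p - 1))"
    using u0 V by (simp add: c_def b_def powr_divide powr_diff)
  have k2: "b powr p * V = u powr p / V powr (p - 1)"
    using u0 V by (simp add: b_def powr_divide powr_diff)
  show ?thesis
  proof (cases "I = \<infinity>")
    case True
    then show ?thesis using V unfolding I_def[symmetric] by (simp add: ennreal_mult_eq_top_iff)
  next
    case False
    then obtain i where i: "I = ennreal i" "0 \<le> i" by (cases I) auto
    have "0 \<le> (p - 1) * b powr p * V" using p V by simp
    with main i have "c * u \<le> i + (p - 1) * b powr p * V"
      by (simp add: ennreal_plus[symmetric] ennreal_le_iff del: ennreal_plus)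
    moreover have "(p - 1) * b powr p * V = (p - 1) * (u powr p / V powr (p - 1))" by (simp only: mult.assoc k2)
    ultimately have "p * (u powr p / V powr (p - 1)) \<le> i + (p - 1) * (u powr p / V powr (p - 1))" by (simp only: k1)
    hence "u powr p / V powr (p - 1) \<le> i" by (simp only: left_diff_distrib)
    hence "u powr p \<le> V powr (p - 1) * i" using V by (simp add: field_simps)
    thus ?thesis unfolding I_def[symmetric] i by (simp add: ennreal_mult'[symmetric] ennreal_leI)
  qed
qed simp

text \<open>
  The pointwise content of Young's convolution inequality. Writing \<open>k F\<close> as \<open>H\<close> times \<open>k\<^sup>r + F\<^sup>m\<close>, Jensen's
  inequality for the weight \<open>k\<^sup>r + F\<^sup>m\<close> leaves \<open>H\<^sup>p (k\<^sup>r + F\<^sup>m)\<close>, and this is at most \<open>k\<^sup>r F\<^sup>m\<close>,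
  whose integral over both variables factorises.
\<close>

lemma young_pointwise:
  fixes k F :: real
  assumes k: "0 \<le> k" and F: "0 \<le> F" and m: "1 \<le> m" "m \<le> p" and r: "1 \<le> r" "r \<le> p" and e: "1 / r + 1 / m = 1 + 1 / p"
  shows "(k * F / (k powr r + F powr m)) powr p * (k powr r + F powr m) \<le> k powr r * F powr m"
    and "k * F / (k powr r + F powr m) * (k powr r + F powr m) = k * F"
proof -
  show "k * F / (k powr r + F powr m) * (k powr r + F powr m) = k * F"
    using k F by (cases "k powr r + F powr m = 0") (auto simp: add_nonneg_eq_0_iff)
  show "(k * F / (k powr r + F powr m)) powr p * (k powr r + F powr m) \<le> k powr r * F powr m"
  proof (cases "k = 0 \<or> F = 0")
    case False
    hence k: "0 < k" and F: "0 < F" using k F by auto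
    define a where "a = k powr r"
    define b where "b = F powr m"
    have a: "0 < a" and b: "0 < b" using k F by (auto simp: a_def b_def)
    have ka: "k = a powr (1 / r)" and Fb: "F = b powr (1 / m)" using k F m r by (auto simp: a_def b_def powr_powr)
    have pr: "0 \<le> p / r - 1" "0 \<le> p / m - 1" using m r by auto
    have "p / r + p / m = p * (1 / r + 1 / m)" by (simp add: distrib_left)
    also have "\<dots> = p * (1 + 1 / p)" by (simp only: e)
    also have "\<dots> = p + 1" using m by (simp add: distrib_left)
    finally have pe: "(p / r - 1) + (p / m - 1) = p - 1" by linarith
    have "(k * F) powr p = (a * a powr (p / r - 1)) * (b * b powr (p / m - 1))"
      using a b by (simp add: ka Fb powr_mult powr_powr powr_diff)
    also have "\<dots> \<le> (a * (a + b) powr (p / r - 1)) * (b * (a + b) powr (p / m - 1))"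
      using a b pr by (intro mult_mono powr_mono2) auto
    also have "\<dots> = a * b * (a + b) powr ((p / r - 1) + (p / m - 1))" by (simp only: powr_add mult_ac)
    also have "\<dots> = a * b * (a + b) powr (p - 1)" by (simp only: pe)
    finally have "(k * F) powr p \<le> a * b * (a + b) powr (p - 1)" .
    hence "(k * F) powr p / (a + b) powr (p - 1) \<le> a * b" using a b by (simp add: pos_divide_le_eq)
    moreover have "(k * F / (a + b)) powr p * (a + b) = (k * F) powr p / (a + b) powr (p - 1)"
      using a b by (simp add: powr_divide powr_diff)
    ultimately show ?thesis by (simp add: a_def b_def)
  qed auto
qed

text \<open>
  Young's inequality in space and Minkowski's inequality in time follow together from one use of
  Jensen's inequality for the space-time weight \<open>W(s) (k(x-y)\<^sup>r + F(y,s)\<^sup>m)\<close>, whose mass is at most \<open>(A + B) V\<close> for every \<open>x\<close>.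
\<close>

lemma convolution_Lp:
  fixes k :: "'a::euclidean_space \<Rightarrow> real" and F :: "'a \<Rightarrow> real \<Rightarrow> real" and W :: "real \<Rightarrow> real"
  assumes [measurable]: "k \<in> borel_measurable borel" "(\<lambda>(y, s). F y s) \<in> borel_measurable (borel \<Otimes>\<^sub>M borel)" "W \<in> borel_measurable borel"
    and k: "\<And>z. 0 \<le> k z" and F: "\<And>y s. 0 \<le> F y s" and W: "\<And>s. 0 \<le> W s"
    and m: "1 \<le> m" "m \<le> p" and r: "1 \<le> r" "r \<le> p" and e: "1 / r + 1 / m = 1 + 1 / p"
    and kA: "(\<integral>\<^sup>+z. ennreal (k z powr r) \<partial>lborel) \<le> ennreal A" and A: "0 < A"
    and FB: "AE s in lborel. W s \<noteq> 0 \<longrightarrow> (\<integral>\<^sup>+y. ennreal (F y s powr m) \<partial>lborel) \<le> ennreal B" and B: "0 < B"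
    and WV: "(\<integral>\<^sup>+s. ennreal (W s) \<partial>lborel) \<le> ennreal V" and V: "0 < V"
    and u: "\<And>x. 0 \<le> u x" "\<And>x. ennreal (u x) \<le> (\<integral>\<^sup>+s. \<integral>\<^sup>+y. ennreal (W s * (k (x - y) * F y s)) \<partial>lborel \<partial>lborel)"
  shows "(\<integral>\<^sup>+x. ennreal (u x powr p) \<partial>lborel) \<le> ennreal (((A + B) * V) powr (p - 1) * (A * B * V))"
proof -
  have p: "1 \<le> p" using m by simp
  define N :: "(real \<times> 'a) measure" where "N = lborel \<Otimes>\<^sub>M lborel"
  define G where "G x = (\<lambda>(s::real, y). k (x - y) powr r + F y s powr m)" for x
  define h where "h x = (\<lambda>(s, y). k (x - y) * F y s / G x (s, y))" for x
  define w where "w x = (\<lambda>(s, y). W s * G x (s, y))" for x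
  have [measurable]: "G x \<in> borel_measurable N" for x unfolding G_def N_def by measurable
  have [measurable]: "h x \<in> borel_measurable N" "w x \<in> borel_measurable N" for x
  proof -
    have "(\<lambda>z. G x (fst z, snd z)) \<in> borel_measurable N" by simp
    thus "h x \<in> borel_measurable N" "w x \<in> borel_measurable N" unfolding h_def w_def case_prod_beta
      by (simp_all add: N_def)
  qed
  have G0: "0 \<le> G x z" for x z by (auto simp: G_def split: prod.splits)
  have h0: "0 \<le> h x z" and w0: "0 \<le> w x z" for x z
    using k F W G0[of x z] by (auto simp: h_def w_def split: prod.splits)
  have kA': "(\<integral>\<^sup>+y. ennreal (k (x - y) powr r) \<partial>lborel) \<le> ennreal A" for x
    using nn_integral_reflect[of "\<lambda>z. ennreal (k z powr r)" x] kA by simp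
  have wI: "(\<integral>\<^sup>+z. ennreal (w x z) \<partial>N) \<le> ennreal ((A + B) * V)" for x
  proof -
    have "(\<integral>\<^sup>+z. ennreal (w x z) \<partial>N) = (\<integral>\<^sup>+s. \<integral>\<^sup>+y. ennreal (w x (s, y)) \<partial>lborel \<partial>lborel)"
      unfolding N_def by (rule lborel.nn_integral_fst[symmetric]) (simp add: N_def[symmetric])
    also have "\<dots> \<le> (\<integral>\<^sup>+s. ennreal (W s) * ennreal (A + B) \<partial>lborel)"
    proof (rule nn_integral_mono_AE, use FB in eventually_elim)
      case (elim s)
      have "(\<integral>\<^sup>+y. ennreal (w x (s, y)) \<partial>lborel) = (\<integral>\<^sup>+y. ennreal (W s) * (ennreal (k (x - y) powr r) + ennreal (F y s powr m)) \<partial>lborel)"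
        using W by (intro nn_integral_cong) (simp add: w_def G_def ennreal_mult' ennreal_plus[symmetric] del: ennreal_plus)
      also have "\<dots> = ennreal (W s) * ((\<integral>\<^sup>+y. ennreal (k (x - y) powr r) \<partial>lborel) + (\<integral>\<^sup>+y. ennreal (F y s powr m) \<partial>lborel))"
        by (subst nn_integral_cmult, measurable, subst nn_integral_add, measurable)
      also have "\<dots> \<le> ennreal (W s) * ennreal (A + B)"
      proof (cases "W s = 0")
        case False
        hence "(\<integral>\<^sup>+y. ennreal (F y s powr m) \<partial>lborel) \<le> ennreal B" using elim by simp
        thus ?thesis using kA'[of x] A B by (subst ennreal_plus) (auto intro!: mult_left_mono add_mono)
      qed simp
      finally show ?case .
    qed
    also have "\<dots> = (\<integral>\<^sup>+s. ennreal (W s) \<partial>lborel) * ennreal (A + B)"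
      by (rule nn_integral_multc) measurable
    also have "\<dots> \<le> ennreal V * ennreal (A + B)" by (intro mult_right_mono WV) simp
    also have "\<dots> = ennreal ((A + B) * V)" using V by (simp add: ennreal_mult'[symmetric] mult.commute)
    finally show ?thesis .
  qed
  define Z where "Z = ((A + B) * V) powr (p - 1)"
  have Z: "0 \<le> Z" by (simp add: Z_def)
  have pt: "ennreal (u x powr p) \<le> ennreal Z * (\<integral>\<^sup>+s. \<integral>\<^sup>+y. ennreal (W s * (k (x - y) powr r * F y s powr m)) \<partial>lborel \<partial>lborel)" for x
  proof -
    have "(\<integral>\<^sup>+s. \<integral>\<^sup>+y. ennreal (W s * (k (x - y) * F y s)) \<partial>lborel \<partial>lborel) = (\<integral>\<^sup>+s. \<integral>\<^sup>+y. ennreal (h x (s, y) * w x (s, y)) \<partial>lborel \<partial>lborel)"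
    proof (intro nn_integral_cong)
      fix s y
      have "h x (s, y) * w x (s, y) = W s * (k (x - y) * F y s / G x (s, y) * G x (s, y))" by (simp add: h_def w_def)
      also have "\<dots> = W s * (k (x - y) * F y s)"
        unfolding G_def prod.case by (simp only: young_pointwise(2)[OF k F m r e])
      finally show "ennreal (W s * (k (x - y) * F y s)) = ennreal (h x (s, y) * w x (s, y))" by simp
    qed
    also have "\<dots> = (\<integral>\<^sup>+z. ennreal (h x z * w x z) \<partial>N)"
      unfolding N_def by (rule lborel.nn_integral_fst) (simp add: N_def[symmetric])
    finally have "ennreal (u x) \<le> (\<integral>\<^sup>+z. ennreal (h x z * w x z) \<partial>N)"
      using u(2)[of x] by simp
    hence "ennreal (u x powr p) \<le> ennreal Z * (\<integral>\<^sup>+z. ennreal (h x z powr p * w x z) \<partial>N)"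
      unfolding Z_def using A B V by (intro jensen_powr_nn_integral p wI u(1) h0 w0) auto
    also have "(\<integral>\<^sup>+z. ennreal (h x z powr p * w x z) \<partial>N) = (\<integral>\<^sup>+s. \<integral>\<^sup>+y. ennreal (h x (s, y) powr p * w x (s, y)) \<partial>lborel \<partial>lborel)"
      unfolding N_def by (rule lborel.nn_integral_fst[symmetric]) (simp add: N_def[symmetric])
    also have "\<dots> \<le> (\<integral>\<^sup>+s. \<integral>\<^sup>+y. ennreal (W s * (k (x - y) powr r * F y s powr m)) \<partial>lborel \<partial>lborel)"
    proof (intro nn_integral_mono ennreal_leI)
      fix s y
      have "h x (s, y) powr p * w x (s, y) = W s * ((k (x - y) * F y s / (k (x - y) powr r + F y s powr m)) powr p * (k (x - y) powr r + F y s powr m))"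
        by (simp add: h_def w_def G_def)
      also have "\<dots> \<le> W s * (k (x - y) powr r * F y s powr m)"
        by (intro mult_left_mono W young_pointwise(1)[OF k F m r e])
      finally show "h x (s, y) powr p * w x (s, y) \<le> W s * (k (x - y) powr r * F y s powr m)" .
    qed
    finally show ?thesis by (simp add: mult_left_mono)
  qed
  have "(\<integral>\<^sup>+x. ennreal (u x powr p) \<partial>lborel) \<le> (\<integral>\<^sup>+x. ennreal Z * (\<integral>\<^sup>+s. \<integral>\<^sup>+y. ennreal (W s * (k (x - y) powr r * F y s powr m)) \<partial>lborel \<partial>lborel) \<partial>lborel)"
    by (intro nn_integral_mono pt)
  also have "\<dots> = ennreal Z * (\<integral>\<^sup>+x. \<integral>\<^sup>+s. \<integral>\<^sup>+y. ennreal (W s * (k (x - y) powr r * F y s powr m)) \<partial>lborel \<partial>lborel \<partial>lborel)"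
    by (rule nn_integral_cmult) measurable
  also have "(\<integral>\<^sup>+x. \<integral>\<^sup>+s. \<integral>\<^sup>+y. ennreal (W s * (k (x - y) powr r * F y s powr m)) \<partial>lborel \<partial>lborel \<partial>lborel)
     = (\<integral>\<^sup>+s. \<integral>\<^sup>+x. \<integral>\<^sup>+y. ennreal (W s * (k (x - y) powr r * F y s powr m)) \<partial>lborel \<partial>lborel \<partial>lborel)"
    by (rule lborel_pair.Fubini') measurable
  also have "\<dots> = (\<integral>\<^sup>+s. \<integral>\<^sup>+y. \<integral>\<^sup>+x. ennreal (W s * (k (x - y) powr r * F y s powr m)) \<partial>lborel \<partial>lborel \<partial>lborel)"
    by (intro nn_integral_cong lborel_pair.Fubini') measurable
  also have "\<dots> \<le> (\<integral>\<^sup>+s. \<integral>\<^sup>+y. ennreal (W s) * (ennreal A * ennreal (F y s powr m)) \<partial>lborel \<partial>lborel)"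
  proof (intro nn_integral_mono)
    fix s y
    have "(\<integral>\<^sup>+x. ennreal (k (x - y) powr r) \<partial>lborel) = (\<integral>\<^sup>+z. ennreal (k z powr r) \<partial>lborel)"
      using nn_integral_translate[of "\<lambda>z. ennreal (k z powr r)" y] by simp
    hence "(\<integral>\<^sup>+x. ennreal (k (x - y) powr r) \<partial>lborel) \<le> ennreal A" using kA by simp
    hence "ennreal (W s) * ((\<integral>\<^sup>+x. ennreal (k (x - y) powr r) \<partial>lborel) * ennreal (F y s powr m)) \<le> ennreal (W s) * (ennreal A * ennreal (F y s powr m))"
      by (intro mult_left_mono mult_right_mono) auto
    moreover have "(\<integral>\<^sup>+x. ennreal (W s * (k (x - y) powr r * F y s powr m)) \<partial>lborel) = ennreal (W s) * ((\<integral>\<^sup>+x. ennreal (k (x - y) powr r) \<partial>lborel) * ennreal (F y s powr m))"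
      using W[of s] by (simp add: ennreal_mult' nn_integral_cmult nn_integral_multc)
    ultimately show "(\<integral>\<^sup>+x. ennreal (W s * (k (x - y) powr r * F y s powr m)) \<partial>lborel) \<le> ennreal (W s) * (ennreal A * ennreal (F y s powr m))" by simp
  qed
  also have "\<dots> = (\<integral>\<^sup>+s. ennreal (W s) * (ennreal A * (\<integral>\<^sup>+y. ennreal (F y s powr m) \<partial>lborel)) \<partial>lborel)"
    by (intro nn_integral_cong) (simp add: nn_integral_cmult)
  also have "\<dots> \<le> (\<integral>\<^sup>+s. ennreal (W s) * ennreal (A * B) \<partial>lborel)"
  proof (rule nn_integral_mono_AE, use FB in eventually_elim)
    case (elim s)
    show ?case
    proof (cases "W s = 0")
      case False
      hence "(\<integral>\<^sup>+y. ennreal (F y s powr m) \<partial>lborel) \<le> ennreal B" using elim by simp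
      thus ?thesis using A by (simp add: ennreal_mult' mult_left_mono)
    qed simp
  qed
  also have "\<dots> = (\<integral>\<^sup>+s. ennreal (W s) \<partial>lborel) * ennreal (A * B)"
    by (rule nn_integral_multc) measurable
  also have "\<dots> \<le> ennreal V * ennreal (A * B)" by (intro mult_right_mono WV) simp
  also have "\<dots> = ennreal (A * B * V)" using V by (simp add: ennreal_mult'[symmetric] mult.commute)
  finally have "(\<integral>\<^sup>+x. ennreal (u x powr p) \<partial>lborel) \<le> ennreal Z * ennreal (A * B * V)"
    by (simp add: mult_left_mono)
  thus ?thesis using Z by (simp add: ennreal_mult'[symmetric] Z_def)
qed

lemma half_power: "(1/2::real) ^ k = 2 powr (-real k)"
  unfolding powr_minus_divide power_one_over by (simp add: powr_realpow)

text \<open>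
  Comparison with a geometric series over the dyadic balls of radius \<open>2\<^sup>-\<^sup>n\<close>.
\<close>

lemma integrable_norm_powr_ball:
  assumes b: "0 \<le> b" "b < real DIM('a::euclidean_space)"
  obtains A where "0 < A" "(\<integral>\<^sup>+z. ennreal (indicator (cball 0 1) z * norm z powr (-b)) \<partial>(lborel::'a measure)) \<le> ennreal A"
proof -
  define N where "N = DIM('a)"
  define V where "V = measure lborel (cball (0::'a) 1)"
  have V: "0 < V" unfolding V_def by (simp add: content_cball_pos)
  define q where "q = 2 powr (b - real N)"
  have q: "0 \<le> q" "q < 1" using b powr_less_mono[of "b - real N" 0 2] by (auto simp: q_def N_def)
  have em: "emeasure lborel (cball (0::'a) r) = ennreal (V * r ^ N)" if "0 \<le> r" for r
  proof -
    have "emeasure lborel (cball (0::'a) r) = ennreal (measure lborel (cball (0::'a) r))"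
      using emeasure_lborel_cball_finite[of "0::'a" r] by (intro emeasure_eq_ennreal_measure) auto
    also have "measure lborel (cball (0::'a) r) = V * r ^ N"
      using content_cball[of r "0::'a"] content_cball[of 1 "0::'a"] that by (simp add: V_def N_def)
    finally show ?thesis .
  qed
  have [measurable]: "cball (0::'a) r \<in> sets borel" for r by simp
  define g where "g n z = ennreal (2 powr (b * (real n + 1))) * indicator (cball (0::'a) ((1/2)^n)) z" for n z
  have "(\<integral>\<^sup>+z. ennreal (indicator (cball 0 1) z * norm z powr (-b)) \<partial>(lborel::'a measure)) \<le> (\<integral>\<^sup>+z. (\<Sum>n. g n z) \<partial>lborel)"
  proof (rule nn_integral_mono)
    fix z :: 'a
    show "ennreal (indicator (cball 0 1) z * norm z powr (-b)) \<le> (\<Sum>n. g n z)"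
    proof (cases "z \<in> cball 0 1 \<and> z \<noteq> 0")
      case True
      hence nz: "0 < norm z" "norm z \<le> 1" by auto
      obtain n where n: "(1/2)^(Suc n) < norm z" "norm z \<le> (1/2::real)^n"
      proof -
        obtain j where j: "(1/2::real)^j < norm z" using real_arch_pow_inv[OF nz(1), of "1/2"] by auto
        define n where "n = (LEAST j. (1/2::real)^j < norm z)"
        have n1: "(1/2::real)^n < norm z" unfolding n_def by (rule LeastI[of _ j]) (rule j)
        have "n \<noteq> 0" using n1 nz by (intro notI) simp
        then obtain n' where n': "n = Suc n'" by (cases n) auto
        have "\<not> (1/2::real)^n' < norm z"
          using not_less_Least[of n' "\<lambda>j. (1/2::real)^j < norm z"] n' by (simp add: n_def)
        thus thesis using that[of n'] n1 n' by auto
      qed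
      have "norm z powr (-b) \<le> ((1/2)^(Suc n)) powr (-b)"
        using n b by (intro powr_mono2') auto
      also have "\<dots> = 2 powr (b * (real n + 1))"
      proof -
        have "-real (Suc n) * -b = b * (real n + 1)" by (simp add: algebra_simps)
        thus ?thesis unfolding half_power powr_powr by (simp only:)
      qed
      finally have "ennreal (indicator (cball 0 1) z * norm z powr (-b)) \<le> g n z"
        using n True by (simp add: g_def ennreal_leI)
      also have "\<dots> \<le> (\<Sum>n. g n z)"
        using sum_le_suminf[of "\<lambda>n. g n z" "{n}"] by simp
      finally show ?thesis .
    next
      case False
      hence "z = 0 \<or> z \<notin> cball 0 1" by blast
      thus ?thesis by auto
    qed
  qed
  also have "\<dots> = (\<Sum>n. \<integral>\<^sup>+z. g n z \<partial>lborel)"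
    by (rule nn_integral_suminf) (simp add: g_def)
  also have "\<dots> = (\<Sum>n. ennreal (2 powr b * V * q ^ n))"
  proof (rule suminf_cong)
    fix n
    have "(\<integral>\<^sup>+z. g n z \<partial>lborel) = ennreal (2 powr (b * (real n + 1))) * ennreal (V * ((1/2)^n)^N)"
      unfolding g_def by (subst nn_integral_cmult_indicator) (auto simp: em)
    also have "\<dots> = ennreal (2 powr (b * (real n + 1)) * (V * ((1/2)^n)^N))"
      by (rule ennreal_mult'[symmetric]) simp
    also have "2 powr (b * (real n + 1)) * (V * ((1/2)^n)^N) = 2 powr b * V * q ^ n"
    proof -
      have 1: "((1/2::real)^n)^N = 2 powr (-(real n * real N))"
        using half_power[of "n * N"] by (simp only: power_mult of_nat_mult)
        have 2: "q ^ n = 2 powr ((b - real N) * real n)" by (simp add: q_def powr_realpow[symmetric] powr_powr)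
      have "2 powr (b * (real n + 1)) * 2 powr (-(real n * real N)) = 2 powr b * 2 powr ((b - real N) * real n)"
        by (simp add: powr_add[symmetric] algebra_simps)
      thus ?thesis unfolding 1 2 by (simp add: mult_ac)
    qed
    finally show "(\<integral>\<^sup>+z. g n z \<partial>lborel) = ennreal (2 powr b * V * q ^ n)" .
  qed
  also have "\<dots> = ennreal (\<Sum>n. 2 powr b * V * q ^ n)"
    using V q by (intro suminf_ennreal2 summable_mult summable_geometric) auto
  also have "(\<Sum>n. 2 powr b * V * q ^ n) = 2 powr b * V * (1 / (1 - q))"
    using q by (subst suminf_mult) (auto simp: suminf_geometric summable_geometric)
  finally have "(\<integral>\<^sup>+z. ennreal (indicator (cball 0 1) z * norm z powr (-b)) \<partial>(lborel::'a measure)) \<le> ennreal (2 powr b * V * (1 / (1 - q)))" .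
  thus thesis using V q by (intro that[of "2 powr b * V * (1 / (1 - q))"]) auto
qed

section \<open>Lebesgue norms and Borel representatives\<close>

text \<open>
  Measurability for the completion survives changes on null sets. It makes integrals of Lebesgue
  measurable functions computable from Borel representatives.
\<close>

lemma completion_measurable_AE_eq:
  fixes f g :: "'b \<Rightarrow> 'c::topological_space"
  assumes [measurable]: "g \<in> borel_measurable M" and eq: "AE x in M. f x = g x"
  shows "f \<in> borel_measurable (completion M)"
proof (rule measurableI)
  fix A :: "'c set" assume [measurable]: "A \<in> sets borel"
  have "AE x in M. \<not> (f x \<noteq> g x)" using eq by simp
  from sets_completion_AE[OF this] have [measurable]: "Measurable.pred (completion M) (\<lambda>x. f x \<noteq> g x)" .
  have "AE x in M. \<not> (f x \<in> A \<and> f x \<noteq> g x)" using eq by eventually_elim simp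
  from sets_completion_AE[OF this] have [measurable]: "Measurable.pred (completion M) (\<lambda>x. f x \<in> A \<and> f x \<noteq> g x)" .
  have [measurable]: "g \<in> borel_measurable (completion M)" by (rule measurable_completion) simp
  have "f -` A \<inter> space (completion M) = {x \<in> space (completion M). (g x \<in> A \<and> \<not> f x \<noteq> g x) \<or> (f x \<in> A \<and> f x \<noteq> g x)}"
    by auto
  also have "\<dots> \<in> sets (completion M)" by measurable
  finally show "f -` A \<inter> space (completion M) \<in> sets (completion M)" .
qed auto

lemma lebesgue_integral_AE_eq:
  fixes f g :: "'a::euclidean_space \<Rightarrow> real"
  assumes g: "g \<in> borel_measurable borel" and eq: "AE x in lborel. f x = g x"
  shows "(\<integral>x. f x \<partial>lebesgue) = (\<integral>x. g x \<partial>lborel)" "integrable lebesgue f \<longleftrightarrow> integrable lborel g"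
proof -
  have g': "g \<in> borel_measurable lborel" using g by simp
  have f: "f \<in> borel_measurable lebesgue" by (rule completion_measurable_AE_eq[OF g' eq])
  have gl: "g \<in> borel_measurable lebesgue" by (rule measurable_completion[OF g'])
  have eql: "AE x in lebesgue. f x = g x" using eq by (rule AE_completion)
  have "(\<integral>x. f x \<partial>lebesgue) = (\<integral>x. g x \<partial>lebesgue)"
    by (rule integral_cong_AE[OF f gl eql])
  thus "(\<integral>x. f x \<partial>lebesgue) = (\<integral>x. g x \<partial>lborel)"
    using integral_completion[OF g'] by simp
  have "integrable lebesgue f \<longleftrightarrow> integrable lebesgue g" by (rule integrable_cong_AE[OF f gl eql])
  thus "integrable lebesgue f \<longleftrightarrow> integrable lborel g" using integrable_completion[OF g'] by simp
qed

lemma nn_integral_lebesgue_on: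
  assumes "A \<in> sets borel"
  shows "(\<integral>\<^sup>+x. f x \<partial>lebesgue_on A) = (\<integral>\<^sup>+x. f x * indicator A x \<partial>(lborel :: 'a::euclidean_space measure))"
proof -
  have "A \<in> sets lebesgue" using assms by simp
  thus ?thesis by (simp add: nn_integral_restrict_space nn_integral_completion)
qed

lemma Lp_norm_finite_le:
  fixes g :: "'a::euclidean_space \<Rightarrow> real"
  assumes g: "g \<in> borel_measurable (lebesgue_on A)" and p: "p \<noteq> \<infinity>" "1 \<le> p" and c: "0 \<le> c"
    and I: "(\<integral>\<^sup>+x. ennreal (\<bar>g x\<bar> powr enn2real p) \<partial>lebesgue_on A) \<le> ennreal (c powr enn2real p)"
  shows "Lp_norm p A g \<le> ennreal c"
proof -
  have p1: "1 \<le> enn2real p" using p by (cases p) auto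
  define J where "J = (\<integral>\<^sup>+x. ennreal (\<bar>g x\<bar> powr enn2real p) \<partial>lebesgue_on A)"
  have J: "J \<noteq> \<infinity>" using I by (auto simp: J_def[symmetric] top_unique)
  then obtain j where j: "J = ennreal j" "0 \<le> j" by (cases J) auto
  have "j \<le> c powr enn2real p" using I j by (simp add: J_def[symmetric] ennreal_le_iff)
  hence "j powr (1 / enn2real p) \<le> (c powr enn2real p) powr (1 / enn2real p)" using j p1 by (intro powr_mono2) auto
  also have "\<dots> = c" using p1 c by (cases "c = 0") (simp_all add: powr_powr)
  finally show ?thesis using g p J j unfolding Lp_norm_def J_def[symmetric] by (simp add: Let_def ennreal_leI)
qed

lemma Lp_norm_finite_D:
  fixes g :: "'a::euclidean_space \<Rightarrow> real"
  assumes n: "Lp_norm p A g \<le> ennreal c" and p: "p \<noteq> \<infinity>" "1 \<le> p" and c: "0 \<le> c"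
  shows "g \<in> borel_measurable (lebesgue_on A)" "(\<integral>\<^sup>+x. ennreal (\<bar>g x\<bar> powr enn2real p) \<partial>lebesgue_on A) \<le> ennreal (c powr enn2real p)"
proof -
  have p1: "1 \<le> enn2real p" using p by (cases p) auto
  show g: "g \<in> borel_measurable (lebesgue_on A)"
  proof (rule ccontr)
    assume "g \<notin> borel_measurable (lebesgue_on A)"
    hence "Lp_norm p A g = \<infinity>" by (simp add: Lp_norm_def)
    thus False using n by (simp add: top_unique)
  qed
  define J where "J = (\<integral>\<^sup>+x. ennreal (\<bar>g x\<bar> powr enn2real p) \<partial>lebesgue_on A)"
  have J: "J \<noteq> \<infinity>"
  proof
    assume "J = \<infinity>"
    hence "Lp_norm p A g = \<infinity>" using g p by (simp add: Lp_norm_def J_def[symmetric])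
    thus False using n by (simp add: top_unique)
  qed
  then obtain j where j: "J = ennreal j" "0 \<le> j" by (cases J) auto
  have "Lp_norm p A g = ennreal (j powr (1 / enn2real p))"
    using g p J j unfolding Lp_norm_def J_def[symmetric] by (simp add: Let_def)
  hence "j powr (1 / enn2real p) \<le> c" using n c by (simp add: ennreal_le_iff)
  hence "(j powr (1 / enn2real p)) powr enn2real p \<le> c powr enn2real p" using p1 by (intro powr_mono2) auto
  also have "(j powr (1 / enn2real p)) powr enn2real p = j" using p1 j by (cases "j = 0") (simp_all add: powr_powr)
  finally show "(\<integral>\<^sup>+x. ennreal (\<bar>g x\<bar> powr enn2real p) \<partial>lebesgue_on A) \<le> ennreal (c powr enn2real p)"
    using j by (simp add: J_def[symmetric] ennreal_leI)
qed

lemma Lp_norm_infinity_le: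
  fixes g :: "'a::euclidean_space \<Rightarrow> real"
  assumes g: "g \<in> borel_measurable (lebesgue_on A)" and c: "\<And>x. \<bar>g x\<bar> \<le> c"
  shows "Lp_norm \<infinity> A g \<le> ennreal c"
  using g c unfolding Lp_norm_def by (auto intro!: esssup_I AE_I2 ennreal_leI)

lemma Lp_norm_infinity_D:
  fixes g :: "'a::euclidean_space \<Rightarrow> real"
  assumes n: "Lp_norm \<infinity> UNIV g \<le> ennreal c" and c: "0 \<le> c"
  shows "AE x in lborel. \<bar>g x\<bar> \<le> c"
proof -
  have g: "g \<in> borel_measurable (lebesgue_on UNIV)"
  proof (rule ccontr)
    assume "g \<notin> borel_measurable (lebesgue_on UNIV)"
    hence "Lp_norm \<infinity> UNIV g = \<infinity>" by (simp add: Lp_norm_def)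
    thus False using n by (simp add: top_unique)
  qed
  hence "esssup (lebesgue_on UNIV) (\<lambda>x. ennreal \<bar>g x\<bar>) \<le> ennreal c"
    using n by (simp add: Lp_norm_def)
  moreover have "AE x in lebesgue_on UNIV. ennreal \<bar>g x\<bar> \<le> esssup (lebesgue_on UNIV) (\<lambda>x. ennreal \<bar>g x\<bar>)" by (rule esssup_AE)
  ultimately have "AE x in lebesgue_on UNIV. ennreal \<bar>g x\<bar> \<le> ennreal c" by (auto elim!: eventually_mono)
  hence "AE x in lborel. ennreal \<bar>g x\<bar> \<le> ennreal c" unfolding lebesgue_on_UNIV_eq AE_completion_iff .
  thus ?thesis using c by simp
qed

lemma Lp_norm_ge:
  fixes g :: "'a::euclidean_space \<Rightarrow> real"
  assumes K: "compact K" "0 < emeasure lebesgue K" and p: "1 \<le> p" and c: "0 \<le> c" and g: "\<And>x. x \<in> K \<Longrightarrow> c \<le> g x"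
  shows "ennreal (c * (if p = \<infinity> then 1 else measure lebesgue K powr (1 / enn2real p))) \<le> Lp_norm p K g"
proof (cases "g \<in> borel_measurable (lebesgue_on K)")
  case False
  thus ?thesis by (simp add: Lp_norm_def)
next
  case True
  have Kb: "K \<in> sets borel" using K by (simp add: borel_compact)
  have Kl: "K \<in> sets lebesgue" using Kb by simp
  have "K \<in> lmeasurable" by (rule lmeasurable_compact[OF K(1)])
  hence "emeasure lebesgue K \<noteq> \<infinity>" by (auto simp: fmeasurable_def)
  hence Kf: "emeasure lebesgue K = ennreal (measure lebesgue K)" by (simp add: emeasure_eq_ennreal_measure)
  have m0: "0 < measure lebesgue K" using K(2) unfolding Kf by simp
  show ?thesis
  proof (cases "p = \<infinity>")
    case pinf: True
    have "emeasure (lebesgue_on K) (space (lebesgue_on K)) \<noteq> 0"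
      using K Kl by (simp add: space_restrict_space emeasure_restrict_space)
    hence "ennreal c = esssup (lebesgue_on K) (\<lambda>x. ennreal c)" by (rule esssup_const[symmetric])
    also have "\<dots> \<le> esssup (lebesgue_on K) (\<lambda>x. ennreal \<bar>g x\<bar>)"
      using g[THEN order_trans[OF _ abs_ge_self]]
        by (intro esssup_AE_mono) (auto intro!: AE_I2 ennreal_leI simp: space_restrict_space)
    finally show ?thesis using True pinf by (simp add: Lp_norm_def)
  next
    case pfin: False
    define P where "P = enn2real p"
    have P: "1 \<le> P" using p pfin by (cases p) (auto simp: P_def)
    define J where "J = (\<integral>\<^sup>+x. ennreal (\<bar>g x\<bar> powr P) \<partial>lebesgue_on K)"
    have "ennreal (c powr P * measure lebesgue K) = (\<integral>\<^sup>+x. ennreal (c powr P) \<partial>lebesgue_on K)"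
      using Kl Kf by (simp add: nn_integral_const space_restrict_space emeasure_restrict_space ennreal_mult')
    also have "\<dots> \<le> J" unfolding J_def
      using g[THEN order_trans[OF _ abs_ge_self]] c P
        by (intro nn_integral_mono ennreal_leI powr_mono2) (auto simp: space_restrict_space)
    finally have J: "ennreal (c powr P * measure lebesgue K) \<le> J" .
    show ?thesis
    proof (cases "J = \<infinity>")
      case True
      then show ?thesis using pfin \<open>g \<in> _\<close> by (simp add: Lp_norm_def P_def[symmetric] J_def[symmetric])
    next
      case False
      then obtain j where j: "J = ennreal j" "0 \<le> j" by (cases J) auto
      have "c powr P * measure lebesgue K \<le> j" using J j by (simp add: ennreal_le_iff)
      hence "(c powr P * measure lebesgue K) powr (1 / P) \<le> j powr (1 / P)" using P m0 by (intro powr_mono2) auto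
      also have "(c powr P * measure lebesgue K) powr (1 / P) = c * measure lebesgue K powr (1 / P)"
        using P c by (cases "c = 0") (simp_all add: powr_mult powr_powr)
      finally show ?thesis using pfin \<open>g \<in> _\<close> j False
        by (simp add: Lp_norm_def P_def[symmetric] J_def[symmetric] Let_def ennreal_leI)
    qed
  qed
qed

text \<open>
  A source is only Lebesgue measurable in space-time. Fubini's theorem, applied to a Borel null set that
  contains the exceptional points, shows that almost all time slices agree almost everywhere with those of
  a Borel function.
\<close>

lemma source_borel_representative:
  fixes f :: "'a::euclidean_space \<Rightarrow> real \<Rightarrow> real"
  assumes f: "(\<lambda>(x, t). f x t) \<in> borel_measurable (lebesgue_on (UNIV \<times> {0..}))"
  obtains g where "(\<lambda>(y, s). g y s) \<in> borel_measurable (borel \<Otimes>\<^sub>M borel)"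
    "AE z in lborel. 0 \<le> snd z \<longrightarrow> f (fst z) (snd z) = g (fst z) (snd z)"
    "AE s in lborel. 0 \<le> s \<longrightarrow> (AE y in lborel. f y s = g y s)"
proof -
  have "closed (UNIV \<times> {0..} :: ('a \<times> real) set)" by (intro closed_Times) auto
  hence [simp]: "(UNIV \<times> {0..} :: ('a \<times> real) set) \<in> sets lebesgue" by (simp add: borel_closed)
  have "(\<lambda>z. indicator (UNIV \<times> {0..}) z *\<^sub>R (case z of (x, t) \<Rightarrow> f x t)) \<in> borel_measurable (lebesgue :: ('a \<times> real) measure)"
    using f by (subst (asm) borel_measurable_restrict_space_iff) (auto simp: scaleR_conv_of_real)
  from completion_ex_borel_measurable_real[OF this[simplified real_scaleR_def]]
  obtain g' where g': "g' \<in> borel_measurable lborel"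
    and eq: "AE z in lborel. indicator (UNIV \<times> {0..}) z * (case z of (x, t) \<Rightarrow> f x t) = g' z" by auto
  define g where "g y s = g' (y, s)" for y s
  have gm: "(\<lambda>(y, s). g y s) \<in> borel_measurable (borel \<Otimes>\<^sub>M borel)"
    using g' by (simp add: g_def borel_prod)
  have AE1: "AE z in lborel. 0 \<le> snd z \<longrightarrow> f (fst z) (snd z) = g (fst z) (snd z)"
    using eq by eventually_elim (auto simp: g_def indicator_def split: prod.splits)
  obtain N where N: "N \<in> null_sets lborel" and sub: "{z \<in> space lborel. \<not> (0 \<le> snd z \<longrightarrow> f (fst z) (snd z) = g (fst z) (snd z))} \<subseteq> N"
    using AE1 unfolding eventually_ae_filter by blast
  have "AE z in lborel. z \<notin> N" using N by (rule AE_not_in)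
  hence "AE z in lborel \<Otimes>\<^sub>M lborel. z \<notin> N" unfolding lborel_prod .
  from lborel_pair.AE_pair[OF this] have "AE y in lborel. AE s in lborel. (y, s) \<notin> N" by simp
  moreover have "{z \<in> space (lborel \<Otimes>\<^sub>M lborel). (fst z, snd z) \<notin> N} \<in> sets (lborel \<Otimes>\<^sub>M lborel)"
  proof -
    have "N \<in> sets (lborel \<Otimes>\<^sub>M lborel)" unfolding lborel_prod using N by (auto simp: null_sets_def)
    hence "space (lborel \<Otimes>\<^sub>M lborel) - N \<in> sets (lborel \<Otimes>\<^sub>M lborel)"
      by (rule sets.compl_sets)
    moreover have "{z \<in> space (lborel \<Otimes>\<^sub>M lborel). (fst z, snd z) \<notin> N} = space (lborel \<Otimes>\<^sub>M lborel) - N" by auto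
    ultimately show ?thesis by simp
  qed
  ultimately have "AE s in lborel. AE y in lborel. (y, s) \<notin> N"
    using lborel_pair.AE_commute[of "\<lambda>y s. (y, s) \<notin> N"] by blast
  hence "AE s in lborel. 0 \<le> s \<longrightarrow> (AE y in lborel. f y s = g y s)"
  proof eventually_elim
    case (elim s)
    show ?case
    proof
      assume s: "0 \<le> s"
      show "AE y in lborel. f y s = g y s"
        using elim
      proof eventually_elim
        case (elim y)
        thus ?case using subsetD[OF sub, of "(y, s)"] s by auto
      qed
    qed
  qed
  from that[OF gm AE1 this] show thesis .
qed

text \<open>
  The equality holds for every \<open>x\<close>, not only for almost every \<open>x\<close>, since for fixed \<open>x\<close> the exceptional
  sets lie in the variables of integration. In particular the mild solution is Borel measurable in \<open>x\<close>.
\<close>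

lemma mild_solution_borel:
  fixes Y Yb f g :: "'a::euclidean_space \<Rightarrow> real \<Rightarrow> real"
  assumes [measurable]: "(\<lambda>(x, t). Yb x t) \<in> borel_measurable (borel \<Otimes>\<^sub>M borel)" "(\<lambda>(y, s). g y s) \<in> borel_measurable (borel \<Otimes>\<^sub>M borel)"
    and Y: "\<And>x t. 0 < t \<Longrightarrow> Y x t = Yb x t"
    and fg: "AE s in lborel. 0 \<le> s \<longrightarrow> (AE y in lborel. f y s = g y s)"
  shows "mild_solution Y f x t = (\<integral>s. indicator {0<..<t} s * (\<integral>y. Yb (x - y) (t - s) * g y s \<partial>lborel) \<partial>lborel)"
proof -
  have "mild_solution Y f x t = (\<integral>s. indicator {0<..<t} s *\<^sub>R (\<integral>y. Y (x - y) (t - s) * f y s \<partial>lebesgue) \<partial>lebesgue)"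
    unfolding mild_solution_def by (rule integral_restrict_space) simp
  also have "\<dots> = (\<integral>s. indicator {0<..<t} s * (\<integral>y. Yb (x - y) (t - s) * g y s \<partial>lborel) \<partial>lborel)"
  proof (rule lebesgue_integral_AE_eq(1))
    show "(\<lambda>s. indicator {0<..<t} s * (\<integral>y. Yb (x - y) (t - s) * g y s \<partial>lborel)) \<in> borel_measurable borel" by measurable
    show "AE s in lborel. indicator {0<..<t} s *\<^sub>R (\<integral>y. Y (x - y) (t - s) * f y s \<partial>lebesgue)
        = indicator {0<..<t} s * (\<integral>y. Yb (x - y) (t - s) * g y s \<partial>lborel)"
      using fg
    proof eventually_elim
      case (elim s)
      show ?case
      proof (cases "s \<in> {0<..<t}")
        case True
        hence "AE y in lborel. f y s = g y s" using elim by simp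
        hence "AE y in lborel. Y (x - y) (t - s) * f y s = Yb (x - y) (t - s) * g y s"
          by eventually_elim (use True Y in auto)
        hence "(\<integral>y. Y (x - y) (t - s) * f y s \<partial>lebesgue) = (\<integral>y. Yb (x - y) (t - s) * g y s \<partial>lborel)"
          by (intro lebesgue_integral_AE_eq(1)) measurable
        thus ?thesis by simp
      qed simp
    qed
  qed
  finally show ?thesis .
qed

lemma ennreal_abs_integral_le:
  fixes f :: "'b \<Rightarrow> real"
  shows "ennreal \<bar>\<integral>x. f x \<partial>M\<bar> \<le> (\<integral>\<^sup>+x. ennreal \<bar>f x\<bar> \<partial>M)"
proof (cases "integrable M f")
  case True thus ?thesis using integral_norm_bound_ennreal[OF True] by simp
qed (simp add: not_integrable_integral_eq)

lemma mild_solution_abs_le: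
  fixes Yb g :: "'a::euclidean_space \<Rightarrow> real \<Rightarrow> real"
  shows "ennreal \<bar>\<integral>s. indicator {0<..<t} s * (\<integral>y. Yb (x - y) (t - s) * g y s \<partial>lborel) \<partial>lborel\<bar>
    \<le> (\<integral>\<^sup>+s. indicator {0<..<t} s * (\<integral>\<^sup>+y. ennreal (\<bar>Yb (x - y) (t - s)\<bar> * \<bar>g y s\<bar>) \<partial>lborel) \<partial>lborel)"
proof -
  have "ennreal \<bar>\<integral>s. indicator {0<..<t} s * (\<integral>y. Yb (x - y) (t - s) * g y s \<partial>lborel) \<partial>lborel\<bar>
    \<le> (\<integral>\<^sup>+s. ennreal \<bar>indicator {0<..<t} s * (\<integral>y. Yb (x - y) (t - s) * g y s \<partial>lborel)\<bar> \<partial>lborel)"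
    by (rule ennreal_abs_integral_le)
  also have "\<dots> \<le> (\<integral>\<^sup>+s. indicator {0<..<t} s * (\<integral>\<^sup>+y. ennreal (\<bar>Yb (x - y) (t - s)\<bar> * \<bar>g y s\<bar>) \<partial>lborel) \<partial>lborel)"
  proof (rule nn_integral_mono)
    fix s
    show "ennreal \<bar>indicator {0<..<t} s * (\<integral>y. Yb (x - y) (t - s) * g y s \<partial>lborel)\<bar>
      \<le> indicator {0<..<t} s * (\<integral>\<^sup>+y. ennreal (\<bar>Yb (x - y) (t - s)\<bar> * \<bar>g y s\<bar>) \<partial>lborel)"
      using ennreal_abs_integral_le[of lborel "\<lambda>y. Yb (x - y) (t - s) * g y s"]
      by (simp add: indicator_def abs_mult)
  qed
  finally show ?thesis .
qed

section \<open>A product bound for the kernel\<close>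

text \<open>
  For \<open>t < 1\<close> the two pointwise bounds are combined with weights \<open>1 - \<eta>\<close> and \<open>\<eta>\<close>; the weight \<open>\<eta>\<close> is determined by the
  exponent \<open>e\<close> of \<open>|x|\<close>, and \<open>e > N - 2\<beta>\<close> means \<open>\<eta> > 1/3\<close>, which makes the exponent \<open>3\<alpha>\<eta> - \<alpha> - 1\<close> of \<open>t\<close> larger
  than \<open>-1\<close>.
\<close>

lemma kernel_dominated:
  fixes Y :: "'a::euclidean_space \<Rightarrow> real \<Rightarrow> real"
  assumes a: "0 < \<alpha>" "\<alpha> < 1" and b: "0 < \<beta>" "\<beta> \<le> 1" and N: "4 * \<beta> < real DIM('a)" and Y: "is_kernel_Y \<alpha> \<beta> Y"
    and e: "real DIM('a) - 2 * \<beta> < e" "e < real DIM('a)"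
  obtains C \<epsilon> where "0 < C" "0 < \<epsilon>" "\<And>t. 0 < t \<Longrightarrow> AE x in lborel. 
     0 \<le> Y x t \<and> Y x t \<le> C * (time_weight \<alpha> \<epsilon> t * (1 + indicator (cball 0 1) x * norm x powr (-e)))"
proof -
  obtain C where C: "0 < C" "\<And>t. 0 < t \<Longrightarrow> AE x in lborel. 
     Y x t \<le> C * (t powr (-(1 + \<alpha>)) * norm x powr (4 * \<beta> - real DIM('a))) \<and>
     Y x t \<le> C * (t powr (2 * \<alpha> - 1) * norm x powr (-real DIM('a) - 2 * \<beta>))"
    using kernel_upper[OF a b N Y] by blast
  define \<eta> where "\<eta> = (e - (real DIM('a) - 4 * \<beta>)) / (6 * \<beta>)"
  have \<eta>: "1/3 < \<eta>" "\<eta> \<le> 1" using e b by (auto simp: \<eta>_def field_simps)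
  have \<eta>e: "6 * \<beta> * \<eta> = e - (real DIM('a) - 4 * \<beta>)" using b by (simp add: \<eta>_def)
  define \<epsilon> where "\<epsilon> = 3 * \<alpha> * \<eta> - \<alpha>"
  have \<epsilon>: "0 < \<epsilon>" using \<eta> a by (simp add: \<epsilon>_def)
  show thesis
  proof (rule that[OF C(1) \<epsilon>])
    fix t :: real assume t: "0 < t"
    have "AE x in lborel. 0 \<le> Y x t" using Y t by (auto simp: is_kernel_Y_def)
    moreover have "AE x in lborel. x \<noteq> (0::'a)" by (rule AE_lborel_singleton)
    ultimately show "AE x in lborel. 0 \<le> Y x t \<and> Y x t \<le> C * (time_weight \<alpha> \<epsilon> t * (1 + indicator (cball 0 1) x * norm x powr (-e)))"
      using C(2)[OF t]
    proof eventually_elim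
      case (elim x)
      have x: "0 < norm x" using elim by simp
      have near: "norm x powr (4 * \<beta> - real DIM('a)) \<le> 1 + indicator (cball 0 1) x * norm x powr (-e)"
      proof (cases "norm x \<le> 1")
        case True
        have "norm x powr (4 * \<beta> - real DIM('a)) \<le> norm x powr (-e)"
          using True x e b by (intro powr_mono') auto
        thus ?thesis using True by simp
      next
        case False
        have "norm x powr (4 * \<beta> - real DIM('a)) \<le> norm x powr 0" using False N by (intro powr_mono) auto
        thus ?thesis using False x by simp
      qed
      have mid: "norm x powr (-e) \<le> 1 + indicator (cball 0 1) x * norm x powr (-e)"
      proof (cases "norm x \<le> 1")
        case False
        have "norm x powr (-e) \<le> norm x powr 0" using False N e b by (intro powr_mono) auto
        thus ?thesis using False x by simp
      qed simp
      show ?case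
      proof (intro conjI elim(1))
        show "Y x t \<le> C * (time_weight \<alpha> \<epsilon> t * (1 + indicator (cball 0 1) x * norm x powr (-e)))"
        proof (cases "1 \<le> t")
          case True
          have "Y x t \<le> C * (t powr (-(1 + \<alpha>)) * norm x powr (4 * \<beta> - real DIM('a)))"
            using elim by simp
          also have "\<dots> \<le> C * (t powr (-(1 + \<alpha>)) * (1 + indicator (cball 0 1) x * norm x powr (-e)))"
            using C by (intro mult_left_mono near) auto
          finally show ?thesis using True by (simp add: time_weight_def)
        next
          case False
          define y where "y = Y x t / C"
          have y: "0 \<le> y" "y \<le> t powr (-(1 + \<alpha>)) * norm x powr (4 * \<beta> - real DIM('a))" "y \<le> t powr (2 * \<alpha> - 1) * norm x powr (-real DIM('a) - 2 * \<beta>)"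
            using elim C by (auto simp: y_def field_simps)
          have "y = y powr (1 - \<eta>) * y powr \<eta>" using y by (cases "y = 0") (simp_all add: powr_add[symmetric])
          also have "\<dots> \<le> (t powr (-(1 + \<alpha>)) * norm x powr (4 * \<beta> - real DIM('a))) powr (1 - \<eta>) * (t powr (2 * \<alpha> - 1) * norm x powr (-real DIM('a) - 2 * \<beta>)) powr \<eta>"
            using y \<eta> by (intro mult_mono powr_mono2) auto
          also have "\<dots> = (t powr (-(1 + \<alpha>) * (1 - \<eta>)) * t powr ((2 * \<alpha> - 1) * \<eta>)) * (norm x powr ((4 * \<beta> - real DIM('a)) * (1 - \<eta>)) * norm x powr ((-real DIM('a) - 2 * \<beta>) * \<eta>))"
            by (simp only: powr_mult powr_powr mult_ac)
          also have "\<dots> = t powr (-(1 + \<alpha>) * (1 - \<eta>) + (2 * \<alpha> - 1) * \<eta>) * norm x powr ((4 * \<beta> - real DIM('a)) * (1 - \<eta>) + (-real DIM('a) - 2 * \<beta>) * \<eta>)"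
            by (simp only: powr_add)
          also have "-(1 + \<alpha>) * (1 - \<eta>) + (2 * \<alpha> - 1) * \<eta> = \<epsilon> - 1"
            by (simp add: \<epsilon>_def algebra_simps)
          also have "(4 * \<beta> - real DIM('a)) * (1 - \<eta>) + (-real DIM('a) - 2 * \<beta>) * \<eta> = 4 * \<beta> - real DIM('a) - 6 * \<beta> * \<eta>" by (simp add: algebra_simps)
          also have "\<dots> = -e" unfolding \<eta>e by simp
          also have "t powr (\<epsilon> - 1) * norm x powr (-e) \<le> t powr (\<epsilon> - 1) * (1 + indicator (cball 0 1) x * norm x powr (-e))"
            by (intro mult_left_mono mid) auto
          finally have "C * y \<le> C * (t powr (\<epsilon> - 1) * (1 + indicator (cball 0 1) x * norm x powr (-e)))"
            using C by (intro mult_left_mono) auto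
          thus ?thesis using C False by (simp add: y_def time_weight_def)
        qed
      qed
    qed
  qed
qed

section \<open>Exponents, moments of the source and convergence\<close>

text \<open>
  Below \<open>p\<^sub>c\<close> the source is used in \<open>L\<^sup>1\<close> and \<open>r = p\<close>. Otherwise \<open>m\<close> is taken between \<open>q\<^sub>c(p)\<close> and both \<open>p\<close> and
  \<open>q\<close>; the condition \<open>m > q\<^sub>c(p)\<close> is exactly \<open>1/r > 1 - 2\<beta>/N\<close>. The term \<open>1/p\<close> appears as
  \<open>enn2real (inverse p)\<close>, which is \<open>0\<close> for \<open>p = \<infinity>\<close>.
\<close>

lemma exponent_choice:
  fixes p :: ennreal and \<beta> :: real
  assumes b: "0 < \<beta>" and N: "4 * \<beta> < real n" and p: "1 \<le> p"
    and q: "ennreal (p_crit n \<beta>) \<le> p \<longrightarrow> (\<exists>q C1. ennreal (q_crit n \<beta> p) < q \<and> P q C1)"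
  obtains m r where "1 \<le> m" "ennreal m \<le> p" "1 \<le> r" "1 / r + 1 / m = 1 + enn2real (inverse p)"
    "1 - 2 * \<beta> / real n < 1 / r" "m = 1 \<or> (\<exists>q C1. ennreal m \<le> q \<and> P q C1)"
proof -
  define N where "N = real n"
  have NN: "4 * \<beta> < N" "0 < N" using N b by (auto simp: N_def)
  define ip where "ip = enn2real (inverse p)"
  have ipf: "ip = 1 / enn2real p" if "p \<noteq> \<infinity>"
    using that p by (cases p) (auto simp: ip_def inverse_ennreal divide_inverse)
  have ipi: "ip = 0" if "p = \<infinity>" using that by (simp add: ip_def)
  have pf: "1 \<le> enn2real p" "p = ennreal (enn2real p)" if "p \<noteq> \<infinity>" using that p by (cases p; auto)+
  show thesis
  proof (cases "ennreal (p_crit n \<beta>) \<le> p")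
    case False
    hence "p \<noteq> \<infinity>" by auto
    note P = pf[OF this] ipf[OF this]
    have "enn2real p < p_crit n \<beta>"
    proof (rule ccontr)
      assume "\<not> enn2real p < p_crit n \<beta>"
      hence "ennreal (p_crit n \<beta>) \<le> ennreal (enn2real p)" by (intro ennreal_leI) simp
      thus False using False P(2) by simp
    qed
    hence "enn2real p < N / (N - 2 * \<beta>)" by (simp add: p_crit_def N_def)
    hence "enn2real p * (N - 2 * \<beta>) < N" using NN b by (simp add: pos_less_divide_eq)
    hence "1 - 2 * \<beta> / N < 1 / enn2real p" using P NN by (simp add: field_simps)
    thus thesis using P p by (intro that[of 1 "enn2real p"]) (auto simp: N_def ip_def)
  next
    case True
    then obtain q C1 where q: "ennreal (q_crit n \<beta> p) < q" "P q C1" using q by blast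
    define Q where "Q = q_crit n \<beta> p"
    have Qd: "Q = N / (2 * \<beta> + N * ip)" by (simp add: Q_def q_crit_def N_def ip_def)
    have ip0: "0 \<le> ip" by (simp add: ip_def)
    have ip1: "N * ip \<le> N - 2 * \<beta>"
    proof (cases "p = \<infinity>")
      case True thus ?thesis using NN b by (simp add: ipi)
    next
      case False
      note P = pf[OF this] ipf[OF this]
      have "0 \<le> p_crit n \<beta>" using NN b by (simp add: p_crit_def N_def)
      moreover have "ennreal (p_crit n \<beta>) \<le> ennreal (enn2real p)" using True P(2) by simp
      ultimately have "p_crit n \<beta> \<le> enn2real p"
        using P(1) ennreal_le_iff[of "enn2real p" "p_crit n \<beta>"] by linarith
      hence "N / (N - 2 * \<beta>) \<le> enn2real p" by (simp add: p_crit_def N_def)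
      hence "N \<le> enn2real p * (N - 2 * \<beta>)" using NN b by (simp add: pos_divide_le_eq)
      hence "N / enn2real p \<le> N - 2 * \<beta>" using P(1) by (simp add: pos_divide_le_eq mult.commute)
      thus ?thesis unfolding P(3) by simp
    qed
    have den: "0 < 2 * \<beta> + N * ip" using b NN ip0 by (simp add: add_pos_nonneg)
    have Q1: "1 \<le> Q" using ip1 den by (simp add: Qd pos_le_divide_eq)
    have Qp: "ennreal Q < p"
    proof (cases "p = \<infinity>")
      case True thus ?thesis by simp
    next
      case False
      note P = pf[OF this] ipf[OF this]
      have "N < enn2real p * (2 * \<beta> + N * ip)" using P b by (simp add: distrib_left)
      hence "Q < enn2real p" using den by (simp add: Qd pos_divide_less_eq)
      hence "ennreal Q < ennreal (enn2real p)" using P by (intro ennreal_lessI) auto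
      thus ?thesis using P(2) by simp
    qed
    obtain m where m: "Q < m" "ennreal m \<le> p" "ennreal m \<le> q"
    proof (cases "min p q = \<infinity>")
      case True
      hence "p = \<infinity>" "q = \<infinity>" by (auto simp: min_def top_unique split: if_splits)
      thus thesis using that[of "Q + 1"] by simp
    next
      case False
      define m where "m = enn2real (min p q)"
      have m: "ennreal m = min p q" using False by (simp add: m_def less_top)
      have "ennreal Q < ennreal m" unfolding m using Qp q(1) by (simp add: Q_def)
      hence "Q < m" using Q1 by (simp add: ennreal_less_iff)
      thus thesis using that[of m] m by simp
    qed
    have m1: "1 \<le> m" using Q1 m by simp
    have mp: "ip \<le> 1 / m"
    proof (cases "p = \<infinity>")
      case True thus ?thesis using m1 by (simp add: ipi)
    next
      case False
      note P = pf[OF this] ipf[OF this]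
      have "ennreal m \<le> ennreal (enn2real p)" using m P(2) by simp
      hence "m \<le> enn2real p" using P(1) ennreal_le_iff[of "enn2real p" m] by linarith
      thus ?thesis using m1 P by (simp add: frac_le)
    qed
    define r where "r = 1 / (1 + ip - 1 / m)"
    have ir: "1 / r = 1 + ip - 1 / m" by (simp add: r_def)
    have "1 / m < 1 / Q" using m Q1 by (intro divide_strict_left_mono) auto
    also have "1 / Q = 2 * \<beta> / N + ip" using NN by (simp add: Qd add_divide_distrib)
    finally have r2: "1 - 2 * \<beta> / N < 1 / r" unfolding ir by simp
    have "0 < 1 - 2 * \<beta> / N" using NN b by (simp add: field_simps)
    hence "0 < 1 + ip - 1 / m" using r2 unfolding ir by linarith
    hence r1: "1 \<le> r" unfolding r_def using mp by (simp add: pos_le_divide_eq)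
    show thesis
      using m m1 r1 r2 ir q by (intro that[of m r]) (auto simp: N_def ip_def)
  qed
qed

text \<open>
  Interpolation between \<open>L\<^sup>1\<close> and \<open>L\<^sup>q\<close> for the normalised source \<open>F = |f| (1+s)\<^sup>\<gamma>\<close>: pointwise \<open>F\<^sup>m \<le> F + F\<^sup>q\<close> for
  finite \<open>q\<close>, and \<open>F\<^sup>m \<le> C\<^sup>m\<^sup>-\<^sup>1 F\<close> if \<open>F \<le> C\<close>.
\<close>

lemma source_moment:
  fixes f g :: "'a::euclidean_space \<Rightarrow> real \<Rightarrow> real"
  assumes fg: "AE s in lborel. 0 \<le> s \<longrightarrow> (AE y in lborel. f y s = g y s)"
    and C0: "0 < C0" "\<And>t. 0 \<le> t \<Longrightarrow> Lp_norm 1 UNIV (\<lambda>x. f x t) \<le> ennreal (C0 / (1 + t) powr \<gamma>)"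
    and m: "1 \<le> m"
    and q: "m = 1 \<or> (\<exists>q C1. ennreal m \<le> q \<and> C1 > 0 \<and> (\<forall>t\<ge>0. Lp_norm q UNIV (\<lambda>x. f x t) \<le> ennreal (C1 * (1 + t) powr (- \<gamma>))))"
  obtains B where "0 < B" "AE s in lborel. 0 \<le> s \<longrightarrow> (\<integral>\<^sup>+y. ennreal ((\<bar>g y s\<bar> * (1 + s) powr \<gamma>) powr m) \<partial>lborel) \<le> ennreal B"
proof -
  have fm: "(\<lambda>x. f x t) \<in> borel_measurable lebesgue" and
    f1: "(\<integral>\<^sup>+y. ennreal (\<bar>f y t\<bar> * (1 + t) powr \<gamma>) \<partial>lebesgue) \<le> ennreal C0" if t: "0 \<le> t" for t
  proof -
    have c: "0 \<le> C0 / (1 + t) powr \<gamma>" using C0 by simp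
    note D = Lp_norm_finite_D[OF C0(2)[OF t] _ _ c, simplified lebesgue_on_UNIV_eq]
    show [measurable]: "(\<lambda>x. f x t) \<in> borel_measurable lebesgue" using D(1) by simp
    have "(\<integral>\<^sup>+y. ennreal \<bar>f y t\<bar> \<partial>lebesgue) \<le> ennreal (C0 / (1 + t) powr \<gamma>)" using D(2) C0(1) by simp
    hence "(\<integral>\<^sup>+y. ennreal \<bar>f y t\<bar> \<partial>lebesgue) * ennreal ((1 + t) powr \<gamma>) \<le> ennreal (C0 / (1 + t) powr \<gamma>) * ennreal ((1 + t) powr \<gamma>)"
      by (intro mult_right_mono) auto
    also have "\<dots> = ennreal C0" using t c by (subst ennreal_mult'[symmetric]) auto
    also have "(\<integral>\<^sup>+y. ennreal \<bar>f y t\<bar> \<partial>lebesgue) * ennreal ((1 + t) powr \<gamma>) = (\<integral>\<^sup>+y. ennreal (\<bar>f y t\<bar> * (1 + t) powr \<gamma>) \<partial>lebesgue)"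
      by (subst nn_integral_multc[symmetric]) (auto simp: ennreal_mult')
    finally show "(\<integral>\<^sup>+y. ennreal (\<bar>f y t\<bar> * (1 + t) powr \<gamma>) \<partial>lebesgue) \<le> ennreal C0" .
  qed
  have "\<exists>B>0. \<forall>t\<ge>0. (\<integral>\<^sup>+y. ennreal ((\<bar>f y t\<bar> * (1 + t) powr \<gamma>) powr m) \<partial>lebesgue) \<le> ennreal B"
    using q
  proof (elim disjE exE conjE)
    assume "m = 1"
    thus ?thesis using f1 C0 by (intro exI[of _ C0]) auto
  next
    fix q C1 assume q: "ennreal m \<le> q" and C1: "0 < C1" and f: "\<forall>t\<ge>0. Lp_norm q UNIV (\<lambda>x. f x t) \<le> ennreal (C1 * (1 + t) powr (- \<gamma>))"
    show ?thesis
    proof (cases "q = \<infinity>")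
      case True
      show ?thesis
      proof (intro exI[of _ "C1 powr (m - 1) * C0"] conjI allI impI)
        show "0 < C1 powr (m - 1) * C0" using C0 C1 by simp
        fix t :: real assume t: "0 \<le> t"
        have [measurable]: "(\<lambda>x. f x t) \<in> borel_measurable lebesgue" by (rule fm[OF t])
        have "AE y in lborel. \<bar>f y t\<bar> \<le> C1 * (1 + t) powr (-\<gamma>)"
          using f t C1 unfolding True by (intro Lp_norm_infinity_D) auto
        hence ae: "AE y in lebesgue. \<bar>f y t\<bar> \<le> C1 * (1 + t) powr (-\<gamma>)" by (rule AE_completion)
        have "(\<integral>\<^sup>+y. ennreal ((\<bar>f y t\<bar> * (1 + t) powr \<gamma>) powr m) \<partial>lebesgue)
          \<le> (\<integral>\<^sup>+y. ennreal (C1 powr (m - 1)) * ennreal (\<bar>f y t\<bar> * (1 + t) powr \<gamma>) \<partial>lebesgue)"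
        proof (rule nn_integral_mono_AE, use ae in eventually_elim)
          case (elim y)
          define F where "F = \<bar>f y t\<bar> * (1 + t) powr \<gamma>"
          have F0: "0 \<le> F" by (simp add: F_def)
          have "F \<le> C1 * (1 + t) powr (-\<gamma>) * (1 + t) powr \<gamma>"
            unfolding F_def by (intro mult_right_mono elim) simp
          also have "\<dots> = C1" using t by (simp add: powr_minus)
          finally have FC: "F \<le> C1" .
          have "F powr m = F powr (m - 1) * F" using F0 by (cases "F = 0") (simp_all add: powr_diff)
          also have "\<dots> \<le> C1 powr (m - 1) * F" using F0 FC m by (intro mult_right_mono powr_mono2) auto
          finally show ?case unfolding F_def[symmetric] by (simp add: ennreal_mult'[symmetric] ennreal_leI)
        qed
        also have "\<dots> = ennreal (C1 powr (m - 1)) * (\<integral>\<^sup>+y. ennreal (\<bar>f y t\<bar> * (1 + t) powr \<gamma>) \<partial>lebesgue)"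
          by (rule nn_integral_cmult) measurable
        also have "\<dots> \<le> ennreal (C1 powr (m - 1)) * ennreal C0" by (intro mult_left_mono f1 t) simp
        finally show "(\<integral>\<^sup>+y. ennreal ((\<bar>f y t\<bar> * (1 + t) powr \<gamma>) powr m) \<partial>lebesgue) \<le> ennreal (C1 powr (m - 1) * C0)"
          by (simp add: ennreal_mult')
      qed
    next
      case False
      define Q where "Q = enn2real q"
      have qQ: "q = ennreal Q" "0 \<le> Q" using False by (auto simp: Q_def less_top)
      have mQ: "m \<le> Q" using q qQ by (simp add: ennreal_le_iff)
      have q1: "1 \<le> q" using m mQ qQ ennreal_leI[of 1 Q] by simp
      show ?thesis
      proof (intro exI[of _ "C0 + C1 powr Q"] conjI allI impI)
        show "0 < C0 + C1 powr Q" using C0 by (simp add: add_pos_nonneg)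
        fix t :: real assume t: "0 \<le> t"
        have [measurable]: "(\<lambda>x. f x t) \<in> borel_measurable lebesgue" by (rule fm[OF t])
        have c: "0 \<le> C1 * (1 + t) powr (-\<gamma>)" using C1 by simp
        have "Lp_norm q UNIV (\<lambda>x. f x t) \<le> ennreal (C1 * (1 + t) powr (- \<gamma>))" using f t by blast
        from Lp_norm_finite_D(2)[OF this False q1 c]
        have I: "(\<integral>\<^sup>+y. ennreal (\<bar>f y t\<bar> powr Q) \<partial>lebesgue) \<le> ennreal ((C1 * (1 + t) powr (-\<gamma>)) powr Q)"
          unfolding lebesgue_on_UNIV_eq Q_def .
        have "(\<integral>\<^sup>+y. ennreal ((\<bar>f y t\<bar> * (1 + t) powr \<gamma>) powr m) \<partial>lebesgue)
          \<le> (\<integral>\<^sup>+y. ennreal (\<bar>f y t\<bar> * (1 + t) powr \<gamma>) + ennreal (((1 + t) powr \<gamma>) powr Q) * ennreal (\<bar>f y t\<bar> powr Q) \<partial>lebesgue)"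
        proof (rule nn_integral_mono)
          fix y
          define F where "F = \<bar>f y t\<bar> * (1 + t) powr \<gamma>"
          have F0: "0 \<le> F" by (simp add: F_def)
          have "F powr m \<le> F + F powr Q"
          proof (cases "F \<le> 1")
            case True
            hence "F powr m \<le> F powr 1" using F0 m by (intro powr_mono') auto
            thus ?thesis using F0 by (simp add: add_increasing2)
          next
            case False
            hence "F powr m \<le> F powr Q" using mQ by (intro powr_mono) auto
            thus ?thesis using F0 by simp
          qed
          also have "F powr Q = ((1 + t) powr \<gamma>) powr Q * \<bar>f y t\<bar> powr Q"
            by (simp add: F_def powr_mult mult.commute)
          finally show "ennreal ((\<bar>f y t\<bar> * (1 + t) powr \<gamma>) powr m) \<le> ennreal (\<bar>f y t\<bar> * (1 + t) powr \<gamma>) + ennreal (((1 + t) powr \<gamma>) powr Q) * ennreal (\<bar>f y t\<bar> powr Q)"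
            unfolding F_def by (simp add: ennreal_mult'[symmetric] ennreal_plus[symmetric] ennreal_leI del: ennreal_plus)
        qed
        also have "\<dots> = (\<integral>\<^sup>+y. ennreal (\<bar>f y t\<bar> * (1 + t) powr \<gamma>) \<partial>lebesgue) + ennreal (((1 + t) powr \<gamma>) powr Q) * (\<integral>\<^sup>+y. ennreal (\<bar>f y t\<bar> powr Q) \<partial>lebesgue)"
          by (subst nn_integral_add, measurable, subst nn_integral_cmult, measurable)
        also have "\<dots> \<le> ennreal C0 + ennreal (((1 + t) powr \<gamma>) powr Q) * ennreal ((C1 * (1 + t) powr (-\<gamma>)) powr Q)"
          by (intro add_mono mult_left_mono f1 t I) auto
        also have "ennreal (((1 + t) powr \<gamma>) powr Q) * ennreal ((C1 * (1 + t) powr (-\<gamma>)) powr Q) = ennreal (((1 + t) powr \<gamma> * (C1 * (1 + t) powr (-\<gamma>))) powr Q)"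
          by (subst ennreal_mult'[symmetric]) (auto simp: powr_mult)
        also have "(1 + t) powr \<gamma> * (C1 * (1 + t) powr (-\<gamma>)) = C1" using t by (simp add: powr_minus)
        also have "ennreal C0 + ennreal (C1 powr Q) = ennreal (C0 + C1 powr Q)" using C0 by (subst ennreal_plus) auto
        finally show "(\<integral>\<^sup>+y. ennreal ((\<bar>f y t\<bar> * (1 + t) powr \<gamma>) powr m) \<partial>lebesgue) \<le> ennreal (C0 + C1 powr Q)" .
      qed
    qed
  qed
  then obtain B where B: "0 < B" "\<And>t. 0 \<le> t \<Longrightarrow> (\<integral>\<^sup>+y. ennreal ((\<bar>f y t\<bar> * (1 + t) powr \<gamma>) powr m) \<partial>lebesgue) \<le> ennreal B" by blast
  have "AE s in lborel. 0 \<le> s \<longrightarrow> (\<integral>\<^sup>+y. ennreal ((\<bar>g y s\<bar> * (1 + s) powr \<gamma>) powr m) \<partial>lborel) \<le> ennreal B"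
    using fg
  proof eventually_elim
    case (elim s)
    show ?case
    proof
      assume s: "0 \<le> s"
      have "(\<integral>\<^sup>+y. ennreal ((\<bar>g y s\<bar> * (1 + s) powr \<gamma>) powr m) \<partial>lborel) = (\<integral>\<^sup>+y. ennreal ((\<bar>f y s\<bar> * (1 + s) powr \<gamma>) powr m) \<partial>lborel)"
        by (rule nn_integral_cong_AE) (use elim s in \<open>auto elim!: eventually_mono\<close>)
      thus "(\<integral>\<^sup>+y. ennreal ((\<bar>g y s\<bar> * (1 + s) powr \<gamma>) powr m) \<partial>lborel) \<le> ennreal B"
        using B(2)[OF s] by (simp add: nn_integral_completion)
    qed
  qed
  from that[OF B(1) this] show thesis .
qed

text \<open>
  The Fourier transform at \<open>0\<close>.
\<close>

lemma kernel_mass: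
  fixes Y :: "'a::euclidean_space \<Rightarrow> real \<Rightarrow> real"
  assumes Y: "is_kernel_Y \<alpha> \<beta> Y" 
  obtains c where "0 \<le> c" "\<And>t. 0 < t \<Longrightarrow> (\<integral>\<^sup>+x. ennreal \<bar>Y x t\<bar> \<partial>lborel) = ennreal (c * t powr (\<alpha> - 1))"
proof -
  define c where "c = mittag_leffler \<alpha> \<alpha> 0"
  have I: "integrable lborel (\<lambda>x. Y x t)" "(\<integral>x. Y x t \<partial>lborel) = c * t powr (\<alpha> - 1)" "AE x in lborel. 0 \<le> Y x t" if "0 < t" for t
  proof -
    show "integrable lborel (\<lambda>x. Y x t)" "AE x in lborel. 0 \<le> Y x t"
      using Y that unfolding is_kernel_Y_def by auto
    have "(\<integral>x. cis (- (x \<bullet> 0)) * complex_of_real (Y x t) \<partial>lborel) =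
              complex_of_real (t powr (\<alpha> - 1) * mittag_leffler \<alpha> \<alpha> (- (norm (0::'a) powr (2 * \<beta>)) * t powr \<alpha>))"
      using Y that unfolding is_kernel_Y_def by blast
    hence "complex_of_real (\<integral>x. Y x t \<partial>lborel) = complex_of_real (c * t powr (\<alpha> - 1))"
      by (simp add: c_def mult.commute)
    thus "(\<integral>x. Y x t \<partial>lborel) = c * t powr (\<alpha> - 1)" by (simp only: of_real_eq_iff)
  qed
  have "0 \<le> (\<integral>x. Y x 1 \<partial>lborel)" using I(3)[of 1] by (intro integral_nonneg_AE) auto
  hence c: "0 \<le> c" using I(2)[of 1] by simp
  show thesis
  proof (rule that[OF c])
    fix t :: real assume t: "0 < t"
    have "(\<integral>\<^sup>+x. ennreal \<bar>Y x t\<bar> \<partial>lborel) = (\<integral>\<^sup>+x. ennreal (Y x t) \<partial>lborel)"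
      by (rule nn_integral_cong_AE) (use I(3)[OF t] in \<open>auto elim!: eventually_mono\<close>)
    also have "\<dots> = ennreal (c * t powr (\<alpha> - 1))"
      using I[OF t] by (simp add: nn_integral_eq_integral)
    finally show "(\<integral>\<^sup>+x. ennreal \<bar>Y x t\<bar> \<partial>lborel) = ennreal (c * t powr (\<alpha> - 1))" .
  qed
qed

lemma time_mass_finite:
  fixes \<gamma> :: real
  assumes a: "0 < \<alpha>" and t: "0 < t"
  shows "(\<integral>\<^sup>+s. ennreal (indicator {0<..<t} s * (C * (t - s) powr (\<alpha> - 1) * (1 + s) powr (-\<gamma>))) \<partial>lborel) < \<infinity>"
proof -
  define D where "D = \<bar>C\<bar> * (1 + t) powr \<bar>\<gamma>\<bar>"
  have "(\<integral>\<^sup>+s. ennreal (indicator {0<..<t} s * (C * (t - s) powr (\<alpha> - 1) * (1 + s) powr (-\<gamma>))) \<partial>lborel)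
    \<le> (\<integral>\<^sup>+s. ennreal D * ennreal (indicator {0..t} (t - s) * (t - s) powr (\<alpha> - 1)) \<partial>lborel)"
  proof (rule nn_integral_mono)
    fix s :: real
    show "ennreal (indicator {0<..<t} s * (C * (t - s) powr (\<alpha> - 1) * (1 + s) powr (-\<gamma>))) \<le> ennreal D * ennreal (indicator {0..t} (t - s) * (t - s) powr (\<alpha> - 1))"
    proof (cases "s \<in> {0<..<t}")
      case True
      have "(1 + s) powr (-\<gamma>) \<le> (1 + s) powr \<bar>\<gamma>\<bar>" using True by (intro powr_mono) auto
      also have "\<dots> \<le> (1 + t) powr \<bar>\<gamma>\<bar>" using True by (intro powr_mono2) auto
      finally have "C * (1 + s) powr (-\<gamma>) \<le> D" unfolding D_def by (intro mult_mono) auto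
      hence "(t - s) powr (\<alpha> - 1) * (C * (1 + s) powr (-\<gamma>)) \<le> (t - s) powr (\<alpha> - 1) * D"
        by (intro mult_left_mono) auto
      thus ?thesis using True by (simp add: D_def ennreal_mult'[symmetric] ennreal_leI mult_ac)
    qed auto
  qed
  also have "\<dots> = (\<integral>\<^sup>+s. ennreal D * ennreal (indicator {0..t} s * s powr (\<alpha> - 1)) \<partial>lborel)"
    by (rule nn_integral_reflect[of "\<lambda>s. ennreal D * ennreal (indicator {0..t} s * s powr (\<alpha> - 1))" t]) measurable
  also have "\<dots> = ennreal D * ennreal (t powr \<alpha> / \<alpha>)"
    using nn_integral_powr_0[of \<alpha> t] a t by (subst nn_integral_cmult) auto
  also have "\<dots> < \<infinity>" by (simp add: ennreal_mult_less_top)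
  finally show ?thesis .
qed

text \<open>
  Only the values at positive times are determined by the kernel; setting the others to \<open>0\<close> makes the
  function jointly Borel measurable on the whole space.
\<close>

definition positive_time :: "('a \<Rightarrow> real \<Rightarrow> real) \<Rightarrow> 'a \<Rightarrow> real \<Rightarrow> real" where
  "positive_time Y x t = indicator {0<..} t * Y x t"

lemma positive_time_measurable:
  fixes Y :: "'a::euclidean_space \<Rightarrow> real \<Rightarrow> real"
  assumes "is_kernel_Y \<alpha> \<beta> Y"
  shows "(\<lambda>(x, t). positive_time Y x t) \<in> borel_measurable (borel \<Otimes>\<^sub>M borel)"
proof -
  have "(\<lambda>z. indicator (UNIV \<times> {0<..}) z *\<^sub>R (case z of (x, t) \<Rightarrow> Y x t)) \<in> borel_measurable borel"
    using assms by (simp add: is_kernel_Y_def set_borel_measurable_def)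
  also have "(\<lambda>z. indicator (UNIV \<times> {0<..}) z *\<^sub>R (case z of (x, t) \<Rightarrow> Y x t)) = (\<lambda>(x, t). positive_time Y x t)"
    by (auto simp: fun_eq_iff positive_time_def indicator_def)
  finally show ?thesis by (simp add: borel_prod)
qed

text \<open>
  Tonelli: the integral over \<open>x\<close> of the absolute space-time integral is the time convolution of
  the masses of kernel and source, which is finite.
\<close>

lemma mild_solution_converges_of_L1:
  fixes Y f :: "'a::euclidean_space \<Rightarrow> real \<Rightarrow> real"
  assumes a: "0 < \<alpha>" and Y: "is_kernel_Y \<alpha> \<beta> Y" and t: "0 < t"
    and f: "(\<lambda>(x, t). f x t) \<in> borel_measurable (lebesgue_on (UNIV \<times> {0..}))"
    and C0: "0 < C0" "\<And>t. 0 \<le> t \<Longrightarrow> Lp_norm 1 UNIV (\<lambda>x. f x t) \<le> ennreal (C0 / (1 + t) powr \<gamma>)"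
  shows "mild_solution_converges Y f t"
proof -
  obtain g where gm[measurable]: "(\<lambda>(y, s). g y s) \<in> borel_measurable (borel \<Otimes>\<^sub>M borel)"
    and fg1: "AE z in lborel. 0 \<le> snd z \<longrightarrow> f (fst z) (snd z) = g (fst z) (snd z)"
    and fg: "AE s in lborel. 0 \<le> s \<longrightarrow> (AE y in lborel. f y s = g y s)"
    by (rule source_borel_representative[OF f])
  obtain B where B: "0 < B" "AE s in lborel. 0 \<le> s \<longrightarrow> (\<integral>\<^sup>+y. ennreal ((\<bar>g y s\<bar> * (1 + s) powr \<gamma>) powr 1) \<partial>lborel) \<le> ennreal B"
    using source_moment[OF fg C0, of 1] by blast
  obtain c where c: "0 \<le> c" "\<And>t. 0 < t \<Longrightarrow> (\<integral>\<^sup>+x. ennreal \<bar>Y x t\<bar> \<partial>lborel) = ennreal (c * t powr (\<alpha> - 1))"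
    using kernel_mass[OF Y] by blast
  define Yb where "Yb = positive_time Y"
  have Ybm[measurable]: "(\<lambda>(x, t). Yb x t) \<in> borel_measurable (borel \<Otimes>\<^sub>M borel)"
    unfolding Yb_def by (rule positive_time_measurable[OF Y])
  have Yb: "Yb x t = Y x t" if "0 < t" for x t using that by (simp add: Yb_def positive_time_def)
  define T where "T x = (\<integral>\<^sup>+s. \<integral>\<^sup>+y. indicator {0<..<t} s * ennreal (\<bar>Yb (x - y) (t - s)\<bar> * \<bar>g y s\<bar>) \<partial>lborel \<partial>lborel)" for x
  have Tm: "T \<in> borel_measurable lborel" unfolding T_def by measurable
  have "(\<integral>\<^sup>+x. T x \<partial>lborel) = (\<integral>\<^sup>+s. \<integral>\<^sup>+x. \<integral>\<^sup>+y. indicator {0<..<t} s * ennreal (\<bar>Yb (x - y) (t - s)\<bar> * \<bar>g y s\<bar>) \<partial>lborel \<partial>lborel \<partial>lborel)"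
    unfolding T_def by (rule lborel_pair.Fubini') measurable
  also have "\<dots> = (\<integral>\<^sup>+s. \<integral>\<^sup>+y. \<integral>\<^sup>+x. indicator {0<..<t} s * ennreal (\<bar>Yb (x - y) (t - s)\<bar> * \<bar>g y s\<bar>) \<partial>lborel \<partial>lborel \<partial>lborel)"
    by (intro nn_integral_cong lborel_pair.Fubini') measurable
  also have "\<dots> \<le> (\<integral>\<^sup>+s. ennreal (indicator {0<..<t} s * (c * B * (t - s) powr (\<alpha> - 1) * (1 + s) powr (-\<gamma>))) \<partial>lborel)"
  proof (rule nn_integral_mono_AE, use B(2) in eventually_elim)
    case (elim s)
    show ?case
    proof (cases "s \<in> {0<..<t}")
      case True
      hence s: "0 < s" "s < t" by auto
      have "(\<integral>\<^sup>+x. ennreal \<bar>Yb (x - y) (t - s)\<bar> \<partial>lborel) = ennreal (c * (t - s) powr (\<alpha> - 1))" for y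
      proof -
        have "(\<integral>\<^sup>+x. ennreal \<bar>Yb (x - y) (t - s)\<bar> \<partial>lborel) = (\<integral>\<^sup>+x. ennreal \<bar>Yb x (t - s)\<bar> \<partial>lborel)"
          by (rule nn_integral_translate[of "\<lambda>x. ennreal \<bar>Yb x (t - s)\<bar>" y]) measurable
        also have "\<dots> = ennreal (c * (t - s) powr (\<alpha> - 1))" using c(2)[of "t - s"] s by (simp add: Yb)
        finally show ?thesis .
      qed
      hence "(\<integral>\<^sup>+y. \<integral>\<^sup>+x. indicator {0<..<t} s * ennreal (\<bar>Yb (x - y) (t - s)\<bar> * \<bar>g y s\<bar>) \<partial>lborel \<partial>lborel)
         = (\<integral>\<^sup>+y. ennreal (c * (t - s) powr (\<alpha> - 1)) * ennreal \<bar>g y s\<bar> \<partial>lborel)"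
        using True by (intro nn_integral_cong) (simp add: ennreal_mult' nn_integral_multc)
      also have "\<dots> = (\<integral>\<^sup>+y. ennreal (c * (t - s) powr (\<alpha> - 1) * (1 + s) powr (-\<gamma>)) * ennreal (\<bar>g y s\<bar> * (1 + s) powr \<gamma>) \<partial>lborel)"
        using s c(1) by (intro nn_integral_cong) (simp add: ennreal_mult'[symmetric] powr_minus)
      also have "\<dots> = ennreal (c * (t - s) powr (\<alpha> - 1) * (1 + s) powr (-\<gamma>)) * (\<integral>\<^sup>+y. ennreal (\<bar>g y s\<bar> * (1 + s) powr \<gamma>) \<partial>lborel)"
        by (rule nn_integral_cmult) measurable
      also have "\<dots> \<le> ennreal (c * (t - s) powr (\<alpha> - 1) * (1 + s) powr (-\<gamma>)) * ennreal B"
        using elim s by (intro mult_left_mono) auto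
      also have "\<dots> = ennreal (indicator {0<..<t} s * (c * B * (t - s) powr (\<alpha> - 1) * (1 + s) powr (-\<gamma>)))"
        using True B c(1) by (simp add: ennreal_mult''[symmetric] mult_ac)
      finally show ?thesis .
    qed simp
  qed
  also have "\<dots> < \<infinity>" by (rule time_mass_finite[OF a t])
  finally have "AE x in lborel. T x \<noteq> \<infinity>" using Tm by (intro nn_integral_noteq_infinite) auto
  hence "AE x in lborel. integrable (lebesgue_on (UNIV \<times> {0<..<t})) (\<lambda>(y, s). Y (x - y) (t - s) * f y s)"
  proof eventually_elim
    case (elim x)
    define G where "G = (\<lambda>z. indicator {0<..<t} (snd z) * (Yb (x - fst z) (t - snd z) * g (fst z) (snd z)))"
    have Gm: "G \<in> borel_measurable (borel \<Otimes>\<^sub>M borel)" unfolding G_def by measurable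
    have "open (UNIV \<times> {0<..<t} :: ('a \<times> real) set)" by (intro open_Times) auto
    hence [simp]: "(UNIV \<times> {0<..<t} :: ('a \<times> real) set) \<in> sets lebesgue" by simp
    have "integrable (lebesgue_on (UNIV \<times> {0<..<t})) (\<lambda>(y, s). Y (x - y) (t - s) * f y s)
      \<longleftrightarrow> integrable lebesgue (\<lambda>z. indicator (UNIV \<times> {0<..<t}) z *\<^sub>R (case z of (y, s) \<Rightarrow> Y (x - y) (t - s) * f y s))"
      by (rule integrable_restrict_space) simp
    also have "\<dots> \<longleftrightarrow> integrable lborel G"
    proof (rule lebesgue_integral_AE_eq(2))
      show "G \<in> borel_measurable borel" using Gm by (simp add: borel_prod)
      show "AE z in lborel. indicator (UNIV \<times> {0<..<t}) z *\<^sub>R (case z of (y, s) \<Rightarrow> Y (x - y) (t - s) * f y s) = G z"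
        using fg1 by eventually_elim (auto simp: G_def Yb indicator_def split: prod.splits)
    qed
    also have "integrable lborel G"
    proof (rule integrableI_bounded)
      show "G \<in> borel_measurable lborel" using Gm by (simp add: borel_prod)
      have "(\<integral>\<^sup>+z. ennreal (norm (G z)) \<partial>lborel) = (\<integral>\<^sup>+z. ennreal (norm (G z)) \<partial>(lborel \<Otimes>\<^sub>M lborel))" by (simp add: lborel_prod)
      also have "\<dots> = (\<integral>\<^sup>+s. \<integral>\<^sup>+y. ennreal (norm (G (y, s))) \<partial>lborel \<partial>lborel)"
        by (rule lborel_pair.nn_integral_snd[symmetric]) (use Gm in simp)
      also have "\<dots> = T x" unfolding T_def
        by (intro nn_integral_cong) (auto simp: G_def indicator_def abs_mult)
      finally show "(\<integral>\<^sup>+z. ennreal (norm (G z)) \<partial>lborel) < \<infinity>"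
        using elim by (simp add: less_top)
    qed
    finally show ?case by simp
  qed
  thus ?thesis unfolding mild_solution_converges_def by (rule AE_completion)
qed

section \<open>The upper estimate\<close>

lemma AE_lborel_reflect:
  fixes x :: "'a::euclidean_space"
  assumes "AE z in lborel. P z"
  shows "AE y in lborel. P (x - y)"
proof -
  have eq: "(lborel :: 'a measure) = distr lborel borel (\<lambda>y. x + (-1) *\<^sub>R y)"
    by (subst lborel_affine[of "-1" x]) (simp_all add: density_1)
  have "AE z in distr lborel borel (\<lambda>y. x + (-1) *\<^sub>R y). P z" using assms by (subst eq[symmetric])
  from AE_distrD[OF _ this] show ?thesis by simp
qed

lemma product_le_sum_powr:
  fixes k F :: real
  assumes k: "0 \<le> k" and F: "0 \<le> F" and m: "1 \<le> m" and r: "1 \<le> r" and e: "1 / r + 1 / m = 1"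
  shows "k * F \<le> k powr r + F powr m"
proof -
  define c where "c = k powr r + F powr m"
  have c: "0 \<le> c" by (simp add: c_def)
  have "k = (k powr r) powr (1 / r)" using k r by (cases "k = 0") (simp_all add: powr_powr)
  also have "\<dots> \<le> c powr (1 / r)" using r by (intro powr_mono2) (auto simp: c_def)
  finally have 1: "k \<le> c powr (1 / r)" .
  have "F = (F powr m) powr (1 / m)" using F m by (cases "F = 0") (simp_all add: powr_powr)
  also have "\<dots> \<le> c powr (1 / m)" using m by (intro powr_mono2) (auto simp: c_def)
  finally have 2: "F \<le> c powr (1 / m)" .
  have "k * F \<le> c powr (1 / r) * c powr (1 / m)" using 1 2 k F by (intro mult_mono) auto
  also have "\<dots> = c powr 1" by (simp only: powr_add[symmetric] e)
  also have "\<dots> = c" using c by simp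
  finally show ?thesis by (simp add: c_def)
qed

text \<open>
  The summand \<open>1\<close> of the product bound contributes uniformly in \<open>x\<close> through the \<open>L\<^sup>1\<close> norm of the source;
  the singular summand \<open>k\<close> leaves a space-time convolution.
\<close>

lemma mild_solution_split:
  fixes Y g :: "'a::euclidean_space \<Rightarrow> real \<Rightarrow> real"
  assumes Ym: "(\<lambda>(x, t). Yb x t) \<in> borel_measurable (borel \<Otimes>\<^sub>M borel)"
    and gm: "(\<lambda>(y, s). g y s) \<in> borel_measurable (borel \<Otimes>\<^sub>M borel)"
    and km: "k \<in> borel_measurable borel" and k0: "\<And>z. 0 \<le> k z"
    and wm: "w \<in> borel_measurable borel" and w0: "\<And>t. 0 \<le> w t" and C: "0 \<le> C"
    and dom: "\<And>t. 0 < t \<Longrightarrow> AE x in lborel. 0 \<le> Yb x t \<and> Yb x t \<le> C * (w t * (1 + k (x::'a)))"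
    and C0: "0 \<le> C0" "AE s in lborel. 0 \<le> s \<longrightarrow> (\<integral>\<^sup>+y. ennreal (\<bar>g y s\<bar> * (1 + s) powr \<gamma>) \<partial>lborel) \<le> ennreal C0"
    and V: "0 \<le> V" "(\<integral>\<^sup>+s. ennreal (indicator {0<..<t} s * (w (t - s) * (1 + s) powr (-\<gamma>))) \<partial>lborel) \<le> ennreal V"
  shows "ennreal \<bar>\<integral>s. indicator {0<..<t} s * (\<integral>y. Yb (x - y) (t - s) * g y s \<partial>lborel) \<partial>lborel\<bar>
     \<le> ennreal C * (ennreal (C0 * V) + (\<integral>\<^sup>+s. \<integral>\<^sup>+y. ennreal ((indicator {0<..<t} s * (w (t - s) * (1 + s) powr (-\<gamma>))) * (k (x - y) * (\<bar>g y s\<bar> * (1 + s) powr \<gamma>))) \<partial>lborel \<partial>lborel))"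
proof -
  note [measurable] = Ym gm km wm
  define W where "W s = indicator {0<..<t} s * (w (t - s) * (1 + s) powr (-\<gamma>))" for s
  define F where "F y s = \<bar>g y s\<bar> * (1 + s) powr \<gamma>" for y s
  have [measurable]: "W \<in> borel_measurable borel" unfolding W_def by measurable
  have [measurable]: "(\<lambda>(y, s). F y s) \<in> borel_measurable (borel \<Otimes>\<^sub>M borel)"
    unfolding F_def by measurable
  have W0: "0 \<le> W s" for s using w0 by (simp add: W_def)
  have F0: "0 \<le> F y s" for y s by (simp add: F_def)
  have "ennreal \<bar>\<integral>s. indicator {0<..<t} s * (\<integral>y. Yb (x - y) (t - s) * g y s \<partial>lborel) \<partial>lborel\<bar>
    \<le> (\<integral>\<^sup>+s. indicator {0<..<t} s * (\<integral>\<^sup>+y. ennreal (\<bar>Yb (x - y) (t - s)\<bar> * \<bar>g y s\<bar>) \<partial>lborel) \<partial>lborel)"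
    by (rule mild_solution_abs_le)
  also have "\<dots> \<le> (\<integral>\<^sup>+s. ennreal C * (ennreal (W s) * (\<integral>\<^sup>+y. ennreal (F y s) \<partial>lborel) + (\<integral>\<^sup>+y. ennreal (W s * (k (x - y) * F y s)) \<partial>lborel)) \<partial>lborel)"
  proof (rule nn_integral_mono)
    fix s :: real
    show "indicator {0<..<t} s * (\<integral>\<^sup>+y. ennreal (\<bar>Yb (x - y) (t - s)\<bar> * \<bar>g y s\<bar>) \<partial>lborel)
      \<le> ennreal C * (ennreal (W s) * (\<integral>\<^sup>+y. ennreal (F y s) \<partial>lborel) + (\<integral>\<^sup>+y. ennreal (W s * (k (x - y) * F y s)) \<partial>lborel))"
    proof (cases "s \<in> {0<..<t}")
      case True
      hence ts: "0 < t - s" "0 < s" by auto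
      have "(\<integral>\<^sup>+y. ennreal (\<bar>Yb (x - y) (t - s)\<bar> * \<bar>g y s\<bar>) \<partial>lborel)
         \<le> (\<integral>\<^sup>+y. ennreal C * (ennreal (W s) * ennreal (F y s) + ennreal (W s * (k (x - y) * F y s))) \<partial>lborel)"
      proof (rule nn_integral_mono_AE, use AE_lborel_reflect[OF dom[OF ts(1)], of x] in eventually_elim)
        case (elim y)
        have "\<bar>Yb (x - y) (t - s)\<bar> * \<bar>g y s\<bar> \<le> C * (w (t - s) * (1 + k (x - y))) * \<bar>g y s\<bar>"
          using elim by (intro mult_right_mono) auto
        also have "\<dots> = C * (w (t - s) * (1 + k (x - y))) * ((1 + s) powr (-\<gamma>) * F y s)"
          using ts by (simp add: F_def powr_minus)
        also have "\<dots> = C * (W s * F y s + W s * (k (x - y) * F y s))"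
          using True by (simp add: W_def algebra_simps)
        finally have "ennreal (\<bar>Yb (x - y) (t - s)\<bar> * \<bar>g y s\<bar>) \<le> ennreal (C * (W s * F y s + W s * (k (x - y) * F y s)))"
          by (rule ennreal_leI)
        also have "\<dots> = ennreal C * (ennreal (W s * F y s) + ennreal (W s * (k (x - y) * F y s)))"
          using C W0[of s] F0[of y s] k0[of "x - y"] by (simp add: ennreal_mult' ennreal_plus)
        finally show ?case using W0[of s] by (simp add: ennreal_mult')
      qed
      also have "\<dots> = ennreal C * (ennreal (W s) * (\<integral>\<^sup>+y. ennreal (F y s) \<partial>lborel) + (\<integral>\<^sup>+y. ennreal (W s * (k (x - y) * F y s)) \<partial>lborel))"
        by (subst nn_integral_cmult, measurable, subst nn_integral_add, measurable, subst nn_integral_cmult, measurable)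
      finally show ?thesis using True by simp
    qed simp
  qed
  also have "\<dots> = ennreal C * ((\<integral>\<^sup>+s. ennreal (W s) * (\<integral>\<^sup>+y. ennreal (F y s) \<partial>lborel) \<partial>lborel) + (\<integral>\<^sup>+s. \<integral>\<^sup>+y. ennreal (W s * (k (x - y) * F y s)) \<partial>lborel \<partial>lborel))"
    by (subst nn_integral_cmult, measurable, subst nn_integral_add, measurable)
  also have "(\<integral>\<^sup>+s. ennreal (W s) * (\<integral>\<^sup>+y. ennreal (F y s) \<partial>lborel) \<partial>lborel) \<le> (\<integral>\<^sup>+s. ennreal (W s) * ennreal C0 \<partial>lborel)"
  proof (rule nn_integral_mono_AE, use C0(2) in eventually_elim)
    case (elim s)
    show ?case
    proof (cases "s \<in> {0<..<t}")
      case True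
      hence "(\<integral>\<^sup>+y. ennreal (F y s) \<partial>lborel) \<le> ennreal C0" using elim by (simp add: F_def)
      thus ?thesis by (intro mult_left_mono) auto
    qed (simp add: W_def)
  qed
  also have "(\<integral>\<^sup>+s. ennreal (W s) * ennreal C0 \<partial>lborel) = (\<integral>\<^sup>+s. ennreal (W s) \<partial>lborel) * ennreal C0" by (rule nn_integral_multc) measurable
  also have "\<dots> \<le> ennreal V * ennreal C0" by (intro mult_right_mono) (use V in \<open>auto simp: W_def\<close>)
  also have "\<dots> = ennreal (C0 * V)" using V(1) C0(1) by (simp add: ennreal_mult'[symmetric] mult.commute)
  finally show ?thesis unfolding W_def F_def by (simp add: mult_left_mono add_right_mono)
qed

text \<open>
  The exponent \<open>d\<close> of the singularity of \<open>k\<close> lies strictly between \<open>N - 2\<beta>\<close>, as the product bound requires,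
  and \<open>N/r\<close>, so that \<open>k \<in> L\<^sup>r\<close>.
\<close>

lemma upper_estimate:
  fixes Y f :: "'a::euclidean_space \<Rightarrow> real \<Rightarrow> real" and p :: ennreal
  assumes a: "0 < \<alpha>" "\<alpha> < 1" and b: "0 < \<beta>" "\<beta> \<le> 1" and N: "4 * \<beta> < real DIM('a)" and p: "1 \<le> p"
    and Y: "is_kernel_Y \<alpha> \<beta> Y" and f: "admissible_source \<beta> \<gamma> p f" and K: "compact K"
  shows "\<exists>C>0. \<forall>t\<ge>2. Lp_norm p K (\<lambda>x. mild_solution Y f x t) \<le> ennreal (C * decay_rate \<alpha> \<gamma> t)"
proof -
  define n where "n = real DIM('a)"
  have fm: "(\<lambda>(x, t). f x t) \<in> borel_measurable (lebesgue_on (UNIV \<times> {0..}))"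
    using f by (simp add: admissible_source_def)
  obtain C0 where C0: "0 < C0" "\<And>t. 0 \<le> t \<Longrightarrow> Lp_norm 1 UNIV (\<lambda>x. f x t) \<le> ennreal (C0 / (1 + t) powr \<gamma>)"
    using f by (auto simp: admissible_source_def)
  have adm: "ennreal (p_crit DIM('a) \<beta>) \<le> p \<longrightarrow>
        (\<exists>q C1. ennreal (q_crit DIM('a) \<beta> p) < q \<and> (C1 > 0 \<and>
           (\<forall>t\<ge>0. Lp_norm q UNIV (\<lambda>x. f x t) \<le> ennreal (C1 * (1 + t) powr (- \<gamma>)))))"
    using f unfolding admissible_source_def by blast
  obtain m r where m: "1 \<le> m" "ennreal m \<le> p" and r: "1 \<le> r" and e: "1 / r + 1 / m = 1 + enn2real (inverse p)"
    and r2: "1 - 2 * \<beta> / n < 1 / r"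
    and mq: "m = 1 \<or> (\<exists>q C1. ennreal m \<le> q \<and> C1 > 0 \<and> (\<forall>t\<ge>0. Lp_norm q UNIV (\<lambda>x. f x t) \<le> ennreal (C1 * (1 + t) powr (- \<gamma>))))"
    using exponent_choice[OF b(1) N p adm] unfolding n_def by blast
  obtain g where gm[measurable]: "(\<lambda>(y, s). g y s) \<in> borel_measurable (borel \<Otimes>\<^sub>M borel)"
    and fg: "AE s in lborel. 0 \<le> s \<longrightarrow> (AE y in lborel. f y s = g y s)"
    by (rule source_borel_representative[OF fm])
  obtain B0 where B0: "0 < B0" "AE s in lborel. 0 \<le> s \<longrightarrow> (\<integral>\<^sup>+y. ennreal ((\<bar>g y s\<bar> * (1 + s) powr \<gamma>) powr 1) \<partial>lborel) \<le> ennreal B0"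
    using source_moment[OF fg C0, of 1] by blast
  obtain B where B: "0 < B" "AE s in lborel. 0 \<le> s \<longrightarrow> (\<integral>\<^sup>+y. ennreal ((\<bar>g y s\<bar> * (1 + s) powr \<gamma>) powr m) \<partial>lborel) \<le> ennreal B"
    using source_moment[OF fg C0 m(1) mq] by blast
  have n0: "0 < n" "2 * \<beta> < n" using N b by (auto simp: n_def)
  define d where "d = (n - 2 * \<beta> + n / r) / 2"
  have nr: "n - 2 * \<beta> < n / r"
  proof -
    have "n * (1 - 2 * \<beta> / n) < n * (1 / r)" using r2 n0 by (intro mult_strict_left_mono) auto
    thus ?thesis using n0 by (simp add: right_diff_distrib)
  qed
  have nr1: "n / r \<le> n" using r n0 by (simp add: pos_divide_le_eq)
  have mid: "x < (x + y) / 2 \<and> (x + y) / 2 < y" if "x < y" for x y :: real using that by simp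
  have d: "n - 2 * \<beta> < d" "d < n / r" using mid[OF nr] by (simp_all only: d_def)
  note d = d less_le_trans[OF d(2) nr1]
  have d0: "0 < d" using d n0 by linarith
  have dr: "0 \<le> d * r" "d * r < n" using d d0 r by (auto simp: pos_less_divide_eq)
  define k where "k z = indicator (cball 0 1) z * norm z powr (-d)" for z :: 'a
  have [measurable]: "cball (0::'a) 1 \<in> sets borel" by simp
  have km[measurable]: "k \<in> borel_measurable borel" unfolding k_def by measurable
  have k0: "0 \<le> k z" for z by (simp add: k_def)
  obtain A where A: "0 < A" "(\<integral>\<^sup>+z. ennreal (indicator (cball 0 1) z * norm z powr (-(d * r))) \<partial>(lborel::'a measure)) \<le> ennreal A"
    using integrable_norm_powr_ball[OF dr[unfolded n_def]] by blast
  have kA: "(\<integral>\<^sup>+z. ennreal (k z powr r) \<partial>lborel) \<le> ennreal A"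
  proof -
    have "(\<integral>\<^sup>+z. ennreal (k z powr r) \<partial>lborel) = (\<integral>\<^sup>+z. ennreal (indicator (cball 0 1) z * norm z powr (-(d * r))) \<partial>(lborel::'a measure))"
      using r by (intro nn_integral_cong) (auto simp: k_def indicator_def powr_powr)
    thus ?thesis using A by simp
  qed
  obtain C \<epsilon> where C: "0 < C" and \<epsilon>: "0 < \<epsilon>" and domY: "\<And>t. 0 < t \<Longrightarrow> AE x in lborel. 
     0 \<le> Y x t \<and> Y x t \<le> C * (time_weight \<alpha> \<epsilon> t * (1 + indicator (cball 0 1) x * norm x powr (-d)))"
    using kernel_dominated[OF a b N Y d(1,3)[unfolded n_def]] by blast
  define Yb where "Yb = positive_time Y"
  have Ybm[measurable]: "(\<lambda>(x, t). Yb x t) \<in> borel_measurable (borel \<Otimes>\<^sub>M borel)"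
    unfolding Yb_def by (rule positive_time_measurable[OF Y])
  have Yb: "Y x t = Yb x t" if "0 < t" for x t using that by (simp add: Yb_def positive_time_def)
  have dom: "AE x in lborel. 0 \<le> Yb x t \<and> Yb x t \<le> C * (time_weight \<alpha> \<epsilon> t * (1 + k x))" if "0 < t" for t
    using domY[OF that] Yb[OF that] by (simp add: k_def)
  obtain C3 where C3: "0 < C3" "\<And>t. 2 \<le> t \<Longrightarrow> 
    (\<integral>\<^sup>+s. ennreal (indicator {0<..<t} s * (time_weight \<alpha> \<epsilon> (t - s) * (1 + s) powr (-\<gamma>))) \<partial>lborel) \<le> ennreal (C3 * decay_rate \<alpha> \<gamma> t)"
    using time_convolution[OF a(1) \<epsilon>, of \<gamma>] by blast
  define ub where "ub t x = (\<integral>s. indicator {0<..<t} s * (\<integral>y. Yb (x - y) (t - s) * g y s \<partial>lborel) \<partial>lborel)" for t x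
  have ubm: "ub t \<in> borel_measurable borel" for t unfolding ub_def by measurable
  have u_eq: "mild_solution Y f x t = ub t x" for x t
    unfolding ub_def by (rule mild_solution_borel[OF Ybm gm Yb fg])
  have ubl: "ub t \<in> borel_measurable (lebesgue_on K)" for t
    using ubm[of t] by (intro measurable_restrict_space1 measurable_completion) simp
  define F where "F y s = \<bar>g y s\<bar> * (1 + s) powr \<gamma>" for y s
  have Fm[measurable]: "(\<lambda>(y, s). F y s) \<in> borel_measurable (borel \<Otimes>\<^sub>M borel)"
    unfolding F_def by measurable
  have F0: "0 \<le> F y s" for y s by (simp add: F_def)
  define W where "W t s = indicator {0<..<t} s * (time_weight \<alpha> \<epsilon> (t - s) * (1 + s) powr (-\<gamma>))" for t s
  have Wm[measurable]: "W t \<in> borel_measurable borel" for t unfolding W_def by measurable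
  have W0: "0 \<le> W t s" for t s by (simp add: W_def time_weight_nonneg)
  define J where "J t x = (\<integral>\<^sup>+s. \<integral>\<^sup>+y. ennreal (W t s * (k (x - y) * F y s)) \<partial>lborel \<partial>lborel)" for t x
  define V where "V t = C3 * decay_rate \<alpha> \<gamma> t" for t
  have V: "0 < V t" "(\<integral>\<^sup>+s. ennreal (W t s) \<partial>lborel) \<le> ennreal (V t)" if "2 \<le> t" for t
    using C3(1) C3(2)[OF that] that by (auto simp: V_def W_def decay_rate_def)
  have split: "ennreal \<bar>ub t x\<bar> \<le> ennreal C * (ennreal (B0 * V t) + J t x)" if t: "2 \<le> t" for t x
    unfolding ub_def J_def W_def F_def
    by (rule mild_solution_split[OF Ybm gm km k0 _ time_weight_nonneg _ dom])
      (use C B0 V[OF t] in \<open>simp_all add: W_def\<close>)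
  have FB: "AE s in lborel. W t s \<noteq> 0 \<longrightarrow> (\<integral>\<^sup>+y. ennreal (F y s powr m) \<partial>lborel) \<le> ennreal B" for t
    using B(2) by eventually_elim (auto simp: W_def F_def)
  show ?thesis
  proof (cases "p = \<infinity>")
    case True
    have e1: "1 / r + 1 / m = 1" using e True by simp
    have Jle: "J t x \<le> ennreal ((A + B) * V t)" if t: "2 \<le> t" for t x
    proof -
      have kA': "(\<integral>\<^sup>+y. ennreal (k (x - y) powr r) \<partial>lborel) \<le> ennreal A"
        using nn_integral_reflect[of "\<lambda>z. ennreal (k z powr r)" x] kA by simp
      have "J t x \<le> (\<integral>\<^sup>+s. ennreal (W t s) * ennreal (A + B) \<partial>lborel)"
        unfolding J_def
      proof (rule nn_integral_mono_AE, use FB[of t] in eventually_elim)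
        case (elim s)
        show ?case
        proof (cases "W t s = 0")
          case False
          have "(\<integral>\<^sup>+y. ennreal (W t s * (k (x - y) * F y s)) \<partial>lborel) \<le> (\<integral>\<^sup>+y. ennreal (W t s) * (ennreal (k (x - y) powr r) + ennreal (F y s powr m)) \<partial>lborel)"
          proof (rule nn_integral_mono)
            fix y
            have "W t s * (k (x - y) * F y s) \<le> W t s * (k (x - y) powr r + F y s powr m)"
              by (intro mult_left_mono product_le_sum_powr k0 F0 m r e1 W0)
            thus "ennreal (W t s * (k (x - y) * F y s)) \<le> ennreal (W t s) * (ennreal (k (x - y) powr r) + ennreal (F y s powr m))"
              using W0[of t s] by (simp add: ennreal_mult'[symmetric] ennreal_plus[symmetric] ennreal_leI del: ennreal_plus)
          qed
          also have "\<dots> = ennreal (W t s) * ((\<integral>\<^sup>+y. ennreal (k (x - y) powr r) \<partial>lborel) + (\<integral>\<^sup>+y. ennreal (F y s powr m) \<partial>lborel))"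
            by (subst nn_integral_cmult, measurable, subst nn_integral_add, measurable)
          also have "\<dots> \<le> ennreal (W t s) * (ennreal A + ennreal B)"
            using elim False kA' by (intro mult_left_mono add_mono) auto
          finally show ?thesis using A B by (simp add: ennreal_plus)
        qed simp
      qed
      also have "\<dots> = (\<integral>\<^sup>+s. ennreal (W t s) \<partial>lborel) * ennreal (A + B)"
        by (rule nn_integral_multc) measurable
      also have "\<dots> \<le> ennreal (V t) * ennreal (A + B)" by (intro mult_right_mono V[OF t]) simp
      also have "\<dots> = ennreal ((A + B) * V t)" using V[OF t] by (simp add: ennreal_mult'[symmetric] mult.commute)
      finally show ?thesis .
    qed
    show ?thesis
    proof (intro exI[of _ "C * (B0 + (A + B)) * C3"] conjI allI impI)
      show "0 < C * (B0 + (A + B)) * C3" using C B0 A B C3 by simp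
      fix t :: real assume t: "2 \<le> t"
      have "Lp_norm \<infinity> K (\<lambda>x. mild_solution Y f x t) \<le> ennreal (C * (B0 + (A + B)) * C3 * decay_rate \<alpha> \<gamma> t)"
        unfolding u_eq
      proof (rule Lp_norm_infinity_le[OF ubl])
        fix x
        have "ennreal \<bar>ub t x\<bar> \<le> ennreal C * (ennreal (B0 * V t) + ennreal ((A + B) * V t))"
          using split[OF t, of x] Jle[OF t, of x] by (meson add_left_mono mult_left_mono order_trans zero_le)
        also have "\<dots> = ennreal (C * (B0 * V t + (A + B) * V t))"
          using C B0 A B V[OF t] by (subst ennreal_mult') (auto simp: ennreal_plus)
        finally have "\<bar>ub t x\<bar> \<le> C * (B0 * V t + (A + B) * V t)"
          using C B0 A B V[OF t] by (subst (asm) ennreal_le_iff) auto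
        thus "\<bar>ub t x\<bar> \<le> C * (B0 + (A + B)) * C3 * decay_rate \<alpha> \<gamma> t"
          by (simp add: V_def algebra_simps)
      qed
      thus "Lp_norm p K (\<lambda>x. mild_solution Y f x t) \<le> ennreal (C * (B0 + (A + B)) * C3 * decay_rate \<alpha> \<gamma> t)" using True by simp
    qed
  next
    case False
    define P where "P = enn2real p"
    have P: "1 \<le> P" "p = ennreal P" using False p unfolding P_def by (cases p; auto)+
    have ip: "enn2real (inverse p) = 1 / P" using P by (simp add: inverse_ennreal divide_inverse)
    have mP: "m \<le> P" using m(2) P by (simp add: ennreal_le_iff)
    have eP: "1 / r + 1 / m = 1 + 1 / P" using e ip by simp
    have rP: "r \<le> P"
    proof -
      have "1 / m \<le> 1" using m by simp
      hence "1 / P \<le> 1 / r" using eP by linarith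
      thus ?thesis using P r by (simp add: field_simps)
    qed
    define D where "D = (A + B) powr (P - 1) * (A * B)"
    have D0: "0 \<le> D" using A B by (simp add: D_def)
    have Kf: "emeasure lborel K = ennreal (measure lborel K)"
      using emeasure_compact_finite[OF K] by (simp add: emeasure_eq_ennreal_measure)
    have Kb[measurable]: "K \<in> sets borel" using K by (simp add: borel_compact)
    define E where "E = (2 * C) powr P * (D + B0 powr P * measure lborel K + 1)"
    have E: "0 < E" using C D0 by (auto simp: E_def intro!: mult_pos_pos add_nonneg_pos add_nonneg_nonneg)
    show ?thesis
    proof (intro exI[of _ "E powr (1 / P) * C3"] conjI allI impI)
      show "0 < E powr (1 / P) * C3" using E C3 by simp
      fix t :: real assume t: "2 \<le> t"
      \<comment> \<open>the part of the solution that exceeds the uniform contribution; it is finite even where \<open>J t x\<close> is not\<close>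
      define u where "u x = max 0 (\<bar>ub t x\<bar> / C - B0 * V t)" for x
      have u0: "0 \<le> u x" for x by (simp add: u_def)
      have uJ: "ennreal (u x) \<le> J t x" for x
      proof (cases "J t x = \<infinity>")
        case False
        then obtain j where j: "J t x = ennreal j" "0 \<le> j" by (cases "J t x") auto
        have "ennreal \<bar>ub t x\<bar> \<le> ennreal C * (ennreal (B0 * V t) + ennreal j)"
          using split[OF t, of x] j by simp
        also have "\<dots> = ennreal (C * (B0 * V t + j))"
          using C B0 V[OF t] j by (subst ennreal_mult') (auto simp: ennreal_plus)
        finally have "\<bar>ub t x\<bar> \<le> C * (B0 * V t + j)"
          using C B0 V[OF t] j by (subst (asm) ennreal_le_iff) auto
        hence "\<bar>ub t x\<bar> / C \<le> B0 * V t + j" using C by (simp add: pos_divide_le_eq mult.commute)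
        hence "u x \<le> j" using j by (simp add: u_def)
        thus ?thesis using j by (simp add: ennreal_leI)
      qed simp
      have "(\<integral>\<^sup>+x. ennreal (u x powr P) \<partial>lborel) \<le> ennreal (((A + B) * V t) powr (P - 1) * (A * B * V t))"
        by (rule convolution_Lp[OF km Fm Wm k0 F0 W0 m(1) mP r rP eP kA A(1) FB B(1) V(2)[OF t] V(1)[OF t] u0 uJ[unfolded J_def]])
      also have "((A + B) * V t) powr (P - 1) * (A * B * V t) = D * V t powr P"
      proof -
        have "V t powr P = V t powr (P - 1) * V t" using V[OF t] by (simp add: powr_diff)
        thus ?thesis by (simp add: D_def powr_mult)
      qed
      finally have uI: "(\<integral>\<^sup>+x. ennreal (u x powr P) \<partial>lborel) \<le> ennreal (D * V t powr P)" .
      have pw: "\<bar>ub t x\<bar> powr P \<le> (2 * C) powr P * (u x powr P + (B0 * V t) powr P)" for x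
      proof -
        define M where "M = max (u x) (B0 * V t)"
        have BV: "0 \<le> B0 * V t" using B0 V[OF t] by simp
        have "\<bar>ub t x\<bar> / C \<le> u x + B0 * V t" by (simp add: u_def)
        also have "\<dots> \<le> 2 * M" by (simp add: M_def)
        finally have "\<bar>ub t x\<bar> \<le> 2 * C * M" using C by (simp add: pos_divide_le_eq mult_ac)
        hence "\<bar>ub t x\<bar> powr P \<le> (2 * C * M) powr P" using P by (intro powr_mono2) auto
        also have "\<dots> = (2 * C) powr P * M powr P" by (rule powr_mult)
        also have "M powr P \<le> u x powr P + (B0 * V t) powr P" by (cases "u x \<le> B0 * V t") (simp_all add: M_def)
        finally show ?thesis by (simp add: mult_left_mono)
      qed
      have um[measurable]: "u \<in> borel_measurable borel" using ubm[of t] unfolding u_def by measurable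
      have "(\<integral>\<^sup>+x. ennreal (\<bar>ub t x\<bar> powr P) \<partial>lebesgue_on K) = (\<integral>\<^sup>+x. ennreal (\<bar>ub t x\<bar> powr P) * indicator K x \<partial>lborel)"
        by (rule nn_integral_lebesgue_on) simp
      also have "\<dots> \<le> (\<integral>\<^sup>+x. ennreal ((2 * C) powr P) * (ennreal (u x powr P) + ennreal ((B0 * V t) powr P) * indicator K x) \<partial>lborel)"
      proof (rule nn_integral_mono)
        fix x
        show "ennreal (\<bar>ub t x\<bar> powr P) * indicator K x \<le> ennreal ((2 * C) powr P) * (ennreal (u x powr P) + ennreal ((B0 * V t) powr P) * indicator K x)"
          using pw[of x] by (cases "x \<in> K") (auto simp: ennreal_mult'[symmetric] ennreal_plus[symmetric] ennreal_leI simp del: ennreal_plus)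
      qed
      also have "\<dots> = ennreal ((2 * C) powr P) * ((\<integral>\<^sup>+x. ennreal (u x powr P) \<partial>lborel) + ennreal ((B0 * V t) powr P) * emeasure lborel K)"
        by (subst nn_integral_cmult, measurable, subst nn_integral_add, measurable, subst nn_integral_cmult_indicator) auto
      also have "\<dots> \<le> ennreal ((2 * C) powr P) * (ennreal (D * V t powr P) + ennreal ((B0 * V t) powr P) * ennreal (measure lborel K))"
        unfolding Kf by (intro mult_left_mono add_mono uI) auto
      also have "\<dots> = ennreal ((2 * C) powr P * (D * V t powr P + (B0 * V t) powr P * measure lborel K))"
        using D0 by (subst ennreal_mult') (auto simp: ennreal_plus ennreal_mult')
      also have "\<dots> \<le> ennreal ((E powr (1 / P) * V t) powr P)"
      proof (rule ennreal_leI)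
        have "(E powr (1 / P) * V t) powr P = E * V t powr P" using E P by (simp add: powr_mult powr_powr)
        also have "\<dots> = (2 * C) powr P * (D * V t powr P + (B0 * V t) powr P * measure lborel K) + (2 * C) powr P * V t powr P"
          by (simp add: E_def powr_mult algebra_simps)
        finally show "(2 * C) powr P * (D * V t powr P + (B0 * V t) powr P * measure lborel K) \<le> (E powr (1 / P) * V t) powr P" by simp
      qed
      finally have I: "(\<integral>\<^sup>+x. ennreal (\<bar>ub t x\<bar> powr P) \<partial>lebesgue_on K) \<le> ennreal ((E powr (1 / P) * V t) powr P)" .
      have "Lp_norm p K (ub t) \<le> ennreal (E powr (1 / P) * V t)"
      proof (rule Lp_norm_finite_le[OF ubl False p])
        show "0 \<le> E powr (1 / P) * V t" using V[OF t] by simp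
        show "(\<integral>\<^sup>+x. ennreal (\<bar>ub t x\<bar> powr enn2real p) \<partial>lebesgue_on K) \<le> ennreal ((E powr (1 / P) * V t) powr enn2real p)"
          unfolding P_def[symmetric] by (rule I)
      qed
      thus "Lp_norm p K (\<lambda>x. mild_solution Y f x t) \<le> ennreal (E powr (1 / P) * C3 * decay_rate \<alpha> \<gamma> t)"
        unfolding u_eq by (simp add: V_def mult.assoc)
    qed
  qed
qed

section \<open>The lower estimate\<close>

text \<open>
  The ball in the source contains the unit ball around every point of \<open>K\<close>, so the solution on \<open>K\<close> is at least
  the time integral of \<open>(1+s)\<^sup>-\<^sup>\<gamma>\<close> times the mass of the kernel at time \<open>t - s\<close> in the unit ball. For \<open>\<gamma> \<le> 1 + \<alpha>\<close> the
  times \<open>s\<close> between \<open>t - 2\<close> and \<open>t - 1\<close> suffice, otherwise those between \<open>0\<close> and \<open>1\<close>.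
\<close>

lemma lower_estimate:
  fixes Y :: "'a::euclidean_space \<Rightarrow> real \<Rightarrow> real" and p :: ennreal and K :: "'a set"
  assumes a: "0 < \<alpha>" "\<alpha> < 1" and b: "0 < \<beta>" "\<beta> \<le> 1" and p: "1 \<le> p"
    and Y: "is_kernel_Y \<alpha> \<beta> Y" and K: "compact K" "0 < emeasure lebesgue K"
  shows "\<exists>f. admissible_source \<beta> \<gamma> p f \<and>
     (\<exists>c>0. \<forall>t\<ge>4. ennreal (c * decay_rate \<alpha> \<gamma> t) \<le> Lp_norm p K (\<lambda>x. mild_solution Y f x t))"
proof -
  obtain R0 where R0: "0 < R0" "\<And>x. x \<in> K \<Longrightarrow> norm x \<le> R0"
    using compact_imp_bounded[OF K(1)] by (auto simp: bounded_pos)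
  define R where "R = R0 + 1"
  define f where "f = (\<lambda>(y::'a) (s::real). (1 + s) powr (-\<gamma>) * indicator (cball 0 R) y)"
  have [measurable]: "cball (0::'a) r \<in> sets borel" for r by simp
  have fm[measurable]: "(\<lambda>(y, s). f y s) \<in> borel_measurable (borel \<Otimes>\<^sub>M borel)"
    unfolding f_def by measurable
  have f0: "0 \<le> f y s" for y s by (simp add: f_def)
  define vol where "vol = measure lborel (cball (0::'a) R)"
  have vol: "0 < vol" unfolding vol_def using R0 by (simp add: R_def content_cball_pos)
  have emv: "emeasure lborel (cball (0::'a) R) = ennreal vol"
    unfolding vol_def using emeasure_lborel_cball_finite[of "0::'a" R] by (intro emeasure_eq_ennreal_measure) auto
  have fml: "(\<lambda>x. f x t) \<in> borel_measurable (lebesgue_on UNIV)" for t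
  proof -
    have "(\<lambda>x. f x t) \<in> borel_measurable lborel" by measurable
    thus ?thesis unfolding lebesgue_on_UNIV_eq by (rule measurable_completion)
  qed
  have adm: "admissible_source \<beta> \<gamma> p f"
    unfolding admissible_source_def
  proof (intro conjI impI)
    have "(\<lambda>(x, t). f x t) \<in> borel_measurable (borel :: ('a \<times> real) measure)"
      using fm by (simp add: borel_prod)
    thus "(\<lambda>(x, t). f x t) \<in> borel_measurable (lebesgue_on (UNIV \<times> {0..}))"
      by (intro measurable_restrict_space1 measurable_completion) simp
    show "\<exists>C0>0. \<forall>t\<ge>0. Lp_norm 1 UNIV (\<lambda>x. f x t) \<le> ennreal (C0 / (1 + t) powr \<gamma>)"
    proof (intro exI[of _ vol] conjI allI impI vol)
      fix t :: real assume t: "0 \<le> t"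
      show "Lp_norm 1 UNIV (\<lambda>x. f x t) \<le> ennreal (vol / (1 + t) powr \<gamma>)"
      proof (rule Lp_norm_finite_le[OF fml])
        have "(\<integral>\<^sup>+x. ennreal (\<bar>f x t\<bar> powr enn2real 1) \<partial>lebesgue_on UNIV) = (\<integral>\<^sup>+x. ennreal ((1 + t) powr (-\<gamma>)) * indicator (cball 0 R) x \<partial>(lborel::'a measure))"
          unfolding lebesgue_on_UNIV_eq nn_integral_completion
            by (intro nn_integral_cong) (simp add: f_def indicator_def)
        also have "\<dots> = ennreal ((1 + t) powr (-\<gamma>)) * ennreal vol"
          by (subst nn_integral_cmult_indicator) (auto simp: emv)
        also have "\<dots> = ennreal ((vol / (1 + t) powr \<gamma>) powr enn2real 1)"
          using vol by (simp add: ennreal_mult'[symmetric] powr_minus divide_inverse mult.commute)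
        finally show "(\<integral>\<^sup>+x. ennreal (\<bar>f x t\<bar> powr enn2real 1) \<partial>lebesgue_on UNIV) \<le> ennreal ((vol / (1 + t) powr \<gamma>) powr enn2real 1)" by simp
      qed (use vol in auto)
    qed
    show "\<exists>q C1. ennreal (q_crit DIM('a) \<beta> p) < q \<and> C1 > 0 \<and> (\<forall>t\<ge>0. Lp_norm q UNIV (\<lambda>x. f x t) \<le> ennreal (C1 * (1 + t) powr (- \<gamma>)))"
    proof (intro exI[of _ \<infinity>] exI[of _ 1] conjI allI impI)
      fix t :: real
      show "Lp_norm \<infinity> UNIV (\<lambda>x. f x t) \<le> ennreal (1 * (1 + t) powr (- \<gamma>))"
        by (rule Lp_norm_infinity_le[OF fml]) (simp add: f_def indicator_def)
    qed auto
  qed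
  obtain c0 where c0: "0 < c0" "\<And>t. 1 \<le> t \<Longrightarrow> ennreal (c0 * t powr (-(1 + \<alpha>))) \<le> (\<integral>\<^sup>+x. ennreal (Y x t) * indicator (cball 0 1) x \<partial>lborel)"
    using kernel_ball_mass[OF a b Y] by blast
  obtain c1 where c1: "0 \<le> c1" "\<And>t. 0 < t \<Longrightarrow> (\<integral>\<^sup>+x. ennreal \<bar>Y x t\<bar> \<partial>lborel) = ennreal (c1 * t powr (\<alpha> - 1))"
    using kernel_mass[OF Y] by blast
  define Yb where "Yb = positive_time Y"
  have Ybm[measurable]: "(\<lambda>(x, t). Yb x t) \<in> borel_measurable (borel \<Otimes>\<^sub>M borel)"
    unfolding Yb_def by (rule positive_time_measurable[OF Y])
  have Yb: "Y x t = Yb x t" if "0 < t" for x t using that by (simp add: Yb_def positive_time_def)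
  have Y0: "AE x in lborel. 0 \<le> Yb x t" if "0 < t" for t
    using Y that by (simp add: is_kernel_Y_def Yb[OF that, symmetric])
  define S where "S x t s = (\<integral>\<^sup>+y. ennreal (Yb (x - y) (t - s) * f y s) \<partial>lborel)" for x t s
  have Sle: "S x t s \<le> ennreal (c1 * (t - s) powr (\<alpha> - 1) * (1 + s) powr (-\<gamma>))" if s: "0 < s" "s < t" for x t s
  proof -
    have "S x t s \<le> (\<integral>\<^sup>+y. ennreal \<bar>Yb (x - y) (t - s)\<bar> * ennreal ((1 + s) powr (-\<gamma>)) \<partial>lborel)"
      unfolding S_def
    proof (rule nn_integral_mono)
      fix y
      have "Yb (x - y) (t - s) * f y s \<le> \<bar>Yb (x - y) (t - s)\<bar> * (1 + s) powr (-\<gamma>)"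
        by (intro mult_mono) (auto simp: f_def indicator_def)
      thus "ennreal (Yb (x - y) (t - s) * f y s) \<le> ennreal \<bar>Yb (x - y) (t - s)\<bar> * ennreal ((1 + s) powr (-\<gamma>))"
        by (simp add: ennreal_mult'[symmetric] ennreal_leI)
    qed
    also have "\<dots> = (\<integral>\<^sup>+y. ennreal \<bar>Yb (x - y) (t - s)\<bar> \<partial>lborel) * ennreal ((1 + s) powr (-\<gamma>))"
      by (rule nn_integral_multc) measurable
    also have "(\<integral>\<^sup>+y. ennreal \<bar>Yb (x - y) (t - s)\<bar> \<partial>lborel) = (\<integral>\<^sup>+z. ennreal \<bar>Yb z (t - s)\<bar> \<partial>lborel)"
      by (rule nn_integral_reflect[of "\<lambda>z. ennreal \<bar>Yb z (t - s)\<bar>" x]) measurable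
    also have "\<dots> = ennreal (c1 * (t - s) powr (\<alpha> - 1))" using c1(2)[of "t - s"] s by (simp add: Yb)
    finally show ?thesis using c1 by (simp add: ennreal_mult'[symmetric])
  qed
  have Sge: "ennreal (c0 * (t - s) powr (-(1 + \<alpha>)) * (1 + s) powr (-\<gamma>)) \<le> S x t s" if x: "x \<in> K" and s: "0 < s" "1 \<le> t - s" for x t s
  proof -
    have "ennreal (c0 * (t - s) powr (-(1 + \<alpha>)) * (1 + s) powr (-\<gamma>)) = ennreal (c0 * (t - s) powr (-(1 + \<alpha>))) * ennreal ((1 + s) powr (-\<gamma>))"
      using c0 by (intro ennreal_mult') simp
    also have "\<dots> \<le> (\<integral>\<^sup>+z. ennreal (Y z (t - s)) * indicator (cball 0 1) z \<partial>lborel) * ennreal ((1 + s) powr (-\<gamma>))"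
      by (intro mult_right_mono c0(2) s) simp
    also have "(\<integral>\<^sup>+z. ennreal (Y z (t - s)) * indicator (cball 0 1) z \<partial>lborel) = (\<integral>\<^sup>+z. ennreal (Yb z (t - s)) * indicator (cball 0 1) z \<partial>lborel)"
      using s by (intro nn_integral_cong) (simp add: Yb)
    also have "\<dots> = (\<integral>\<^sup>+y. ennreal (Yb (x - y) (t - s)) * indicator (cball 0 1) (x - y) \<partial>lborel)"
      by (rule nn_integral_reflect[of "\<lambda>z. ennreal (Yb z (t - s)) * indicator (cball 0 1) z" x, symmetric]) measurable
    also have "\<dots> * ennreal ((1 + s) powr (-\<gamma>)) = (\<integral>\<^sup>+y. ennreal (Yb (x - y) (t - s)) * indicator (cball 0 1) (x - y) * ennreal ((1 + s) powr (-\<gamma>)) \<partial>lborel)"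
      by (rule nn_integral_multc[symmetric]) measurable
    also have "\<dots> \<le> S x t s" unfolding S_def
    proof (rule nn_integral_mono)
      fix y
      show "ennreal (Yb (x - y) (t - s)) * indicator (cball 0 1) (x - y) * ennreal ((1 + s) powr (-\<gamma>)) \<le> ennreal (Yb (x - y) (t - s) * f y s)"
      proof (cases "x - y \<in> cball 0 1")
        case True
        have "norm y \<le> norm x + norm (x - y)" using norm_triangle_ineq4[of x "x - y"] by simp
        hence "norm y \<le> R" using True R0(2)[OF x] by (simp add: R_def)
        thus ?thesis using True by (simp add: f_def ennreal_mult''[symmetric])
      qed simp
    qed
    finally show ?thesis .
  qed
  have sol: "ennreal (mild_solution Y f x t) = (\<integral>\<^sup>+s. indicator {0<..<t} s * S x t s \<partial>lborel)" if t: "0 < t" for x t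
  proof -
    define I where "I s = indicator {0<..<t} s * (\<integral>y. Yb (x - y) (t - s) * f y s \<partial>lborel)" for s
    have Im: "I \<in> borel_measurable borel" unfolding I_def by measurable
    have I: "ennreal (I s) = indicator {0<..<t} s * S x t s" "0 \<le> I s" for s
    proof -
      have "ennreal (I s) = indicator {0<..<t} s * S x t s \<and> 0 \<le> I s"
      proof (cases "s \<in> {0<..<t}")
        case True
        hence s: "0 < s" "s < t" by auto
        have ae: "AE y in lborel. 0 \<le> Yb (x - y) (t - s) * f y s"
          using AE_lborel_reflect[OF Y0[of "t - s"], of x] s by (auto simp: f0 elim!: eventually_mono)
        have Sf: "S x t s < \<infinity>" using Sle[OF s, of x] by (rule order_le_less_trans) simp
        have "integrable lborel (\<lambda>y. Yb (x - y) (t - s) * f y s)"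
          by (rule integrableI_nonneg) (use ae Sf in \<open>auto simp: S_def\<close>)
        hence "S x t s = ennreal (\<integral>y. Yb (x - y) (t - s) * f y s \<partial>lborel)"
          unfolding S_def using ae by (rule nn_integral_eq_integral)
        moreover have "0 \<le> (\<integral>y. Yb (x - y) (t - s) * f y s \<partial>lborel)"
          using ae by (rule integral_nonneg_AE)
        ultimately show ?thesis using True by (simp add: I_def)
      qed (simp add: I_def)
      thus "ennreal (I s) = indicator {0<..<t} s * S x t s" "0 \<le> I s" by auto
    qed
    have fin: "(\<integral>\<^sup>+s. ennreal (I s) \<partial>lborel) < \<infinity>"
    proof -
      have "(\<integral>\<^sup>+s. ennreal (I s) \<partial>lborel) \<le> (\<integral>\<^sup>+s. ennreal (indicator {0<..<t} s * (c1 * (t - s) powr (\<alpha> - 1) * (1 + s) powr (-\<gamma>))) \<partial>lborel)"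
        using Sle by (intro nn_integral_mono) (auto simp: I indicator_def)
      also have "\<dots> < \<infinity>" by (rule time_mass_finite[OF a(1) t])
      finally show ?thesis .
    qed
    have "integrable lborel I" by (rule integrableI_nonneg) (use Im I fin in auto)
    hence "(\<integral>\<^sup>+s. ennreal (I s) \<partial>lborel) = ennreal (\<integral>s. I s \<partial>lborel)"
      using I by (intro nn_integral_eq_integral) auto
    moreover have "mild_solution Y f x t = (\<integral>s. I s \<partial>lborel)"
      unfolding I_def by (rule mild_solution_borel[OF Ybm fm Yb]) auto
    ultimately show ?thesis by (simp add: I)
  qed
  have low: "ennreal L \<le> ennreal (mild_solution Y f x t)"
    if x: "x \<in> K" and ab: "0 \<le> l" "l + 1 \<le> t - 1" and L: "\<And>s. l < s \<Longrightarrow> s < l + 1 \<Longrightarrow> L \<le> c0 * (t - s) powr (-(1 + \<alpha>)) * (1 + s) powr (-\<gamma>)" for x t l L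
  proof -
    have "ennreal L = (\<integral>\<^sup>+s. ennreal L * indicator {l<..<l + 1} s \<partial>lborel)"
      by (subst nn_integral_cmult_indicator) auto
    also have "\<dots> \<le> (\<integral>\<^sup>+s. indicator {0<..<t} s * S x t s \<partial>lborel)"
    proof (rule nn_integral_mono)
      fix s :: real
      show "ennreal L * indicator {l<..<l + 1} s \<le> indicator {0<..<t} s * S x t s"
      proof (cases "s \<in> {l<..<l + 1}")
        case True
        hence "ennreal L \<le> ennreal (c0 * (t - s) powr (-(1 + \<alpha>)) * (1 + s) powr (-\<gamma>))"
          using L by (intro ennreal_leI) auto
        also have "\<dots> \<le> S x t s" using True ab by (intro Sge x) auto
        finally show ?thesis using True ab by simp
      qed simp
    qed
    also have "\<dots> = ennreal (mild_solution Y f x t)" using ab by (intro sol[symmetric]) simp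
    finally show ?thesis .
  qed
  define c2 where "c2 = c0 * (2 powr (-(1 + \<alpha>)) * 2 powr (-\<bar>\<gamma>\<bar>))"
  have c2: "0 < c2" using c0 by (simp add: c2_def)
  have lower: "c2 * decay_rate \<alpha> \<gamma> t \<le> mild_solution Y f x t" if t: "4 \<le> t" and x: "x \<in> K" for t x
  proof -
    have "ennreal (c2 * decay_rate \<alpha> \<gamma> t) \<le> ennreal (mild_solution Y f x t)"
    proof (cases "\<gamma> \<le> 1 + \<alpha>")
      case True
      show ?thesis
      proof (rule low[OF x, of "t - 2"])
        fix s assume s: "t - 2 < s" "s < t - 2 + 1"
        have "(2::real) powr (-(1 + \<alpha>)) \<le> (t - s) powr (-(1 + \<alpha>))"
          using s a by (intro powr_mono2') auto
        moreover have "2 powr (-\<bar>\<gamma>\<bar>) * t powr (-\<gamma>) \<le> (1 + s) powr (-\<gamma>)"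
        proof -
          have "(1 + s) powr \<gamma> \<le> 2 powr \<bar>\<gamma>\<bar> * t powr \<gamma>"
            by (rule powr_le_of_comparable) (use s t in auto)
          hence "inverse (2 powr \<bar>\<gamma>\<bar> * t powr \<gamma>) \<le> inverse ((1 + s) powr \<gamma>)"
            using s t by (intro le_imp_inverse_le) auto
          thus ?thesis by (simp add: powr_minus)
        qed
        ultimately have "2 powr (-(1 + \<alpha>)) * (2 powr (-\<bar>\<gamma>\<bar>) * t powr (-\<gamma>)) \<le> (t - s) powr (-(1 + \<alpha>)) * (1 + s) powr (-\<gamma>)"
          by (intro mult_mono) auto
        hence "c0 * (2 powr (-(1 + \<alpha>)) * (2 powr (-\<bar>\<gamma>\<bar>) * t powr (-\<gamma>))) \<le> c0 * ((t - s) powr (-(1 + \<alpha>)) * (1 + s) powr (-\<gamma>))"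
          using c0 by (intro mult_left_mono) auto
        thus "c2 * decay_rate \<alpha> \<gamma> t \<le> c0 * (t - s) powr (-(1 + \<alpha>)) * (1 + s) powr (-\<gamma>)"
          using True by (simp add: c2_def decay_rate_def mult.assoc)
      qed (use t in auto)
    next
      case False
      hence g: "0 < \<gamma>" using a by simp
      show ?thesis
      proof (rule low[OF x, of 0])
        fix s :: real assume s: "0 < s" "s < 0 + 1"
        have "t powr (-(1 + \<alpha>)) \<le> (t - s) powr (-(1 + \<alpha>))" using s a t by (intro powr_mono2') auto
        moreover have "2 powr (-\<bar>\<gamma>\<bar>) \<le> (1 + s) powr (-\<gamma>)"
          using s g by (simp, intro powr_mono2') auto
        ultimately have "t powr (-(1 + \<alpha>)) * 2 powr (-\<bar>\<gamma>\<bar>) \<le> (t - s) powr (-(1 + \<alpha>)) * (1 + s) powr (-\<gamma>)"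
          by (intro mult_mono) auto
        moreover have "(2::real) powr (-(1 + \<alpha>)) * (t powr (-(1 + \<alpha>)) * 2 powr (-\<bar>\<gamma>\<bar>)) \<le> 1 * (t powr (-(1 + \<alpha>)) * 2 powr (-\<bar>\<gamma>\<bar>))"
          using a powr_mono[of "-(1 + \<alpha>)" 0 2] by (intro mult_right_mono) auto
        ultimately have "c0 * (2 powr (-(1 + \<alpha>)) * (t powr (-(1 + \<alpha>)) * 2 powr (-\<bar>\<gamma>\<bar>))) \<le> c0 * ((t - s) powr (-(1 + \<alpha>)) * (1 + s) powr (-\<gamma>))"
          using c0 by (intro mult_left_mono) auto
        thus "c2 * decay_rate \<alpha> \<gamma> t \<le> c0 * (t - s) powr (-(1 + \<alpha>)) * (1 + s) powr (-\<gamma>)"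
          using False by (simp add: c2_def decay_rate_def mult_ac)
      qed (use t in auto)
    qed
    moreover have "0 < c2 * decay_rate \<alpha> \<gamma> t" using c2 t by (simp add: decay_rate_def)
    ultimately show ?thesis by (metis ennreal_le_iff2 not_le)
  qed
  define mu where "mu = (if p = \<infinity> then 1 else measure lebesgue K powr (1 / enn2real p))"
  have "K \<in> lmeasurable" by (rule lmeasurable_compact[OF K(1)])
  hence "emeasure lebesgue K \<noteq> \<infinity>" by (auto simp: fmeasurable_def)
  hence "emeasure lebesgue K = ennreal (measure lebesgue K)" by (simp add: emeasure_eq_ennreal_measure)
  hence "0 < measure lebesgue K" using K(2) by simp
  hence mu: "0 < mu" by (simp add: mu_def)
  show ?thesis
  proof (intro exI[of _ f] conjI adm exI[of _ "c2 * mu"] allI impI)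
    show "0 < c2 * mu" using c2 mu by simp
    fix t :: real assume t: "4 \<le> t"
    have "ennreal (c2 * decay_rate \<alpha> \<gamma> t * mu) \<le> Lp_norm p K (\<lambda>x. mild_solution Y f x t)"
      unfolding mu_def by (rule Lp_norm_ge[OF K p]) (use c2 t lower in \<open>auto simp: decay_rate_def\<close>)
    thus "ennreal (c2 * mu * decay_rate \<alpha> \<gamma> t) \<le> Lp_norm p K (\<lambda>x. mild_solution Y f x t)"
      by (simp add: mult_ac)
  qed
qed

theorem theorem1p2:
  fixes \<alpha> \<beta> \<gamma> :: real and p :: ennreal
    and Y :: "'a::euclidean_space \<Rightarrow> real \<Rightarrow> real"
  assumes "0 < \<alpha>" "\<alpha> < 1" "0 < \<beta>" "\<beta> \<le> 1"
    and "real DIM('a) > 4 * \<beta>"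
    and "1 \<le> p"
    and "is_kernel_Y \<alpha> \<beta> Y"
  shows "(\<forall>f. admissible_source \<beta> \<gamma> p f \<longrightarrow>
            (\<forall>t>0. mild_solution_converges Y f t) \<and>
            (\<forall>K. compact K \<longrightarrow>
               (\<exists>C>0. \<exists>t0\<ge>2. \<forall>t\<ge>t0.
                  Lp_norm p K (\<lambda>x. mild_solution Y f x t) \<le> ennreal (C * decay_rate \<alpha> \<gamma> t))))
       \<and> (\<forall>K::'a set. compact K \<and> emeasure lebesgue K > 0 \<longrightarrow>
            (\<exists>f. admissible_source \<beta> \<gamma> p f \<and>
               (\<exists>c>0. \<exists>t1\<ge>2. \<forall>t\<ge>t1.
                  Lp_norm p K (\<lambda>x. mild_solution Y f x t) \<ge> ennreal (c * decay_rate \<alpha> \<gamma> t))))"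
proof (intro conjI allI impI)
  fix f :: "'a \<Rightarrow> real \<Rightarrow> real" assume f: "admissible_source \<beta> \<gamma> p f"
  have fm: "(\<lambda>(x, t). f x t) \<in> borel_measurable (lebesgue_on (UNIV \<times> {0..}))"
    using f by (simp add: admissible_source_def)
  obtain C0 where C0: "0 < C0" "\<And>t. 0 \<le> t \<Longrightarrow> Lp_norm 1 UNIV (\<lambda>x. f x t) \<le> ennreal (C0 / (1 + t) powr \<gamma>)"
    using f by (auto simp: admissible_source_def)
  show "mild_solution_converges Y f t" if "0 < t" for t
    by (rule mild_solution_converges_of_L1[OF assms(1,7) that fm C0])
  fix K :: "'a set" assume K: "compact K"
  show "\<exists>C>0. \<exists>t0\<ge>2. \<forall>t\<ge>t0. Lp_norm p K (\<lambda>x. mild_solution Y f x t) \<le> ennreal (C * decay_rate \<alpha> \<gamma> t)"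
    using upper_estimate[OF assms(1-4) _ assms(6,7) f K] assms(5) by (meson order_refl)
next
  fix K :: "'a set" assume K: "compact K \<and> emeasure lebesgue K > 0"
  obtain f c where "admissible_source \<beta> \<gamma> p f" "0 < c"
    "\<And>t. 4 \<le> t \<Longrightarrow> ennreal (c * decay_rate \<alpha> \<gamma> t) \<le> Lp_norm p K (\<lambda>x. mild_solution Y f x t)"
    using lower_estimate[OF assms(1-4,6,7), of K \<gamma>] K by blast
  thus "\<exists>f. admissible_source \<beta> \<gamma> p f \<and>
               (\<exists>c>0. \<exists>t1\<ge>2. \<forall>t\<ge>t1.
                  Lp_norm p K (\<lambda>x. mild_solution Y f x t) \<ge> ennreal (c * decay_rate \<alpha> \<gamma> t))"
    by (intro exI[of _ f] conjI exI[of _ c] exI[of _ 4]) auto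
qed

end
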